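(* Let $\mathbb{A}$ be a symmetric strict monoidal category and let $\mathbf{H}\,\mathcal{C}(\mathbb{A})$ be the strict monoidal category of horizontal cells of its free cornering. There are strong monoidal functors $(-)^\circ:\mathbb{A}\to\mathbf{H}\,\mathcal{C}(\mathbb{A})$ and $(-)^\bullet:\mathbb{A}^{\mathsf{op}}\to\mathbf{H}\,\mathcal{C}(\mathbb{A})$, sending an object $A$ to $A^\circ$ and $A^\bullet$ respectively, and defined on $f:A\to B$ of $\mathbb{A}$ as follows: $f^\circ:A^\circ\to B^\circ$ is the vertical composite, from top to bottom, of $r^\circ_A$, $\ulcorner f\urcorner$, $s^\circ_B$; and $f^\bullet:B^\bullet\to A^\bullet$ is the vertical composite, from top to bottom, of $r^\bullet_A$, $\ulcorner f\urcorner$, $s^\bullet_B$. Further, each of these functors is full and faithful.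
   Context: Single-object double categories. A single-object double category $\mathbb{D}$ consists of a monoid $(\mathbb{D}_H,\otimes,I)$ of horizontal edges, a monoid $(\mathbb{D}_V,\otimes,I)$ of vertical edges, and cells $\alpha$, each with a top and a bottom boundary in $\mathbb{D}_H$ and a left and a right boundary in $\mathbb{D}_V$. If the right boundary of $\alpha$ equals the left boundary of $\beta$ there is a horizontal composite $\alpha\vert\beta$ (top/bottom boundaries are multiplied in the order $\alpha,\beta$; left boundary that of $\alpha$, right boundary that of $\beta$). If the bottom boundary of $\alpha$ equals the top boundary of $\beta$ there is a vertical composite $\frac{\alpha}{\beta}$ (left/right boundaries multiplied in the order $\alpha,\beta$; top that of $\alpha$, bottom that of $\beta$). Both compositions are associative and unital, with identity cells $1_A$ for $A\in\mathbb{D}_H$ (top $=$ bottom $=A$, left $=$ right $=I$; identities for vertical composition) and $1_X$ for $X\in\mathbb{D}_V$ (left $=$ right $=X$, top $=$ bottom $=I$; identities for horizontal composition), with $1_A\vert 1_B=1_{A\otimes B}$, $\frac{1_X}{1_Y}=1_{X\otimes Y}$, the two identity cells on $I$ coincide, and the interchange law $\frac{\alpha}{\beta}\big\vert\frac{\gamma}{\delta}=\frac{\alpha\vert\gamma}{\beta\vert\delta}$ holds. Horizontal cells. $\mathbf{H}\mathbb{D}$ is the strict monoidal category with object set $\mathbb{D}_V$, whose morphisms $X\to Y$ are cells with left boundary $X$, right boundary $Y$ and top and bottom boundary $I$; composition is horizontal composition, and the tensor product is vertical composition, $h\otimes k=\frac{h}{k}$. Free cornering. For a symmetric strict monoidal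 category $\mathbb{A}$ (with object set $\mathbb{A}_0$), $\mathcal{C}(\mathbb{A})$ is the free single-object double category determined by: horizontal edge monoid $(\mathbb{A}_0,\otimes,I)$; vertical edge monoid the free monoid $\mathbb{A}^{\circ\bullet}=(\mathbb{A}_0\times\{\circ,\bullet\})^*$, with generators written $A^\circ$, $A^\bullet$, product written $\otimes$ and unit $I$; generating cells, for each $A\in\mathbb{A}_0$, the corners (boundaries not mentioned are $I$) - $s^\circ_A$: top $A$, right $A^\circ$; $\quad r^\circ_A$: left $A^\circ$, bottom $A$; - $s^\bullet_A$: top $A$, left $A^\bullet$; $\quad r^\bullet_A$: right $A^\bullet$, bottom $A$; and, for each morphism $f:A\to B$ of $\mathbb{A}$, a cell $\ulcorner f\urcorner$ with top $A$, bottom $B$; subject to the yanking equations $s^\circ_A\vert r^\circ_A=1_A$, $\frac{r^\circ_A}{s^\circ_A}=1_{A^\circ}$, $r^\bullet_A\vert s^\bullet_A=1_A$, $\frac{r^\bullet_A}{s^\bullet_A}=1_{A^\bullet}$, and the equations $\frac{\ulcorner f\urcorner}{\ulcorner g\urcorner}=\ulcorner f;g\urcorner$ (for composable $f,g$; $f;g$ is "first $f$ then $g$"), $\ulcorner 1_A\urcorner=1_A$, $\ulcorner f\urcorner\vert\ulcorner g\urcorner=\ulcorner f\otimes g\urcorner$. $\mathbb{A}^{\mathsf{op}}$ carries the tensor product of $\mathbb{A}$ (same order of factors). *)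

theory Defs
  imports "HOL-Algebra.Group"
begin

section \<open>Strict monoidal categories\<close>

text \<open>Composition \<^term>\<open>seq\<close> is written in diagrammatic order: first the left argument, then
  the right one.\<close>

record ('o, 'm) moncat =
  obj :: "'o monoid"
  mor :: "'m set"
  src :: "'m \<Rightarrow> 'o"
  tgt :: "'m \<Rightarrow> 'o"
  ident :: "'o \<Rightarrow> 'm"
  seq :: "'m \<Rightarrow> 'm \<Rightarrow> 'm"
  tens :: "'m \<Rightarrow> 'm \<Rightarrow> 'm"

definition homs :: "('o, 'm) moncat \<Rightarrow> 'o \<Rightarrow> 'o \<Rightarrow> 'm set" where
  "homs C A B = {f \<in> mor C. src C f = A \<and> tgt C f = B}"

locale strict_monoidal_category =
  fixes C :: "('o, 'm) moncat"
  assumes obj_monoid: "monoid (obj C)"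
    and src_obj: "f \<in> mor C \<Longrightarrow> src C f \<in> carrier (obj C)"
    and tgt_obj: "f \<in> mor C \<Longrightarrow> tgt C f \<in> carrier (obj C)"
    and ident_homs: "A \<in> carrier (obj C) \<Longrightarrow> ident C A \<in> homs C A A"
    and seq_homs: "\<lbrakk>f \<in> homs C X Y; g \<in> homs C Y Z\<rbrakk> \<Longrightarrow> seq C f g \<in> homs C X Z"
    and seq_assoc: "\<lbrakk>f \<in> homs C W X; g \<in> homs C X Y; h \<in> homs C Y Z\<rbrakk>
      \<Longrightarrow> seq C (seq C f g) h = seq C f (seq C g h)"
    and seq_ident_left: "f \<in> homs C X Y \<Longrightarrow> seq C (ident C X) f = f"
    and seq_ident_right: "f \<in> homs C X Y \<Longrightarrow> seq C f (ident C Y) = f"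
    and tens_homs: "\<lbrakk>f \<in> homs C X Y; g \<in> homs C X' Y'\<rbrakk>
      \<Longrightarrow> tens C f g \<in> homs C (X \<otimes>\<^bsub>obj C\<^esub> X') (Y \<otimes>\<^bsub>obj C\<^esub> Y')"
    and tens_ident: "\<lbrakk>X \<in> carrier (obj C); Y \<in> carrier (obj C)\<rbrakk>
      \<Longrightarrow> tens C (ident C X) (ident C Y) = ident C (X \<otimes>\<^bsub>obj C\<^esub> Y)"
    and tens_seq: "\<lbrakk>f \<in> homs C X Y; g \<in> homs C Y Z; f' \<in> homs C X' Y'; g' \<in> homs C Y' Z'\<rbrakk>
      \<Longrightarrow> tens C (seq C f g) (seq C f' g') = seq C (tens C f f') (tens C g g')"
    and tens_assoc: "\<lbrakk>f \<in> mor C; g \<in> mor C; h \<in> mor C\<rbrakk>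
      \<Longrightarrow> tens C (tens C f g) h = tens C f (tens C g h)"
    and tens_unit_left: "f \<in> mor C \<Longrightarrow> tens C (ident C \<one>\<^bsub>obj C\<^esub>) f = f"
    and tens_unit_right: "f \<in> mor C \<Longrightarrow> tens C f (ident C \<one>\<^bsub>obj C\<^esub>) = f"

definition is_iso :: "('o, 'm) moncat \<Rightarrow> 'm \<Rightarrow> bool" where
  "is_iso C f \<longleftrightarrow> f \<in> mor C \<and> (\<exists>g \<in> homs C (tgt C f) (src C f).
      seq C f g = ident C (src C f) \<and> seq C g f = ident C (tgt C f))"

text \<open>The second hexagon, the unit conditions on the braiding \<^term>\<open>\<sigma>\<close> and its invertibility
  follow from these axioms.\<close>

locale symmetric_strict_monoidal_category = strict_monoidal_category C
  for C :: "('o, 'm) moncat" +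
  fixes \<sigma> :: "'o \<Rightarrow> 'o \<Rightarrow> 'm"
  assumes braid_homs: "\<lbrakk>X \<in> carrier (obj C); Y \<in> carrier (obj C)\<rbrakk>
      \<Longrightarrow> \<sigma> X Y \<in> homs C (X \<otimes>\<^bsub>obj C\<^esub> Y) (Y \<otimes>\<^bsub>obj C\<^esub> X)"
    and braid_natural: "\<lbrakk>f \<in> homs C X Y; g \<in> homs C X' Y'\<rbrakk>
      \<Longrightarrow> seq C (tens C f g) (\<sigma> Y Y') = seq C (\<sigma> X X') (tens C g f)"
    and braid_symmetric: "\<lbrakk>X \<in> carrier (obj C); Y \<in> carrier (obj C)\<rbrakk>
      \<Longrightarrow> seq C (\<sigma> X Y) (\<sigma> Y X) = ident C (X \<otimes>\<^bsub>obj C\<^esub> Y)"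
    and braid_hexagon: "\<lbrakk>X \<in> carrier (obj C); Y \<in> carrier (obj C); Z \<in> carrier (obj C)\<rbrakk>
      \<Longrightarrow> \<sigma> (X \<otimes>\<^bsub>obj C\<^esub> Y) Z
        = seq C (tens C (ident C X) (\<sigma> Y Z)) (tens C (\<sigma> X Z) (ident C Y))"

definition opposite :: "('o, 'm) moncat \<Rightarrow> ('o, 'm) moncat" where
  "opposite C = C\<lparr>src := tgt C, tgt := src C, seq := (\<lambda>f g. seq C g f)\<rparr>"


section \<open>Strong monoidal functors\<close>

locale strong_monoidal_functor =
  source: strict_monoidal_category C + target: strict_monoidal_category D
  for C :: "('o, 'm) moncat" and D :: "('p, 'n) moncat" +
  fixes F0 :: "'o \<Rightarrow> 'p" and F1 :: "'m \<Rightarrow> 'n"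
    and \<mu> :: "'o \<Rightarrow> 'o \<Rightarrow> 'n" and \<epsilon> :: 'n
  assumes F_obj: "A \<in> carrier (obj C) \<Longrightarrow> F0 A \<in> carrier (obj D)"
    and F_homs: "f \<in> homs C A B \<Longrightarrow> F1 f \<in> homs D (F0 A) (F0 B)"
    and F_ident: "A \<in> carrier (obj C) \<Longrightarrow> F1 (ident C A) = ident D (F0 A)"
    and F_seq: "\<lbrakk>f \<in> homs C X Y; g \<in> homs C Y Z\<rbrakk> \<Longrightarrow> F1 (seq C f g) = seq D (F1 f) (F1 g)"
    and mu_homs: "\<lbrakk>A \<in> carrier (obj C); B \<in> carrier (obj C)\<rbrakk>
      \<Longrightarrow> \<mu> A B \<in> homs D (F0 A \<otimes>\<^bsub>obj D\<^esub> F0 B) (F0 (A \<otimes>\<^bsub>obj C\<^esub> B))"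
    and mu_iso: "\<lbrakk>A \<in> carrier (obj C); B \<in> carrier (obj C)\<rbrakk> \<Longrightarrow> is_iso D (\<mu> A B)"
    and mu_natural: "\<lbrakk>f \<in> homs C A B; g \<in> homs C A' B'\<rbrakk>
      \<Longrightarrow> seq D (tens D (F1 f) (F1 g)) (\<mu> B B') = seq D (\<mu> A A') (F1 (tens C f g))"
    and mu_assoc: "\<lbrakk>X \<in> carrier (obj C); Y \<in> carrier (obj C); Z \<in> carrier (obj C)\<rbrakk>
      \<Longrightarrow> seq D (tens D (\<mu> X Y) (ident D (F0 Z))) (\<mu> (X \<otimes>\<^bsub>obj C\<^esub> Y) Z)
        = seq D (tens D (ident D (F0 X)) (\<mu> Y Z)) (\<mu> X (Y \<otimes>\<^bsub>obj C\<^esub> Z))"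
    and eps_homs: "\<epsilon> \<in> homs D \<one>\<^bsub>obj D\<^esub> (F0 \<one>\<^bsub>obj C\<^esub>)"
    and eps_iso: "is_iso D \<epsilon>"
    and mu_unit_left: "A \<in> carrier (obj C)
      \<Longrightarrow> seq D (tens D \<epsilon> (ident D (F0 A))) (\<mu> \<one>\<^bsub>obj C\<^esub> A) = ident D (F0 A)"
    and mu_unit_right: "A \<in> carrier (obj C)
      \<Longrightarrow> seq D (tens D (ident D (F0 A)) \<epsilon>) (\<mu> A \<one>\<^bsub>obj C\<^esub>) = ident D (F0 A)"

definition full :: "('o, 'm) moncat \<Rightarrow> ('p, 'n) moncat \<Rightarrow> ('o \<Rightarrow> 'p) \<Rightarrow> ('m \<Rightarrow> 'n) \<Rightarrow> bool" where
  "full C D F0 F1 \<longleftrightarrow> (\<forall>A \<in> carrier (obj C). \<forall>B \<in> carrier (obj C).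
      \<forall>g \<in> homs D (F0 A) (F0 B). \<exists>f \<in> homs C A B. F1 f = g)"

definition faithful :: "('o, 'm) moncat \<Rightarrow> ('m \<Rightarrow> 'n) \<Rightarrow> bool" where
  "faithful C F1 \<longleftrightarrow> (\<forall>A \<in> carrier (obj C). \<forall>B \<in> carrier (obj C). inj_on F1 (homs C A B))"


section \<open>Single-object double categories\<close>

text \<open>\<^term>\<open>hcomp\<close> composes left to right, \<^term>\<open>vcomp\<close> top to bottom; \<^term>\<open>hid\<close> gives the
  identity cells on horizontal edges (units for \<^term>\<open>vcomp\<close>) and \<^term>\<open>vid\<close> those on vertical
  edges (units for \<^term>\<open>hcomp\<close>).\<close>

record ('h, 'v, 'c) sodc =
  hedges :: "'h monoid"
  vedges :: "'v monoid"
  cells :: "'c set"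
  ctop :: "'c \<Rightarrow> 'h"
  cbot :: "'c \<Rightarrow> 'h"
  cleft :: "'c \<Rightarrow> 'v"
  cright :: "'c \<Rightarrow> 'v"
  hcomp :: "'c \<Rightarrow> 'c \<Rightarrow> 'c"
  vcomp :: "'c \<Rightarrow> 'c \<Rightarrow> 'c"
  hid :: "'h \<Rightarrow> 'c"
  vid :: "'v \<Rightarrow> 'c"

definition cells_at :: "('h, 'v, 'c) sodc \<Rightarrow> 'h \<Rightarrow> 'h \<Rightarrow> 'v \<Rightarrow> 'v \<Rightarrow> 'c set" where
  "cells_at D T B L R =
    {\<alpha> \<in> cells D. ctop D \<alpha> = T \<and> cbot D \<alpha> = B \<and> cleft D \<alpha> = L \<and> cright D \<alpha> = R}"

locale single_object_double_category =
  fixes D :: "('h, 'v, 'c) sodc"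
  assumes hedges_monoid: "monoid (hedges D)"
    and vedges_monoid: "monoid (vedges D)"
    and ctop_edge: "\<alpha> \<in> cells D \<Longrightarrow> ctop D \<alpha> \<in> carrier (hedges D)"
    and cbot_edge: "\<alpha> \<in> cells D \<Longrightarrow> cbot D \<alpha> \<in> carrier (hedges D)"
    and cleft_edge: "\<alpha> \<in> cells D \<Longrightarrow> cleft D \<alpha> \<in> carrier (vedges D)"
    and cright_edge: "\<alpha> \<in> cells D \<Longrightarrow> cright D \<alpha> \<in> carrier (vedges D)"
    and hcomp_cells: "\<lbrakk>\<alpha> \<in> cells_at D T B L M; \<beta> \<in> cells_at D T' B' M R\<rbrakk>
      \<Longrightarrow> hcomp D \<alpha> \<beta> \<in> cells_at D (T \<otimes>\<^bsub>hedges D\<^esub> T') (B \<otimes>\<^bsub>hedges D\<^esub> B') L R"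
    and vcomp_cells: "\<lbrakk>\<alpha> \<in> cells_at D T N L R; \<beta> \<in> cells_at D N B L' R'\<rbrakk>
      \<Longrightarrow> vcomp D \<alpha> \<beta> \<in> cells_at D T B (L \<otimes>\<^bsub>vedges D\<^esub> L') (R \<otimes>\<^bsub>vedges D\<^esub> R')"
    and hid_cells: "A \<in> carrier (hedges D)
      \<Longrightarrow> hid D A \<in> cells_at D A A \<one>\<^bsub>vedges D\<^esub> \<one>\<^bsub>vedges D\<^esub>"
    and vid_cells: "X \<in> carrier (vedges D)
      \<Longrightarrow> vid D X \<in> cells_at D \<one>\<^bsub>hedges D\<^esub> \<one>\<^bsub>hedges D\<^esub> X X"
    and hcomp_assoc: "\<lbrakk>\<alpha> \<in> cells D; \<beta> \<in> cells D; \<gamma> \<in> cells D;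
        cright D \<alpha> = cleft D \<beta>; cright D \<beta> = cleft D \<gamma>\<rbrakk>
      \<Longrightarrow> hcomp D (hcomp D \<alpha> \<beta>) \<gamma> = hcomp D \<alpha> (hcomp D \<beta> \<gamma>)"
    and vcomp_assoc: "\<lbrakk>\<alpha> \<in> cells D; \<beta> \<in> cells D; \<gamma> \<in> cells D;
        cbot D \<alpha> = ctop D \<beta>; cbot D \<beta> = ctop D \<gamma>\<rbrakk>
      \<Longrightarrow> vcomp D (vcomp D \<alpha> \<beta>) \<gamma> = vcomp D \<alpha> (vcomp D \<beta> \<gamma>)"
    and hcomp_unit_left: "\<alpha> \<in> cells D \<Longrightarrow> hcomp D (vid D (cleft D \<alpha>)) \<alpha> = \<alpha>"
    and hcomp_unit_right: "\<alpha> \<in> cells D \<Longrightarrow> hcomp D \<alpha> (vid D (cright D \<alpha>)) = \<alpha>"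
    and vcomp_unit_top: "\<alpha> \<in> cells D \<Longrightarrow> vcomp D (hid D (ctop D \<alpha>)) \<alpha> = \<alpha>"
    and vcomp_unit_bot: "\<alpha> \<in> cells D \<Longrightarrow> vcomp D \<alpha> (hid D (cbot D \<alpha>)) = \<alpha>"
    and hcomp_hid: "\<lbrakk>A \<in> carrier (hedges D); B \<in> carrier (hedges D)\<rbrakk>
      \<Longrightarrow> hcomp D (hid D A) (hid D B) = hid D (A \<otimes>\<^bsub>hedges D\<^esub> B)"
    and vcomp_vid: "\<lbrakk>X \<in> carrier (vedges D); Y \<in> carrier (vedges D)\<rbrakk>
      \<Longrightarrow> vcomp D (vid D X) (vid D Y) = vid D (X \<otimes>\<^bsub>vedges D\<^esub> Y)"
    and hid_unit: "hid D \<one>\<^bsub>hedges D\<^esub> = vid D \<one>\<^bsub>vedges D\<^esub>"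
    and interchange: "\<lbrakk>\<alpha> \<in> cells D; \<beta> \<in> cells D; \<gamma> \<in> cells D; \<delta> \<in> cells D;
        cbot D \<alpha> = ctop D \<beta>; cbot D \<gamma> = ctop D \<delta>;
        cright D \<alpha> = cleft D \<gamma>; cright D \<beta> = cleft D \<delta>\<rbrakk>
      \<Longrightarrow> hcomp D (vcomp D \<alpha> \<beta>) (vcomp D \<gamma> \<delta>) = vcomp D (hcomp D \<alpha> \<gamma>) (hcomp D \<beta> \<delta>)"

definition horizontal_cells :: "('h, 'v, 'c) sodc \<Rightarrow> ('v, 'c) moncat" where
  "horizontal_cells D =
    \<lparr>obj = vedges D,
     mor = {\<alpha> \<in> cells D. ctop D \<alpha> = \<one>\<^bsub>hedges D\<^esub> \<and> cbot D \<alpha> = \<one>\<^bsub>hedges D\<^esub>},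
     src = cleft D, tgt = cright D, ident = vid D, seq = hcomp D, tens = vcomp D\<rparr>"

lemma (in single_object_double_category) horizontal_cells_strict_monoidal:
  "strict_monoidal_category (horizontal_cells D)"
proof -
  interpret H: monoid "hedges D" by (rule hedges_monoid)
  interpret V: monoid "vedges D" by (rule vedges_monoid)
  have homs: "homs (horizontal_cells D) X Y = cells_at D \<one>\<^bsub>hedges D\<^esub> \<one>\<^bsub>hedges D\<^esub> X Y" for X Y
    by (auto simp: homs_def horizontal_cells_def cells_at_def)
  show ?thesis
    apply (rule strict_monoidal_category.intro)
    unfolding homs
    using hcomp_cells[of _ "\<one>\<^bsub>hedges D\<^esub>" "\<one>\<^bsub>hedges D\<^esub>" _ _ _ "\<one>\<^bsub>hedges D\<^esub>" "\<one>\<^bsub>hedges D\<^esub>"]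
      vcomp_cells[of _ "\<one>\<^bsub>hedges D\<^esub>" "\<one>\<^bsub>hedges D\<^esub>" _ _ _ "\<one>\<^bsub>hedges D\<^esub>"]
      hcomp_assoc vcomp_assoc hcomp_unit_left hcomp_unit_right vcomp_vid vid_cells cleft_edge
      cright_edge interchange vedges_monoid
                      apply (auto simp: horizontal_cells_def cells_at_def hid_unit[symmetric])
     apply (metis vcomp_unit_top)
    apply (metis vcomp_unit_bot)
    done
qed


section \<open>The free cornering\<close>

text \<open>The polarities \<^term>\<open>Circ\<close> and \<^term>\<open>Bull\<close> stand for the superscripts written as a circle
  and as a bullet.\<close>

datatype polarity = Circ | Bull

type_synonym 'o signed_word = "('o \<times> polarity) list"

definition signed_words :: "('o, 'm) moncat \<Rightarrow> 'o signed_word monoid" where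
  "signed_words A = \<lparr>carrier = lists (carrier (obj A) \<times> UNIV), mult = (@), one = []\<rparr>"

datatype ('o, 'm) cell_term =
    SCorner polarity 'o
  | RCorner polarity 'o
  | Box 'm
  | HId 'o
  | VId "'o signed_word"
  | HComp "('o, 'm) cell_term" "('o, 'm) cell_term"
  | VComp "('o, 'm) cell_term" "('o, 'm) cell_term"

primrec tm_top :: "('o, 'm) moncat \<Rightarrow> ('o, 'm) cell_term \<Rightarrow> 'o" where
  "tm_top A (SCorner p a) = a"
| "tm_top A (RCorner p a) = \<one>\<^bsub>obj A\<^esub>"
| "tm_top A (Box f) = src A f"
| "tm_top A (HId a) = a"
| "tm_top A (VId X) = \<one>\<^bsub>obj A\<^esub>"
| "tm_top A (HComp s t) = tm_top A s \<otimes>\<^bsub>obj A\<^esub> tm_top A t"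
| "tm_top A (VComp s t) = tm_top A s"

primrec tm_bot :: "('o, 'm) moncat \<Rightarrow> ('o, 'm) cell_term \<Rightarrow> 'o" where
  "tm_bot A (SCorner p a) = \<one>\<^bsub>obj A\<^esub>"
| "tm_bot A (RCorner p a) = a"
| "tm_bot A (Box f) = tgt A f"
| "tm_bot A (HId a) = a"
| "tm_bot A (VId X) = \<one>\<^bsub>obj A\<^esub>"
| "tm_bot A (HComp s t) = tm_bot A s \<otimes>\<^bsub>obj A\<^esub> tm_bot A t"
| "tm_bot A (VComp s t) = tm_bot A t"

primrec tm_left :: "('o, 'm) cell_term \<Rightarrow> 'o signed_word" where
  "tm_left (SCorner p a) = (case p of Circ \<Rightarrow> [] | Bull \<Rightarrow> [(a, Bull)])"
| "tm_left (RCorner p a) = (case p of Circ \<Rightarrow> [(a, Circ)] | Bull \<Rightarrow> [])"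
| "tm_left (Box f) = []"
| "tm_left (HId a) = []"
| "tm_left (VId X) = X"
| "tm_left (HComp s t) = tm_left s"
| "tm_left (VComp s t) = tm_left s @ tm_left t"

primrec tm_right :: "('o, 'm) cell_term \<Rightarrow> 'o signed_word" where
  "tm_right (SCorner p a) = (case p of Circ \<Rightarrow> [(a, Circ)] | Bull \<Rightarrow> [])"
| "tm_right (RCorner p a) = (case p of Circ \<Rightarrow> [] | Bull \<Rightarrow> [(a, Bull)])"
| "tm_right (Box f) = []"
| "tm_right (HId a) = []"
| "tm_right (VId X) = X"
| "tm_right (HComp s t) = tm_right t"
| "tm_right (VComp s t) = tm_right s @ tm_right t"

primrec wf_term :: "('o, 'm) moncat \<Rightarrow> ('o, 'm) cell_term \<Rightarrow> bool" where
  "wf_term A (SCorner p a) \<longleftrightarrow> a \<in> carrier (obj A)"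
| "wf_term A (RCorner p a) \<longleftrightarrow> a \<in> carrier (obj A)"
| "wf_term A (Box f) \<longleftrightarrow> f \<in> mor A"
| "wf_term A (HId a) \<longleftrightarrow> a \<in> carrier (obj A)"
| "wf_term A (VId X) \<longleftrightarrow> X \<in> carrier (signed_words A)"
| "wf_term A (HComp s t) \<longleftrightarrow> wf_term A s \<and> wf_term A t \<and> tm_right s = tm_left t"
| "wf_term A (VComp s t) \<longleftrightarrow> wf_term A s \<and> wf_term A t \<and> tm_bot A s = tm_top A t"

inductive cell_eq :: "('o, 'm) moncat \<Rightarrow> ('o, 'm) cell_term \<Rightarrow> ('o, 'm) cell_term \<Rightarrow> bool"
  for A :: "('o, 'm) moncat" where
  refl: "wf_term A t \<Longrightarrow> cell_eq A t t"
| sym: "cell_eq A s t \<Longrightarrow> cell_eq A t s"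
| trans: "cell_eq A s t \<Longrightarrow> cell_eq A t u \<Longrightarrow> cell_eq A s u"
| HComp_cong: "\<lbrakk>cell_eq A s s'; cell_eq A t t'; tm_right s = tm_left t\<rbrakk>
    \<Longrightarrow> cell_eq A (HComp s t) (HComp s' t')"
| VComp_cong: "\<lbrakk>cell_eq A s s'; cell_eq A t t'; tm_bot A s = tm_top A t\<rbrakk>
    \<Longrightarrow> cell_eq A (VComp s t) (VComp s' t')"
| HComp_assoc: "\<lbrakk>wf_term A s; wf_term A t; wf_term A u;
      tm_right s = tm_left t; tm_right t = tm_left u\<rbrakk>
    \<Longrightarrow> cell_eq A (HComp (HComp s t) u) (HComp s (HComp t u))"
| VComp_assoc: "\<lbrakk>wf_term A s; wf_term A t; wf_term A u;
      tm_bot A s = tm_top A t; tm_bot A t = tm_top A u\<rbrakk>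
    \<Longrightarrow> cell_eq A (VComp (VComp s t) u) (VComp s (VComp t u))"
| HComp_unit_left: "wf_term A t \<Longrightarrow> cell_eq A (HComp (VId (tm_left t)) t) t"
| HComp_unit_right: "wf_term A t \<Longrightarrow> cell_eq A (HComp t (VId (tm_right t))) t"
| VComp_unit_top: "wf_term A t \<Longrightarrow> cell_eq A (VComp (HId (tm_top A t)) t) t"
| VComp_unit_bot: "wf_term A t \<Longrightarrow> cell_eq A (VComp t (HId (tm_bot A t))) t"
| HComp_HId: "\<lbrakk>a \<in> carrier (obj A); b \<in> carrier (obj A)\<rbrakk>
    \<Longrightarrow> cell_eq A (HComp (HId a) (HId b)) (HId (a \<otimes>\<^bsub>obj A\<^esub> b))"
| VComp_VId: "\<lbrakk>X \<in> carrier (signed_words A); Y \<in> carrier (signed_words A)\<rbrakk>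
    \<Longrightarrow> cell_eq A (VComp (VId X) (VId Y)) (VId (X @ Y))"
| HId_unit: "cell_eq A (HId \<one>\<^bsub>obj A\<^esub>) (VId [])"
| interchange: "\<lbrakk>wf_term A s; wf_term A t; wf_term A u; wf_term A w;
      tm_bot A s = tm_top A t; tm_bot A u = tm_top A w;
      tm_right s = tm_left u; tm_right t = tm_left w\<rbrakk>
    \<Longrightarrow> cell_eq A (HComp (VComp s t) (VComp u w)) (VComp (HComp s u) (HComp t w))"
| yank_Circ_h: "a \<in> carrier (obj A)
    \<Longrightarrow> cell_eq A (HComp (SCorner Circ a) (RCorner Circ a)) (HId a)"
| yank_Circ_v: "a \<in> carrier (obj A)
    \<Longrightarrow> cell_eq A (VComp (RCorner Circ a) (SCorner Circ a)) (VId [(a, Circ)])"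
| yank_Bull_h: "a \<in> carrier (obj A)
    \<Longrightarrow> cell_eq A (HComp (RCorner Bull a) (SCorner Bull a)) (HId a)"
| yank_Bull_v: "a \<in> carrier (obj A)
    \<Longrightarrow> cell_eq A (VComp (RCorner Bull a) (SCorner Bull a)) (VId [(a, Bull)])"
| Box_seq: "\<lbrakk>f \<in> mor A; g \<in> mor A; tgt A f = src A g\<rbrakk>
    \<Longrightarrow> cell_eq A (VComp (Box f) (Box g)) (Box (seq A f g))"
| Box_ident: "a \<in> carrier (obj A) \<Longrightarrow> cell_eq A (Box (ident A a)) (HId a)"
| Box_tens: "\<lbrakk>f \<in> mor A; g \<in> mor A\<rbrakk>
    \<Longrightarrow> cell_eq A (HComp (Box f) (Box g)) (Box (tens A f g))"

text \<open>Cells are \<^term>\<open>cell_eq\<close>-classes of well-formed terms. The boundary maps and compositions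
  use arbitrary representatives; lemma \<open>cell_eq_boundary\<close> and the congruence rules show that
  the choice is irrelevant.\<close>

definition cell_rel :: "('o, 'm) moncat \<Rightarrow> ('o, 'm) cell_term rel" where
  "cell_rel A = {(s, t). cell_eq A s t}"

definition cell_of :: "('o, 'm) moncat \<Rightarrow> ('o, 'm) cell_term \<Rightarrow> ('o, 'm) cell_term set" where
  "cell_of A t = cell_rel A `` {t}"

definition rep :: "('o, 'm) cell_term set \<Rightarrow> ('o, 'm) cell_term" where
  "rep c = (SOME t. t \<in> c)"

definition free_cornering ::
    "('o, 'm) moncat \<Rightarrow> ('o, 'o signed_word, ('o, 'm) cell_term set) sodc" where
  "free_cornering A =
    \<lparr>hedges = obj A, vedges = signed_words A,
     cells = {t. wf_term A t} // cell_rel A,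
     ctop = (\<lambda>c. tm_top A (rep c)), cbot = (\<lambda>c. tm_bot A (rep c)),
     cleft = (\<lambda>c. tm_left (rep c)), cright = (\<lambda>c. tm_right (rep c)),
     hcomp = (\<lambda>c d. cell_of A (HComp (rep c) (rep d))),
     vcomp = (\<lambda>c d. cell_of A (VComp (rep c) (rep d))),
     hid = (\<lambda>a. cell_of A (HId a)), vid = (\<lambda>X. cell_of A (VId X))\<rparr>"

definition scorner :: "('o, 'm) moncat \<Rightarrow> polarity \<Rightarrow> 'o \<Rightarrow> ('o, 'm) cell_term set" where
  "scorner A p a = cell_of A (SCorner p a)"

definition rcorner :: "('o, 'm) moncat \<Rightarrow> polarity \<Rightarrow> 'o \<Rightarrow> ('o, 'm) cell_term set" where
  "rcorner A p a = cell_of A (RCorner p a)"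

definition box :: "('o, 'm) moncat \<Rightarrow> 'm \<Rightarrow> ('o, 'm) cell_term set" where
  "box A f = cell_of A (Box f)"

text \<open>The functors for the two polarities have the same formula; for
  \<^term>\<open>Circ\<close> the cell \<open>polar_mor A p f\<close> goes from left boundary \<open>src A f\<close> to right boundary
  \<open>tgt A f\<close>, for \<^term>\<open>Bull\<close> the other way round.\<close>

definition polar_obj :: "polarity \<Rightarrow> 'o \<Rightarrow> 'o signed_word" where
  "polar_obj p a = [(a, p)]"

definition polar_mor :: "('o, 'm) moncat \<Rightarrow> polarity \<Rightarrow> 'm \<Rightarrow> ('o, 'm) cell_term set" where
  "polar_mor A p f = vcomp (free_cornering A)
     (vcomp (free_cornering A) (rcorner A p (src A f)) (box A f)) (scorner A p (tgt A f))"


section \<open>The free cornering is a double category\<close>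

context strict_monoidal_category
begin

lemma seq_mor:
  assumes "f \<in> mor C" "g \<in> mor C" "tgt C f = src C g"
  shows "seq C f g \<in> mor C \<and> src C (seq C f g) = src C f \<and> tgt C (seq C f g) = tgt C g"
  using seq_homs[of f "src C f" "tgt C f" g "tgt C g"] assms by (simp add: homs_def)

lemma tens_mor:
  assumes "f \<in> mor C" "g \<in> mor C"
  shows "tens C f g \<in> mor C \<and> src C (tens C f g) = src C f \<otimes>\<^bsub>obj C\<^esub> src C g
    \<and> tgt C (tens C f g) = tgt C f \<otimes>\<^bsub>obj C\<^esub> tgt C g"
  using tens_homs[of f "src C f" "tgt C f" g "src C g" "tgt C g"] assms by (simp add: homs_def)

lemma ident_mor:
  "a \<in> carrier (obj C) \<Longrightarrow> ident C a \<in> mor C \<and> src C (ident C a) = a \<and> tgt C (ident C a) = a"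
  using ident_homs[of a] by (simp add: homs_def)

lemma tm_top_obj: "wf_term C t \<Longrightarrow> tm_top C t \<in> carrier (obj C)"
  and tm_bot_obj: "wf_term C t \<Longrightarrow> tm_bot C t \<in> carrier (obj C)"
  using obj_monoid src_obj tgt_obj
  by (induction t) (auto simp: monoid.m_closed monoid.one_closed)

lemma cell_eq_boundary:
  assumes "cell_eq C s t"
  shows "wf_term C s \<and> wf_term C t \<and> tm_top C s = tm_top C t \<and> tm_bot C s = tm_bot C t
    \<and> tm_left s = tm_left t \<and> tm_right s = tm_right t"
proof -
  interpret monoid "obj C" by (rule obj_monoid)
  have W: "X \<in> carrier (signed_words C)
      \<longleftrightarrow> (\<forall>x \<in> set X. fst x \<in> carrier (obj C))" for X
    by (auto simp: signed_words_def lists_eq_set)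
  have L: "wf_term C t \<Longrightarrow> tm_left t \<in> carrier (signed_words C)
      \<and> tm_right t \<in> carrier (signed_words C)" for t
    by (induction t) (auto simp: W split: polarity.splits)
  show ?thesis
    using assms
  proof induction
    case (VComp_VId X Y)
    then show ?case by (auto simp: W)
  qed (use L in \<open>auto simp: m_assoc tm_top_obj tm_bot_obj W seq_mor tens_mor ident_mor\<close>)
qed

lemma cell_rel_equiv: "equiv {t. wf_term C t} (cell_rel C)"
  by (rule equivI)
    (auto simp: cell_rel_def refl_on_def cell_eq.refl dest: cell_eq_boundary
      intro!: symI transI intro: cell_eq.sym cell_eq.trans)

lemma cell_of_eq_iff:
  "wf_term C s \<Longrightarrow> wf_term C t \<Longrightarrow> cell_of C s = cell_of C t \<longleftrightarrow> cell_eq C s t"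
  unfolding cell_of_def using eq_equiv_class_iff[OF cell_rel_equiv, of s t]
  by (simp add: cell_rel_def)

lemma cell_of_eqI: "cell_eq C s t \<Longrightarrow> cell_of C s = cell_of C t"
  using cell_of_eq_iff cell_eq_boundary by blast

lemma cell_eq_rep: "wf_term C t \<Longrightarrow> cell_eq C (rep (cell_of C t)) t"
  unfolding rep_def
  by (rule cell_eq.sym, rule someI2[of "\<lambda>x. x \<in> cell_of C t" t])
    (auto simp: cell_of_def cell_rel_def intro: cell_eq.refl)

lemma cells_free_cornering: "cells (free_cornering C) = cell_of C ` {t. wf_term C t}"
  by (auto simp: free_cornering_def quotient_def cell_of_def)

lemma free_cornering_boundary:
  assumes "wf_term C t"
  shows "ctop (free_cornering C) (cell_of C t) = tm_top C t"
    and "cbot (free_cornering C) (cell_of C t) = tm_bot C t"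
    and "cleft (free_cornering C) (cell_of C t) = tm_left t"
    and "cright (free_cornering C) (cell_of C t) = tm_right t"
  using cell_eq_boundary[OF cell_eq_rep[OF assms]] by (auto simp: free_cornering_def)

lemma hcomp_cell_of:
  assumes "wf_term C s" "wf_term C t" "tm_right s = tm_left t"
  shows "hcomp (free_cornering C) (cell_of C s) (cell_of C t) = cell_of C (HComp s t)"
proof -
  have "cell_eq C (HComp (rep (cell_of C s)) (rep (cell_of C t))) (HComp s t)"
    using assms cell_eq_boundary[OF cell_eq_rep[OF assms(1)]]
      cell_eq_boundary[OF cell_eq_rep[OF assms(2)]]
    by (intro cell_eq.HComp_cong cell_eq_rep) auto
  then show ?thesis
    by (simp add: free_cornering_def cell_of_eqI)
qed

lemma vcomp_cell_of:
  assumes "wf_term C s" "wf_term C t" "tm_bot C s = tm_top C t"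
  shows "vcomp (free_cornering C) (cell_of C s) (cell_of C t) = cell_of C (VComp s t)"
proof -
  have "cell_eq C (VComp (rep (cell_of C s)) (rep (cell_of C t))) (VComp s t)"
    using assms cell_eq_boundary[OF cell_eq_rep[OF assms(1)]]
      cell_eq_boundary[OF cell_eq_rep[OF assms(2)]]
    by (intro cell_eq.VComp_cong cell_eq_rep) auto
  then show ?thesis
    by (simp add: free_cornering_def cell_of_eqI)
qed

lemma hid_free_cornering: "hid (free_cornering C) a = cell_of C (HId a)"
  and vid_free_cornering: "vid (free_cornering C) X = cell_of C (VId X)"
  and hedges_free_cornering: "hedges (free_cornering C) = obj C"
  and vedges_free_cornering: "vedges (free_cornering C) = signed_words C"
  by (simp_all add: free_cornering_def)

lemma signed_words_simps:
  "X \<in> carrier (signed_words C) \<longleftrightarrow> fst ` set X \<subseteq> carrier (obj C)"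
  "X \<otimes>\<^bsub>signed_words C\<^esub> Y = X @ Y" "\<one>\<^bsub>signed_words C\<^esub> = []"
  by (auto simp: signed_words_def lists_eq_set)

lemma tm_left_word: "wf_term C t \<Longrightarrow> tm_left t \<in> carrier (signed_words C)"
  and tm_right_word: "wf_term C t \<Longrightarrow> tm_right t \<in> carrier (signed_words C)"
  by (induction t) (auto simp: signed_words_simps split: polarity.splits)

lemmas free_cornering_simps = hid_free_cornering vid_free_cornering hedges_free_cornering
  vedges_free_cornering free_cornering_boundary hcomp_cell_of vcomp_cell_of

theorem free_cornering_double_category: "single_object_double_category (free_cornering C)"
proof -
  interpret monoid "obj C" by (rule obj_monoid)
  have words: "monoid (signed_words C)"
    by unfold_locales (auto simp: signed_words_simps)
  note B = tm_top_obj tm_bot_obj tm_left_word tm_right_word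
  show ?thesis
    by (rule single_object_double_category.intro)
      (auto simp: cells_at_def cells_free_cornering free_cornering_simps obj_monoid words B
      signed_words_simps(2,3) cell_of_eqI[OF cell_eq.VComp_VId] cell_of_eqI[OF cell_eq.HId_unit]
      cell_of_eq_iff m_assoc intro: cell_eq.intros(6-15) del: equalityI)
qed

end


section \<open>The free cornering is free\<close>

text \<open>A cornering structure interprets the presentation of the free cornering in a
  single-object double category \<^term>\<open>D\<close>; the free cornering carries the initial one.\<close>

locale cornering_structure =
  strict_monoidal_category A + single_object_double_category D
  for A :: "('o, 'm) moncat" and D :: "('h, 'v, 'c) sodc" +
  fixes h :: "'o \<Rightarrow> 'h" and v :: "'o \<times> polarity \<Rightarrow> 'v"
    and s r :: "polarity \<Rightarrow> 'o \<Rightarrow> 'c" and k :: "'m \<Rightarrow> 'c"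
  assumes h_hom: "h \<in> hom (obj A) (hedges D)"
    and h_one: "h \<one>\<^bsub>obj A\<^esub> = \<one>\<^bsub>hedges D\<^esub>"
    and v_edge: "a \<in> carrier (obj A) \<Longrightarrow> v (a, p) \<in> carrier (vedges D)"
    and s_Circ: "a \<in> carrier (obj A)
      \<Longrightarrow> s Circ a \<in> cells_at D (h a) \<one>\<^bsub>hedges D\<^esub> \<one>\<^bsub>vedges D\<^esub> (v (a, Circ))"
    and r_Circ: "a \<in> carrier (obj A)
      \<Longrightarrow> r Circ a \<in> cells_at D \<one>\<^bsub>hedges D\<^esub> (h a) (v (a, Circ)) \<one>\<^bsub>vedges D\<^esub>"
    and s_Bull: "a \<in> carrier (obj A)
      \<Longrightarrow> s Bull a \<in> cells_at D (h a) \<one>\<^bsub>hedges D\<^esub> (v (a, Bull)) \<one>\<^bsub>vedges D\<^esub>"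
    and r_Bull: "a \<in> carrier (obj A)
      \<Longrightarrow> r Bull a \<in> cells_at D \<one>\<^bsub>hedges D\<^esub> (h a) \<one>\<^bsub>vedges D\<^esub> (v (a, Bull))"
    and k_cell: "f \<in> mor A
      \<Longrightarrow> k f \<in> cells_at D (h (src A f)) (h (tgt A f)) \<one>\<^bsub>vedges D\<^esub> \<one>\<^bsub>vedges D\<^esub>"
    and yank_Circ_h: "a \<in> carrier (obj A) \<Longrightarrow> hcomp D (s Circ a) (r Circ a) = hid D (h a)"
    and yank_Circ_v: "a \<in> carrier (obj A) \<Longrightarrow> vcomp D (r Circ a) (s Circ a) = vid D (v (a, Circ))"
    and yank_Bull_h: "a \<in> carrier (obj A) \<Longrightarrow> hcomp D (r Bull a) (s Bull a) = hid D (h a)"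
    and yank_Bull_v: "a \<in> carrier (obj A) \<Longrightarrow> vcomp D (r Bull a) (s Bull a) = vid D (v (a, Bull))"
    and k_seq: "\<lbrakk>f \<in> mor A; g \<in> mor A; tgt A f = src A g\<rbrakk> \<Longrightarrow> vcomp D (k f) (k g) = k (seq A f g)"
    and k_ident: "a \<in> carrier (obj A) \<Longrightarrow> k (ident A a) = hid D (h a)"
    and k_tens: "\<lbrakk>f \<in> mor A; g \<in> mor A\<rbrakk> \<Longrightarrow> hcomp D (k f) (k g) = k (tens A f g)"

theorem (in strict_monoidal_category) free_cornering_structure:
  "cornering_structure C (free_cornering C) id (\<lambda>x. [x]) (scorner C) (rcorner C) (box C)"
proof -
  interpret F: single_object_double_category "free_cornering C"
    by (rule free_cornering_double_category)
  show ?thesis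
    by unfold_locales
      (auto simp: cells_at_def cells_free_cornering free_cornering_simps signed_words_simps hom_def
        scorner_def rcorner_def box_def seq_mor tens_mor ident_mor
        cell_of_eq_iff intro: cell_eq.intros(16-) del: equalityI)
qed

context cornering_structure
begin

definition word :: "'o signed_word \<Rightarrow> 'v" where
  "word X = foldr (\<lambda>x y. v x \<otimes>\<^bsub>vedges D\<^esub> y) X \<one>\<^bsub>vedges D\<^esub>"

primrec eval_term :: "('o, 'm) cell_term \<Rightarrow> 'c" where
  "eval_term (SCorner p a) = s p a"
| "eval_term (RCorner p a) = r p a"
| "eval_term (Box f) = k f"
| "eval_term (HId a) = hid D (h a)"
| "eval_term (VId X) = vid D (word X)"
| "eval_term (HComp t u) = hcomp D (eval_term t) (eval_term u)"
| "eval_term (VComp t u) = vcomp D (eval_term t) (eval_term u)"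

lemma word_edge: "X \<in> carrier (signed_words A) \<Longrightarrow> word X \<in> carrier (vedges D)"
  using vedges_monoid v_edge
  by (induction X) (auto simp: word_def signed_words_simps monoid.m_closed monoid.one_closed)

lemma word_append:
  "\<lbrakk>X \<in> carrier (signed_words A); Y \<in> carrier (signed_words A)\<rbrakk>
    \<Longrightarrow> word (X @ Y) = word X \<otimes>\<^bsub>vedges D\<^esub> word Y"
proof (induction X)
  case Nil
  then show ?case using monoid.l_one[OF vedges_monoid word_edge] by (simp add: word_def)
next
  case (Cons x X)
  then have "X \<in> carrier (signed_words A)" "v x \<in> carrier (vedges D)"
    using v_edge[of "fst x" "snd x"] by (auto simp: signed_words_simps)
  moreover have "word (x # Z) = v x \<otimes>\<^bsub>vedges D\<^esub> word Z" for Z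
    by (simp add: word_def)
  ultimately show ?case
    using Cons word_edge by (simp add: monoid.m_assoc[OF vedges_monoid])
qed

lemma word_single: "a \<in> carrier (obj A) \<Longrightarrow> word [(a, p)] = v (a, p)"
  using monoid.r_one[OF vedges_monoid v_edge] by (simp add: word_def)

lemma word_Nil: "word [] = \<one>\<^bsub>vedges D\<^esub>"
  by (simp add: word_def)

lemma eval_term_cell:
  "wf_term A t \<Longrightarrow> eval_term t
    \<in> cells_at D (h (tm_top A t)) (h (tm_bot A t)) (word (tm_left t)) (word (tm_right t))"
proof (induction t)
  case (SCorner p a)
  then show ?case using s_Circ s_Bull by (cases p) (auto simp: word_single word_Nil h_one)
next
  case (RCorner p a)
  then show ?case using r_Circ r_Bull by (cases p) (auto simp: word_single word_Nil h_one)
next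
  case (Box f)
  then show ?case using k_cell by (simp add: word_Nil)
next
  case (HId a)
  then show ?case using hid_cells[of "h a"] h_hom by (auto simp: hom_def word_Nil)
next
  case (VId X)
  then show ?case using vid_cells[OF word_edge] by (simp add: h_one)
next
  case (HComp t u)
  then show ?case using h_hom hcomp_cells by (simp add: hom_mult tm_top_obj tm_bot_obj)
next
  case (VComp t u)
  then show ?case using vcomp_cells by (simp add: word_append tm_left_word tm_right_word)
qed

lemma eval_term_cong: "cell_eq A t u \<Longrightarrow> eval_term t = eval_term u"
proof (induction rule: cell_eq.induct)
  case (HComp_unit_left t)
  then show ?case using eval_term_cell[of t] hcomp_unit_left[of "eval_term t"] by (auto simp: cells_at_def)
next
  case (HComp_unit_right t)
  then show ?case using eval_term_cell[of t] hcomp_unit_right[of "eval_term t"] by (auto simp: cells_at_def)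
next
  case (VComp_unit_top t)
  then show ?case using eval_term_cell[of t] vcomp_unit_top[of "eval_term t"] by (auto simp: cells_at_def)
next
  case (VComp_unit_bot t)
  then show ?case using eval_term_cell[of t] vcomp_unit_bot[of "eval_term t"] by (auto simp: cells_at_def)
next
  case (HComp_assoc t u w)
  then show ?case using eval_term_cell[of t] eval_term_cell[of u] eval_term_cell[of w]
    by (auto simp: cells_at_def intro: hcomp_assoc)
next
  case (VComp_assoc t u w)
  then show ?case using eval_term_cell[of t] eval_term_cell[of u] eval_term_cell[of w]
    by (auto simp: cells_at_def intro: vcomp_assoc)
next
  case (interchange t u w x)
  then show ?case
    using eval_term_cell[of t] eval_term_cell[of u] eval_term_cell[of w] eval_term_cell[of x]
      single_object_double_category.interchange
        [OF single_object_double_category_axioms, of "eval_term t" "eval_term u" "eval_term w" "eval_term x"]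
    by (auto simp: cells_at_def)
next
  case (HComp_HId a b)
  then show ?case using h_hom hcomp_hid[of "h a" "h b"] by (auto simp: hom_def)
next
  case (VComp_VId X Y)
  then show ?case using vcomp_vid[of "word X" "word Y"] by (simp add: word_append word_edge)
qed (simp_all add: h_one word_Nil hid_unit yank_Circ_h yank_Circ_v yank_Bull_h yank_Bull_v
    k_seq k_ident k_tens word_single)

definition eval :: "('o, 'm) cell_term set \<Rightarrow> 'c" where
  "eval c = eval_term (rep c)"

lemma eval_cell_of: "wf_term A t \<Longrightarrow> eval (cell_of A t) = eval_term t"
  unfolding eval_def by (rule eval_term_cong[OF cell_eq_rep])

definition is_interpretation :: "(('o, 'm) cell_term set \<Rightarrow> 'c) \<Rightarrow> bool" where
  "is_interpretation F \<longleftrightarrow>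
    (\<forall>a \<in> carrier (obj A). \<forall>p. F (scorner A p a) = s p a \<and> F (rcorner A p a) = r p a)
    \<and> (\<forall>f \<in> mor A. F (box A f) = k f)
    \<and> (\<forall>a \<in> carrier (obj A). F (hid (free_cornering A) a) = hid D (h a))
    \<and> (\<forall>X \<in> carrier (signed_words A). F (vid (free_cornering A) X) = vid D (word X))
    \<and> (\<forall>\<alpha> \<in> cells (free_cornering A). F \<alpha> \<in> cells_at D
          (h (ctop (free_cornering A) \<alpha>)) (h (cbot (free_cornering A) \<alpha>))
          (word (cleft (free_cornering A) \<alpha>)) (word (cright (free_cornering A) \<alpha>)))
    \<and> (\<forall>\<alpha> \<in> cells (free_cornering A). \<forall>\<beta> \<in> cells (free_cornering A).
          cright (free_cornering A) \<alpha> = cleft (free_cornering A) \<beta>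
          \<longrightarrow> F (hcomp (free_cornering A) \<alpha> \<beta>) = hcomp D (F \<alpha>) (F \<beta>))
    \<and> (\<forall>\<alpha> \<in> cells (free_cornering A). \<forall>\<beta> \<in> cells (free_cornering A).
          cbot (free_cornering A) \<alpha> = ctop (free_cornering A) \<beta>
          \<longrightarrow> F (vcomp (free_cornering A) \<alpha> \<beta>) = vcomp D (F \<alpha>) (F \<beta>))"

theorem free_cornering_initial:
  "is_interpretation eval"
  "\<lbrakk>is_interpretation F; \<alpha> \<in> cells (free_cornering A)\<rbrakk> \<Longrightarrow> F \<alpha> = eval \<alpha>"
proof -
  show "is_interpretation eval"
    unfolding is_interpretation_def cells_free_cornering scorner_def rcorner_def box_def
    by (auto simp: free_cornering_simps eval_cell_of eval_term_cell)
next
  assume F: "is_interpretation F" and \<alpha>: "\<alpha> \<in> cells (free_cornering A)"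
  have "wf_term A t \<Longrightarrow> F (cell_of A t) = eval_term t" for t
    using F
    by (induction t)
      (auto simp: is_interpretation_def scorner_def rcorner_def box_def cells_free_cornering
        free_cornering_simps simp flip: hcomp_cell_of vcomp_cell_of)
  then show "F \<alpha> = eval \<alpha>"
    using \<alpha> by (auto simp: cells_free_cornering eval_cell_of)
qed

end

end

theory Submission
  imports Defs
begin

text \<open>Corners exhibit \<open>a\<^sup>\<circ>\<close> and \<open>a\<^sup>\<bullet>\<close> as a companion and a conjoint of \<open>a\<close>, so composing with
  corners gives mutually inverse bijections between the horizontal cells from \<open>a\<^sup>\<circ>\<close> to \<open>b\<^sup>\<circ>\<close>,
  respectively from \<open>b\<^sup>\<bullet>\<close> to \<open>a\<^sup>\<bullet>\<close>, and the cells from \<open>a\<close> to \<open>b\<close> with trivial sides. It remains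
  to identify the latter with the morphisms of \<open>A\<close>.

  A cell \<open>t\<close> acts on the left contexts of its left boundary: these are cells with trivial left
  side, cut into rows containing one morphism or one corner each, and composing one with \<open>t\<close>
  can be carried out on row lists (\<open>push\<close>). Acting on the empty context shows that every cell
  with trivial sides comes from a morphism. Dually \<open>t\<close> acts on right contexts (\<open>pull\<close>), and a left
  context can be run against a right one to a morphism of \<open>A\<close>. Since the two actions are adjoint
  for this pairing, observing the action of \<open>t\<close> through it respects all the equations of the
  presentation; hence distinct morphisms give distinct cells.\<close>

section \<open>Corner pairs\<close>

text \<open>The delicate point is faithfulness: the presentation must not identify distinct
  morphisms. The action \<open>push\<close> does not respect the equations literally. Equal terms
  may send one context to different row lists, since a morphism can be listed before or after a
  corner it commutes with. What is compared is therefore the morphism obtained by \<open>run\<close>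
  against every right context. This weaker comparison has its own obstacle. Replacing
  \<open>s\<close> in \<open>HComp s t\<close> changes the context that \<open>t\<close> then meets,
  and nothing is known about \<open>push t\<close> on two contexts that are merely indistinguishable
  by \<open>run\<close>. Adjointness removes it: \<open>pull\<close> moves \<open>t\<close> into the
  right context, so that \<open>s\<close> alone faces a right context. The same device makes the
  place of a vertical cut immaterial. The comparison cells of the functors are mates too. The
  corners of two letters combine to a new corner pair over a product of objects, and the comparison
  cell is the mate of a braiding (\<open>Circ\<close>) or of an identity (\<open>Bull\<close>)
  between that pair and the corners of the product. This is why mates are studied for arbitrary
  corner pairs.\<close>

context single_object_double_category
begin

interpretation H: monoid "hedges D"
  by (rule hedges_monoid)

interpretation V: monoid "vedges D"
  by (rule vedges_monoid)

section \<open>Boundaries and units in a double category\<close>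

lemma cells_at_iff: "\<alpha> \<in> cells_at D T B L R \<longleftrightarrow>
    \<alpha> \<in> cells D \<and> ctop D \<alpha> = T \<and> cbot D \<alpha> = B \<and> cleft D \<alpha> = L \<and> cright D \<alpha> = R"
  by (simp add: cells_at_def)

lemma hcomp_cell:
  "\<lbrakk>\<alpha> \<in> cells D; \<beta> \<in> cells D; cright D \<alpha> = cleft D \<beta>\<rbrakk> \<Longrightarrow> hcomp D \<alpha> \<beta> \<in> cells D
    \<and> ctop D (hcomp D \<alpha> \<beta>) = ctop D \<alpha> \<otimes>\<^bsub>hedges D\<^esub> ctop D \<beta>
    \<and> cbot D (hcomp D \<alpha> \<beta>) = cbot D \<alpha> \<otimes>\<^bsub>hedges D\<^esub> cbot D \<beta>
    \<and> cleft D (hcomp D \<alpha> \<beta>) = cleft D \<alpha> \<and> cright D (hcomp D \<alpha> \<beta>) = cright D \<beta>"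
  using hcomp_cells[of \<alpha> _ _ _ "cleft D \<beta>" \<beta>] by (simp add: cells_at_iff)

lemma vcomp_cell:
  "\<lbrakk>\<alpha> \<in> cells D; \<beta> \<in> cells D; cbot D \<alpha> = ctop D \<beta>\<rbrakk> \<Longrightarrow> vcomp D \<alpha> \<beta> \<in> cells D
    \<and> ctop D (vcomp D \<alpha> \<beta>) = ctop D \<alpha> \<and> cbot D (vcomp D \<alpha> \<beta>) = cbot D \<beta>
    \<and> cleft D (vcomp D \<alpha> \<beta>) = cleft D \<alpha> \<otimes>\<^bsub>vedges D\<^esub> cleft D \<beta>
    \<and> cright D (vcomp D \<alpha> \<beta>) = cright D \<alpha> \<otimes>\<^bsub>vedges D\<^esub> cright D \<beta>"
  using vcomp_cells[of \<alpha> _ "ctop D \<beta>" _ _ \<beta>] by (simp add: cells_at_iff)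

lemma hid_cell:
  "a \<in> carrier (hedges D) \<Longrightarrow> hid D a \<in> cells D \<and> ctop D (hid D a) = a \<and> cbot D (hid D a) = a
    \<and> cleft D (hid D a) = \<one>\<^bsub>vedges D\<^esub> \<and> cright D (hid D a) = \<one>\<^bsub>vedges D\<^esub>"
  using hid_cells by (simp add: cells_at_iff)

lemma vid_cell:
  "X \<in> carrier (vedges D) \<Longrightarrow> vid D X \<in> cells D \<and> cleft D (vid D X) = X \<and> cright D (vid D X) = X
    \<and> ctop D (vid D X) = \<one>\<^bsub>hedges D\<^esub> \<and> cbot D (vid D X) = \<one>\<^bsub>hedges D\<^esub>"
  using vid_cells by (simp add: cells_at_iff)

lemma unit_cells:
  "\<lbrakk>\<alpha> \<in> cells D; cleft D \<alpha> = X\<rbrakk> \<Longrightarrow> hcomp D (vid D X) \<alpha> = \<alpha>"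
  "\<lbrakk>\<alpha> \<in> cells D; cright D \<alpha> = X\<rbrakk> \<Longrightarrow> hcomp D \<alpha> (vid D X) = \<alpha>"
  "\<lbrakk>\<alpha> \<in> cells D; ctop D \<alpha> = a\<rbrakk> \<Longrightarrow> vcomp D (hid D a) \<alpha> = \<alpha>"
  "\<lbrakk>\<alpha> \<in> cells D; cbot D \<alpha> = a\<rbrakk> \<Longrightarrow> vcomp D \<alpha> (hid D a) = \<alpha>"
  "\<lbrakk>\<alpha> \<in> cells D; ctop D \<alpha> = \<one>\<^bsub>hedges D\<^esub>\<rbrakk> \<Longrightarrow> vcomp D (vid D \<one>\<^bsub>vedges D\<^esub>) \<alpha> = \<alpha>"
  "\<lbrakk>\<alpha> \<in> cells D; cbot D \<alpha> = \<one>\<^bsub>hedges D\<^esub>\<rbrakk> \<Longrightarrow> vcomp D \<alpha> (vid D \<one>\<^bsub>vedges D\<^esub>) = \<alpha>"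
  using hcomp_unit_left[of \<alpha>] hcomp_unit_right[of \<alpha>] vcomp_unit_top[of \<alpha>] vcomp_unit_bot[of \<alpha>]
  by (auto simp flip: hid_unit)

lemmas cell_simps = hcomp_cell vcomp_cell hid_cell vid_cell unit_cells hcomp_assoc vcomp_assoc
  hid_unit
  hcomp_hid vcomp_vid ctop_edge cbot_edge cleft_edge cright_edge
  H.m_closed H.one_closed H.m_assoc H.l_one H.r_one V.m_closed V.one_closed V.m_assoc V.l_one
    V.r_one

text \<open>\<open>p\<close> plays the role of an r-corner and \<open>q\<close> of an s-corner; the
  two equations are the yanking equations, that is, the defining identities of a companion. Besides
  the corners themselves, joins of corners and the identity on the unit are instances.\<close>

definition corner_pair :: "'h \<Rightarrow> 'v \<Rightarrow> 'c \<Rightarrow> 'c \<Rightarrow> bool" where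
  "corner_pair a X p q \<longleftrightarrow> p \<in> cells_at D \<one>\<^bsub>hedges D\<^esub> a X \<one>\<^bsub>vedges D\<^esub>
    \<and> q \<in> cells_at D a \<one>\<^bsub>hedges D\<^esub> \<one>\<^bsub>vedges D\<^esub> X \<and> hcomp D q p = hid D a \<and> vcomp D p q = vid D X"

definition mate :: "'c \<Rightarrow> 'c \<Rightarrow> 'c \<Rightarrow> 'c" where
  "mate p f q = vcomp D (vcomp D p f) q"

text \<open>The second corner must still reach the left boundary, so it stands to the left of the
  wire \<open>a\<close> that the first one has already brought in. In \<open>join_out\<close>,
  correspondingly, the rightmost wire leaves first.\<close>

definition join_in :: "'h \<Rightarrow> 'c \<Rightarrow> 'c \<Rightarrow> 'c" where
  "join_in a p p' = vcomp D p (hcomp D p' (hid D a))"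

definition join_out :: "'h \<Rightarrow> 'c \<Rightarrow> 'c \<Rightarrow> 'c" where
  "join_out b q q' = vcomp D (hcomp D (hid D b) q) q'"

abbreviation vcells :: "'h \<Rightarrow> 'h \<Rightarrow> 'c set" where
  "vcells a b \<equiv> cells_at D a b \<one>\<^bsub>vedges D\<^esub> \<one>\<^bsub>vedges D\<^esub>"

lemma corner_pair_cells:
  assumes "corner_pair a X p q"
  shows "p \<in> cells D" "ctop D p = \<one>\<^bsub>hedges D\<^esub>" "cbot D p = a" "cleft D p = X"
    "cright D p = \<one>\<^bsub>vedges D\<^esub>"
    "q \<in> cells D" "ctop D q = a" "cbot D q = \<one>\<^bsub>hedges D\<^esub>" "cleft D q = \<one>\<^bsub>vedges D\<^esub>" "cright D q = X"
    "hcomp D q p = hid D a" "vcomp D p q = vid D X" "a \<in> carrier (hedges D)"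
      "X \<in> carrier (vedges D)"
  using assms cbot_edge[of p] cleft_edge[of p] by (auto simp: corner_pair_def cells_at_iff)

lemma corner_pair_unit:
  "corner_pair \<one>\<^bsub>hedges D\<^esub> \<one>\<^bsub>vedges D\<^esub> (hid D \<one>\<^bsub>hedges D\<^esub>) (hid D \<one>\<^bsub>hedges D\<^esub>)"
  by (simp add: corner_pair_def cells_at_iff cell_simps)

lemma mate_cells:
  "\<lbrakk>corner_pair a X p q; corner_pair b Y p' q'; f \<in> vcells a b\<rbrakk>
    \<Longrightarrow> mate p f q' \<in> cells_at D \<one>\<^bsub>hedges D\<^esub> \<one>\<^bsub>hedges D\<^esub> X Y"
  by (simp add: mate_def cells_at_iff cell_simps corner_pair_cells)

lemma mate_hid: "corner_pair a X p q \<Longrightarrow> mate p (hid D a) q = vid D X"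
  using corner_pair_cells[of a X p q] by (simp add: mate_def unit_cells)

lemma mate_hcomp:
  assumes "corner_pair a X p q" "corner_pair b Y p' q'" "corner_pair c Z p'' q''"
    "f \<in> vcells a b" "g \<in> vcells b c"
  shows "hcomp D (mate p f q') (mate p' g q'') = mate p (vcomp D f g) q''"
proof -
  let ?I = "hid D \<one>\<^bsub>hedges D\<^esub>" and ?A = "vcomp D p f" and ?B = "vcomp D g q''"
  note [simp] = corner_pair_cells[OF assms(1)] corner_pair_cells[OF assms(2)]
    corner_pair_cells[OF assms(3)]
  have [simp]: "f \<in> cells D" "ctop D f = a" "cbot D f = b" "cleft D f = \<one>\<^bsub>vedges D\<^esub>"
    "cright D f = \<one>\<^bsub>vedges D\<^esub>"
    "g \<in> cells D" "ctop D g = b" "cbot D g = c" "cleft D g = \<one>\<^bsub>vedges D\<^esub>" "cright D g = \<one>\<^bsub>vedges D\<^esub>"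
    using assms by (auto simp: cells_at_iff)
  \<comment> \<open>Padding with identities on the unit aligns the cuts: \<open>q'\<close> and
    \<open>p'\<close> come to stand in the same row, where they yank to
    \<open>hid D b\<close>.\<close>
  have "hcomp D (mate p f q') (mate p' g q'') = hcomp D (vcomp D ?A (vcomp D q' ?I)) (vcomp D ?I (vcomp D p' ?B))"
    by (simp add: mate_def cell_simps)
  also have "\<dots> = vcomp D (hcomp D ?A ?I) (hcomp D (vcomp D q' ?I) (vcomp D p' ?B))"
    by (rule interchange) (simp_all add: cell_simps)
  also have "hcomp D (vcomp D q' ?I) (vcomp D p' ?B) = vcomp D (hcomp D q' p') (hcomp D ?I ?B)"
    by (rule interchange) (simp_all add: cell_simps)
  finally show ?thesis
    by (simp add: mate_def cell_simps)
qed

text \<open>Interchange with identities: two cells meeting along a trivial vertical edge can be slid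
  past each other, so either one may be performed first.\<close>

lemma hcomp_eq_vcomp:
  assumes "\<alpha> \<in> cells D" "\<beta> \<in> cells D" "cright D \<alpha> = \<one>\<^bsub>vedges D\<^esub>" "cleft D \<beta> = \<one>\<^bsub>vedges D\<^esub>"
  shows "vcomp D (hcomp D (hid D (ctop D \<alpha>)) \<beta>) (hcomp D \<alpha> (hid D (cbot D \<beta>))) = hcomp D \<alpha> \<beta>"
    and "vcomp D (hcomp D \<alpha> (hid D (ctop D \<beta>))) (hcomp D (hid D (cbot D \<alpha>)) \<beta>) = hcomp D \<alpha> \<beta>"
  using interchange[of "hid D (ctop D \<alpha>)" \<alpha> \<beta> "hid D (cbot D \<beta>)"]
    interchange[of \<alpha> "hid D (cbot D \<alpha>)" "hid D (ctop D \<beta>)" \<beta>] assms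
  by (simp_all add: cell_simps)

text \<open>An Eckmann-Hilton argument: the edge between the two cells is trivial in both
  directions. The upper cell becomes the right one.\<close>

lemma vcomp_swap:
  assumes "q \<in> cells D" "p \<in> cells D" "cbot D q = \<one>\<^bsub>hedges D\<^esub>" "ctop D p = \<one>\<^bsub>hedges D\<^esub>"
    "cleft D q = \<one>\<^bsub>vedges D\<^esub>" "cright D p = \<one>\<^bsub>vedges D\<^esub>"
  shows "vcomp D q p = hcomp D p q"
  using hcomp_eq_vcomp(1)[of p q] assms by (simp add: cell_simps)

text \<open>The object of the joined pair is the product in reverse order, which is where the
  symmetry of \<open>A\<close> enters the comparison cells of the functor for the polarity \<open>Circ\<close>.\<close>

lemma corner_pair_join:
  assumes "corner_pair a X p q" "corner_pair b Y p' q'"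
  shows "corner_pair (b \<otimes>\<^bsub>hedges D\<^esub> a) (X \<otimes>\<^bsub>vedges D\<^esub> Y) (join_in a p p') (join_out b q q')"
proof -
  note [simp] = corner_pair_cells[OF assms(1)] corner_pair_cells[OF assms(2)]
  have "hcomp D (join_out b q q') (join_in a p p') = vcomp D (hcomp D (hcomp D (hid D b) q) p) (hcomp D q' (hcomp D p' (hid D a)))"
    unfolding join_out_def join_in_def by (rule interchange) (simp_all add: cell_simps)
  also have "hcomp D q' (hcomp D p' (hid D a)) = hcomp D (hcomp D q' p') (hid D a)"
    by (subst hcomp_assoc[symmetric]) (simp_all add: cell_simps)
  finally have 1: "hcomp D (join_out b q q') (join_in a p p') = hid D (b \<otimes>\<^bsub>hedges D\<^esub> a)"
    by (simp add: cell_simps)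
  have "vcomp D (join_in a p p') (join_out b q q')
      = vcomp D p (vcomp D (vcomp D (hcomp D p' (hid D a)) (hcomp D (hid D b) q)) q')"
    by (simp add: join_in_def join_out_def cell_simps)
  \<comment> \<open>The corner giving up \<open>a\<close> is moved above the corner bringing in
    \<open>b\<close>; then \<open>p\<close> meets its own partner \<open>q\<close>, and
    \<open>p'\<close> its partner \<open>q'\<close>.\<close>
  also have "vcomp D (hcomp D p' (hid D a)) (hcomp D (hid D b) q) = vcomp D q p'"
    using hcomp_eq_vcomp(2)[of p' q] vcomp_swap[of q p'] by simp
  also have "vcomp D p (vcomp D (vcomp D q p') q') = vcomp D (vcomp D p q) (vcomp D p' q')"
    by (simp only: vcomp_assoc vcomp_cell corner_pair_cells(1-10)[OF assms(1)] corner_pair_cells(1-10)[OF assms(2)])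
  finally have 2: "vcomp D (join_in a p p') (join_out b q q') = vid D (X \<otimes>\<^bsub>vedges D\<^esub> Y)"
    by (simp add: cell_simps)
  show ?thesis
    unfolding corner_pair_def using 1 2 by
      (simp add: cells_at_iff join_in_def join_out_def cell_simps)
qed

lemma mate_vcomp:
  assumes "corner_pair a X p q" "corner_pair b Y p' q'" "corner_pair c Z p2 q2"
    "corner_pair d W p2' q2'"
    "f \<in> vcells a b" "g \<in> vcells c d"
  shows "vcomp D (mate p f q') (mate p2 g q2') = mate (join_in a p p2) (hcomp D g f) (join_out d q' q2')"
proof -
  note [simp] = corner_pair_cells(1-10,13,14)[OF assms(1)]
    corner_pair_cells(1-10,13,14)[OF assms(2)]
    corner_pair_cells(1-10,13,14)[OF assms(3)] corner_pair_cells(1-10,13,14)[OF assms(4)]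
  have [simp]: "f \<in> cells D" "ctop D f = a" "cbot D f = b" "cleft D f = \<one>\<^bsub>vedges D\<^esub>"
    "cright D f = \<one>\<^bsub>vedges D\<^esub>"
    "g \<in> cells D" "ctop D g = c" "cbot D g = d" "cleft D g = \<one>\<^bsub>vedges D\<^esub>" "cright D g = \<one>\<^bsub>vedges D\<^esub>"
    using assms by (auto simp: cells_at_iff)
  \<comment> \<open>\<open>?M\<close> is the common middle block. Expanded by interchange it is the
    middle of the mate of \<open>hcomp D g f\<close>; turned upright by \<open>vcomp_swap\<close> it
    is the middle of the vertical composite of the two mates.\<close>
  let ?M = "hcomp D (vcomp D p2 g) (vcomp D f q')"
  have "?M = hcomp D (vcomp D (vcomp D p2 g) (hid D d)) (vcomp D (vcomp D (hid D a) f) q')"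
    by (simp add: cell_simps)
  also have "\<dots> = vcomp D (hcomp D (vcomp D p2 g) (vcomp D (hid D a) f)) (hcomp D (hid D d) q')"
    by (rule interchange) (simp_all add: cell_simps)
  also have
    "hcomp D (vcomp D p2 g) (vcomp D (hid D a) f) = vcomp D (hcomp D p2 (hid D a)) (hcomp D g f)"
    by (rule interchange) (simp_all add: cell_simps)
  finally have 1:
    "mate (join_in a p p2) (hcomp D g f) (join_out d q' q2') = vcomp D p (vcomp D ?M q2')"
    by (simp add: mate_def join_in_def join_out_def cell_simps)
  have "?M = vcomp D (vcomp D f q') (vcomp D p2 g)"
    by (rule vcomp_swap[symmetric]) (simp_all add: cell_simps)
  then show ?thesis
    unfolding 1 by (simp add: mate_def cell_simps)
qed

lemma join_in_assoc:
  assumes "corner_pair a X p q" "corner_pair b Y p' q'" "corner_pair c Z p'' q''"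
  shows "join_in (b \<otimes>\<^bsub>hedges D\<^esub> a) (join_in a p p') p'' = join_in a p (join_in b p' p'')"
proof -
  note [simp] = corner_pair_cells[OF assms(1)] corner_pair_cells[OF assms(2)]
    corner_pair_cells[OF assms(3)]
  have "hcomp D (vcomp D p' (hcomp D p'' (hid D b))) (vcomp D (hid D a) (hid D a))
      = vcomp D (hcomp D p' (hid D a)) (hcomp D (hcomp D p'' (hid D b)) (hid D a))"
    by (rule interchange) (simp_all add: cell_simps)
  then show ?thesis
    by (simp add: join_in_def cell_simps)
qed

lemma join_out_assoc:
  assumes "corner_pair a X p q" "corner_pair b Y p' q'" "corner_pair c Z p'' q''"
  shows "join_out c (join_out b q q') q'' = join_out (c \<otimes>\<^bsub>hedges D\<^esub> b) q (join_out c q' q'')"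
proof -
  note [simp] = corner_pair_cells[OF assms(1)] corner_pair_cells[OF assms(2)]
    corner_pair_cells[OF assms(3)]
  have "hcomp D (vcomp D (hid D c) (hid D c)) (vcomp D (hcomp D (hid D b) q) q')
      = vcomp D (hcomp D (hid D c) (hcomp D (hid D b) q)) (hcomp D (hid D c) q')"
    by (rule interchange) (simp_all add: cell_simps)
  then show ?thesis
    by (simp add: join_out_def cell_simps flip: hcomp_assoc hcomp_hid)
qed

lemma join_unit:
  assumes "corner_pair a X p q"
  shows "join_in \<one>\<^bsub>hedges D\<^esub> (hid D \<one>\<^bsub>hedges D\<^esub>) p = p" "join_in a p (hid D \<one>\<^bsub>hedges D\<^esub>) = p"
    "join_out a (hid D \<one>\<^bsub>hedges D\<^esub>) q = q" "join_out \<one>\<^bsub>hedges D\<^esub> q (hid D \<one>\<^bsub>hedges D\<^esub>) = q"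
  using corner_pair_cells[OF assms] by (simp_all add: join_in_def join_out_def cell_simps)

text \<open>Composing with \<open>q\<close> on the left and \<open>p'\<close> on the right bends
  both vertical edges into horizontal ones. This direction uses the horizontal yanking equations,
  and \<open>mate_unmate\<close> uses the vertical ones.\<close>

lemma unmate_mate:
  assumes "corner_pair a X p q" "corner_pair b Y p' q'" "f \<in> vcells a b"
  shows "hcomp D (hcomp D q (mate p f q')) p' = f"
proof -
  note [simp] = corner_pair_cells[OF assms(1)] corner_pair_cells[OF assms(2)]
  have [simp]: "f \<in> cells D" "ctop D f = a" "cbot D f = b" "cleft D f = \<one>\<^bsub>vedges D\<^esub>"
    "cright D f = \<one>\<^bsub>vedges D\<^esub>"
    using assms by (auto simp: cells_at_iff)
  let ?I = "hid D \<one>\<^bsub>hedges D\<^esub>"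
  have "hcomp D (vcomp D q ?I) (vcomp D p (vcomp D f q')) = vcomp D (hcomp D q p) (hcomp D ?I (vcomp D f q'))"
    by (rule interchange) (simp_all add: cell_simps)
  then have "hcomp D q (mate p f q') = vcomp D f q'"
    by (simp add: mate_def cell_simps)
  moreover have "hcomp D (vcomp D f q') (vcomp D ?I p') = vcomp D (hcomp D f ?I) (hcomp D q' p')"
    by (rule interchange) (simp_all add: cell_simps)
  ultimately show ?thesis
    by (simp add: cell_simps)
qed

lemma mate_unmate:
  assumes "corner_pair a X p q" "corner_pair b Y p' q'" "\<alpha> \<in> cells_at D \<one>\<^bsub>hedges D\<^esub> \<one>\<^bsub>hedges D\<^esub> X Y"
  shows "hcomp D (hcomp D q \<alpha>) p' \<in> vcells a b" "mate p (hcomp D (hcomp D q \<alpha>) p') q' = \<alpha>"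
proof -
  note [simp] = corner_pair_cells[OF assms(1)] corner_pair_cells[OF assms(2)]
  have [simp]: "\<alpha> \<in> cells D" "ctop D \<alpha> = \<one>\<^bsub>hedges D\<^esub>" "cbot D \<alpha> = \<one>\<^bsub>hedges D\<^esub>" "cleft D \<alpha> = X"
    "cright D \<alpha> = Y"
    using assms by (auto simp: cells_at_iff)
  let ?I = "hid D \<one>\<^bsub>hedges D\<^esub>"
  show "hcomp D (hcomp D q \<alpha>) p' \<in> vcells a b"
    by (simp add: cells_at_iff cell_simps)
  have "hcomp D (vcomp D p q) (vcomp D ?I (hcomp D \<alpha> p')) = vcomp D (hcomp D p ?I) (hcomp D q (hcomp D \<alpha> p'))"
    by (rule interchange) (simp_all add: cell_simps)
  then have 1: "vcomp D p (hcomp D (hcomp D q \<alpha>) p') = hcomp D \<alpha> p'"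
    by (simp add: cell_simps)
  have "hcomp D (vcomp D \<alpha> ?I) (vcomp D p' q') = vcomp D (hcomp D \<alpha> p') (hcomp D ?I q')"
    by (rule interchange) (simp_all add: cell_simps)
  then show "mate p (hcomp D (hcomp D q \<alpha>) p') q' = \<alpha>"
    unfolding mate_def 1 by (simp add: cell_simps)
qed

end

text \<open>Reflection exchanges the two polarities: the corners of \<open>a\<^sup>\<bullet>\<close> form a \<open>corner_pair\<close> in the
  reflected double category.\<close>

definition hmirror :: "('h, 'v, 'c) sodc \<Rightarrow> ('h, 'v, 'c) sodc" where
  "hmirror D = D\<lparr>hedges := (hedges D)\<lparr>mult := \<lambda>x y. y \<otimes>\<^bsub>hedges D\<^esub> x\<rparr>,
    cleft := cright D, cright := cleft D, hcomp := \<lambda>\<alpha> \<beta>. hcomp D \<beta> \<alpha>\<rparr>"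

lemma hmirror_simps:
  "hcomp (hmirror D) \<alpha> \<beta> = hcomp D \<beta> \<alpha>" "vcomp (hmirror D) = vcomp D"
  "hid (hmirror D) = hid D" "vid (hmirror D) = vid D" "vedges (hmirror D) = vedges D"
  "carrier (hedges (hmirror D)) = carrier (hedges D)" "\<one>\<^bsub>hedges (hmirror D)\<^esub> = \<one>\<^bsub>hedges D\<^esub>"
  "a \<otimes>\<^bsub>hedges (hmirror D)\<^esub> b = b \<otimes>\<^bsub>hedges D\<^esub> a"
  "cells_at (hmirror D) T B L R = cells_at D T B R L"
  by (auto simp: hmirror_def cells_at_def)

lemma (in single_object_double_category) hmirror_double_category:
  "single_object_double_category (hmirror D)"
proof -
  interpret H: monoid "hedges D" by (rule hedges_monoid)
  have "monoid ((hedges D)\<lparr>mult := \<lambda>x y. y \<otimes>\<^bsub>hedges D\<^esub> x\<rparr>)"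
    by unfold_locales (auto simp: H.m_assoc)
  then show ?thesis
    by unfold_locales (auto simp: hmirror_def cells_at_def cell_simps vedges_monoid interchange)
qed

lemma homs_horizontal_cells:
  "homs (horizontal_cells D) X Y = cells_at D \<one>\<^bsub>hedges D\<^esub> \<one>\<^bsub>hedges D\<^esub> X Y"
  by (auto simp: homs_def horizontal_cells_def cells_at_def)


section \<open>Contexts\<close>

text \<open>Contexts are lists of rows, from top to bottom. In a left context \<open>Give a K\<close> stands for
  \<open>1\<^sub>K | s\<^sup>\<circ>\<^sub>a\<close> and \<open>Take a K\<close> for \<open>1\<^sub>K | r\<^sup>\<bullet>\<^sub>a\<close>; in a right context \<open>Give a K\<close> stands for \<open>s\<^sup>\<bullet>\<^sub>a
    | 1\<^sub>K\<close> and
  \<open>Take a K\<close> for \<open>r\<^sup>\<circ>\<^sub>a | 1\<^sub>K\<close>. The object \<open>K\<close> is recorded because it cannot be recovered from a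
  product.\<close>

datatype ('o, 'm) row = Arr 'm | Give 'o 'o | Take 'o 'o

context strict_monoidal_category
begin

interpretation ob: monoid "obj C"
  by (rule obj_monoid)

abbreviation obs :: "'o set" where
  "obs \<equiv> carrier (obj C)"

abbreviation otens :: "'o \<Rightarrow> 'o \<Rightarrow> 'o" (infixr "\<odot>" 70) where
  "X \<odot> Y \<equiv> X \<otimes>\<^bsub>obj C\<^esub> Y"

abbreviation mseq :: "'m \<Rightarrow> 'm \<Rightarrow> 'm" (infixr "\<triangleright>" 60) where
  "f \<triangleright> g \<equiv> seq C f g"

abbreviation mtens :: "'m \<Rightarrow> 'm \<Rightarrow> 'm" (infixr "\<oslash>" 70) where
  "f \<oslash> g \<equiv> tens C f g"

section \<open>Calculus of morphisms in terms of sources and targets\<close>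

lemma mor_assoc:
  "\<lbrakk>f \<in> mor C; g \<in> mor C; h \<in> mor C; tgt C f = src C g; tgt C g = src C h\<rbrakk>
    \<Longrightarrow> (f \<triangleright> g) \<triangleright> h = f \<triangleright> g \<triangleright> h"
  using seq_assoc[of f "src C f" "src C g" g "src C h" h "tgt C h"] by (simp add: homs_def)

lemma mor_ident_left: "\<lbrakk>f \<in> mor C; src C f = X\<rbrakk> \<Longrightarrow> ident C X \<triangleright> f = f"
  using seq_ident_left[of f X "tgt C f"] by (simp add: homs_def)

lemma mor_ident_right: "\<lbrakk>f \<in> mor C; tgt C f = X\<rbrakk> \<Longrightarrow> f \<triangleright> ident C X = f"
  using seq_ident_right[of f "src C f" X] by (simp add: homs_def)

lemma mor_interchange:
  "\<lbrakk>f \<in> mor C; g \<in> mor C; f' \<in> mor C; g' \<in> mor C; tgt C f = src C g; tgt C f' = src C g'\<rbrakk>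
    \<Longrightarrow> (f \<oslash> f') \<triangleright> (g \<oslash> g') = (f \<triangleright> g) \<oslash> (f' \<triangleright> g')"
  using tens_seq[of f "src C f" "src C g" g "tgt C g" f' "src C f'" "src C g'" g' "tgt C g'"]
  by (simp add: homs_def)

lemmas mor_simps = seq_mor tens_mor ident_mor src_obj tgt_obj mor_assoc mor_ident_left
  mor_ident_right tens_assoc tens_unit_left tens_unit_right ob.m_assoc ob.m_closed ob.one_closed

text \<open>The typing of row lists: top object \<open>M\<close>, bottom object \<open>M'\<close>,
  trivial left side, and right side \<open>X\<close> with one letter per corner. For
  \<open>right_path\<close> the word is the left side and the right side is trivial, so a given
  letter is a \<open>Give\<close> in one kind of context and a \<open>Take\<close> in the
  other.\<close>

primrec left_path :: "('o, 'm) row list \<Rightarrow> 'o signed_word \<Rightarrow> 'o \<Rightarrow> 'o \<Rightarrow> bool" where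
  "left_path [] X M M' \<longleftrightarrow> X = [] \<and> M \<in> obs \<and> M' = M"
| "left_path (x # l) X M M' \<longleftrightarrow> (case x of
      Arr f \<Rightarrow> f \<in> mor C \<and> M = src C f \<and> left_path l X (tgt C f) M'
    | Give a K \<Rightarrow> a \<in> obs \<and> K \<in> obs \<and> M = K \<odot> a \<and>
        (\<exists>Y. X = (a, Circ) # Y \<and> left_path l Y K M')
    | Take a K \<Rightarrow> a \<in> obs \<and> K \<in> obs \<and> M = K \<and>
        (\<exists>Y. X = (a, Bull) # Y \<and> left_path l Y (K \<odot> a) M'))"

primrec right_path :: "('o, 'm) row list \<Rightarrow> 'o signed_word \<Rightarrow> 'o \<Rightarrow> 'o \<Rightarrow> bool" where
  "right_path [] X N N' \<longleftrightarrow> X = [] \<and> N \<in> obs \<and> N' = N"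
| "right_path (x # r) X N N' \<longleftrightarrow> (case x of
      Arr f \<Rightarrow> f \<in> mor C \<and> N = src C f \<and> right_path r X (tgt C f) N'
    | Give a K \<Rightarrow> a \<in> obs \<and> K \<in> obs \<and> N = a \<odot> K \<and>
        (\<exists>Y. X = (a, Bull) # Y \<and> right_path r Y K N')
    | Take a K \<Rightarrow> a \<in> obs \<and> K \<in> obs \<and> N = K \<and>
        (\<exists>Y. X = (a, Circ) # Y \<and> right_path r Y (a \<odot> K) N'))"

text \<open>The composite of a left and a right context; when both have reached a corner, the two corners
  cancel by yanking and only the bracketing of the three objects changes.\<close>

fun run :: "'o \<Rightarrow> 'o \<Rightarrow> ('o, 'm) row list \<Rightarrow> ('o, 'm) row list \<Rightarrow> 'm" where
  "run M N [] [] = ident C (M \<odot> N)"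
| "run M N (Arr f # l) r = (f \<oslash> ident C N) \<triangleright> run (tgt C f) N l r"
| "run M N [] (Arr g # r) = (ident C M \<oslash> g) \<triangleright> run M (tgt C g) [] r"
| "run M N (Give a K # l) (Arr g # r) = (ident C M \<oslash> g) \<triangleright> run M (tgt C g) (Give a K # l) r"
| "run M N (Take a K # l) (Arr g # r) = (ident C M \<oslash> g) \<triangleright> run M (tgt C g) (Take a K # l) r"
| "run M N (Give a K # l) (Take b J # r) = run K (a \<odot> J) l r"
| "run M N (Take a K # l) (Give b J # r) = run (K \<odot> a) J l r"

lemma left_path_obs: "left_path l X M M' \<Longrightarrow> M \<in> obs \<and> M' \<in> obs"
  by (induction l arbitrary: X M) (auto simp: mor_simps split: row.splits)

lemma right_path_obs: "right_path l X M M' \<Longrightarrow> M \<in> obs \<and> M' \<in> obs"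
  by (induction l arbitrary: X M) (auto simp: mor_simps split: row.splits)

lemma left_path_append:
  "\<lbrakk>left_path l X M M'; left_path l' Y M' M''\<rbrakk> \<Longrightarrow> left_path (l @ l') (X @ Y) M M''"
  by (induction l arbitrary: X M) (auto split: row.splits)

lemma right_path_append:
  "\<lbrakk>right_path r X N N'; right_path r' Y N' N''\<rbrakk> \<Longrightarrow> right_path (r @ r') (X @ Y) N N''"
  by (induction r arbitrary: X N) (auto split: row.splits)

text \<open>\<open>run\<close> has no clause for a corner against an empty list or for two corners
  of the same kind. The common word \<open>X\<close> excludes these cases.\<close>

lemma run_mor:
  "\<lbrakk>left_path l X M M'; right_path r X N N'\<rbrakk>
    \<Longrightarrow> run M N l r \<in> mor C \<and> src C (run M N l r) = M \<odot> N \<and> tgt C (run M N l r) = M' \<odot> N'"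
proof (induction M N l r arbitrary: X rule: run.induct)
  case (2 M N f l r)
  then show ?case using right_path_obs[of r X N N'] by (auto simp: mor_simps)
next
  case (3 M N g r)
  then show ?case using "3.IH"[of X] by (auto simp: mor_simps)
next
  case (4 M N a K l g r)
  then show ?case using "4.IH"[of X] by (auto simp: mor_simps)
next
  case (5 M N a K l g r)
  then show ?case using "5.IH"[of X] by (auto simp: mor_simps)
qed (auto simp: mor_simps)

text \<open>The clauses of \<open>run\<close> give priority to morphisms of the left context. By
  interchange, a morphism heading the right context may be performed first as well.\<close>

lemma run_Arr_right:
  "\<lbrakk>left_path l X M M'; right_path (Arr g # r) X N N'\<rbrakk>
    \<Longrightarrow> run M N l (Arr g # r) = (ident C M \<oslash> g) \<triangleright> run M (tgt C g) l r"
proof (induction l arbitrary: X M)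
  case (Cons x l)
  show ?case
  proof (cases x)
    case (Arr f)
    with Cons.prems have 1: "f \<in> mor C" "g \<in> mor C" "src C f = M" "src C g = N"
      and l: "left_path l X (tgt C f) M'" and r: "right_path r X (tgt C g) N'"
      by auto
    have "run M N (x # l) (Arr g # r)
        = (f \<oslash> ident C N) \<triangleright> (ident C (tgt C f) \<oslash> g) \<triangleright> run (tgt C f) (tgt C g) l r"
      using Cons Arr l by simp
    also have "\<dots> = ((f \<oslash> ident C N) \<triangleright> (ident C (tgt C f) \<oslash> g)) \<triangleright> run (tgt C f) (tgt C g) l r"
      using 1 run_mor[OF l r] by (auto simp: mor_simps)
    also have
      "(f \<oslash> ident C N) \<triangleright> (ident C (tgt C f) \<oslash> g) = (ident C M \<oslash> g) \<triangleright> (f \<oslash> ident C (tgt C g))"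
      using 1 by (auto simp: mor_interchange mor_simps)
    also have "\<dots> \<triangleright> run (tgt C f) (tgt C g) l r
        = (ident C M \<oslash> g) \<triangleright> (f \<oslash> ident C (tgt C g)) \<triangleright> run (tgt C f) (tgt C g) l r"
      using 1 run_mor[OF l r] by (auto simp: mor_simps)
    finally show ?thesis
      using Arr by simp
  qed (use Cons in auto)
qed auto

text \<open>Corners are consumed in pairs, so the upper halves, having the same word, are exhausted
  together.\<close>

lemma run_append:
  "\<lbrakk>left_path l X M M'; right_path r X N N'; left_path l' Y M' M''; right_path r' Y N' N''\<rbrakk>
    \<Longrightarrow> run M N (l @ l') (r @ r') = run M N l r \<triangleright> run M' N' l' r'"
proof (induction M N l r arbitrary: X rule: run.induct)
  case (1 M N)
  then show ?case using run_mor[of l' Y M' M'' r' N' N''] by (simp add: mor_simps)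
next
  case (2 M N f l r)
  then have "run (tgt C f) N (l @ l') (r @ r') = run (tgt C f) N l r \<triangleright> run M' N' l' r'"
    by auto
  then show ?case
    using 2 run_mor[of l' Y M' M'' r' N' N''] run_mor[of l X "tgt C f" M' r N N']
      right_path_obs[of r X N N']
    by (auto simp: mor_simps)
next
  \<comment> \<open>The critical case: \<open>l'\<close> may begin with a morphism, which
    \<open>run\<close> would perform before \<open>g\<close>. \<open>run_Arr_right\<close> restores
    the order.\<close>
  case (3 M N g r)
  then have r: "right_path r [] (tgt C g) N'" and 1: "g \<in> mor C" "src C g = N" "X = []" "M' = M"
    "M \<in> obs"
    by auto
  have "run M (tgt C g) ([] @ l') (r @ r') = run M (tgt C g) [] r \<triangleright> run M' N' l' r'"
    using 3 by auto
  moreover have "right_path (Arr g # r @ r') Y N N''"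
    using right_path_append[OF r, of r' Y N''] 1 3 by simp
  ultimately show ?case
    using 3 1 run_mor[of l' Y M' M'' r' N' N''] run_mor[of "[]" X M M' r "tgt C g" N'] r
    by (auto simp: mor_simps run_Arr_right)
next
  case (4 M N a K l g r)
  then show ?case
    using "4.IH"[of X] run_mor[of l' Y M' M'' r' N' N'']
      run_mor[of "Give a K # l" X M M' r "tgt C g" N']
    by (auto simp: mor_simps)
next
  case (5 M N a K l g r)
  then show ?case
    using "5.IH"[of X] run_mor[of l' Y M' M'' r' N' N'']
      run_mor[of "Take a K # l" X M M' r "tgt C g" N']
    by (auto simp: mor_simps)
qed auto

section \<open>Contexts with at most one corner, read as morphisms\<close>

primrec composite :: "'o \<Rightarrow> ('o, 'm) row list \<Rightarrow> 'm" where
  "composite M [] = ident C M"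
| "composite M (x # l) = (case x of Arr f \<Rightarrow> f \<triangleright> composite (tgt C f) l | _ \<Rightarrow> ident C M)"

text \<open>The four functions close off a context with a single corner by composing it with the
  matching one: \<open>left_give\<close> attaches an r-corner for \<open>Circ\<close> and
  \<open>left_take\<close> an s-corner for \<open>Bull\<close> on the right;
  \<open>right_give\<close> attaches an r-corner for \<open>Bull\<close> and
  \<open>right_take\<close> an s-corner for \<open>Circ\<close> on the left. The values
  \<open>undefined\<close> belong to contexts of another type.\<close>

primrec left_give :: "'o \<Rightarrow> ('o, 'm) row list \<Rightarrow> 'm" where
  "left_give a [] = undefined"
| "left_give a (x # l) = (case x of Arr f \<Rightarrow> f \<triangleright> left_give a l
    | Give b K \<Rightarrow> composite K l \<oslash> ident C a | Take b K \<Rightarrow> undefined)"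

primrec left_take :: "'o \<Rightarrow> ('o, 'm) row list \<Rightarrow> 'm" where
  "left_take a [] = undefined"
| "left_take a (x # l) = (case x of Arr f \<Rightarrow> (f \<oslash> ident C a) \<triangleright> left_take a l
    | Take b K \<Rightarrow> composite (K \<odot> a) l | Give b K \<Rightarrow> undefined)"

primrec right_give :: "'o \<Rightarrow> ('o, 'm) row list \<Rightarrow> 'm" where
  "right_give a [] = undefined"
| "right_give a (x # r) = (case x of Arr f \<Rightarrow> f \<triangleright> right_give a r
    | Give b K \<Rightarrow> ident C a \<oslash> composite K r | Take b K \<Rightarrow> undefined)"

primrec right_take :: "'o \<Rightarrow> ('o, 'm) row list \<Rightarrow> 'm" where
  "right_take a [] = undefined"
| "right_take a (x # r) = (case x of Arr f \<Rightarrow> (ident C a \<oslash> f) \<triangleright> right_take a r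
    | Take b K \<Rightarrow> composite (a \<odot> K) r | Give b K \<Rightarrow> undefined)"

lemma composite_left_mor:
  "left_path l [] M M' \<Longrightarrow> composite M l \<in> mor C \<and> src C (composite M l) = M \<and> tgt C (composite M l) = M'"
  by (induction l arbitrary: M) (auto simp: mor_simps split: row.splits)

lemma composite_right_mor:
  "right_path r [] N N' \<Longrightarrow> composite N r \<in> mor C \<and> src C (composite N r) = N \<and> tgt C (composite N r) = N'"
  by (induction r arbitrary: N) (auto simp: mor_simps split: row.splits)

lemma left_give_mor:
  "left_path l [(a, Circ)] M M'
    \<Longrightarrow> left_give a l \<in> mor C \<and> src C (left_give a l) = M \<and> tgt C (left_give a l) = M' \<odot> a"
  by (induction l arbitrary: M) (auto simp: mor_simps composite_left_mor split: row.splits)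

lemma left_take_mor:
  "left_path l [(a, Bull)] M M'
    \<Longrightarrow> a \<in> obs \<and> left_take a l \<in> mor C \<and> src C (left_take a l) = M \<odot> a \<and> tgt C (left_take a l) = M'"
  by (induction l arbitrary: M) (auto simp: mor_simps composite_left_mor split: row.splits)

lemma right_give_mor:
  "right_path r [(a, Bull)] N N'
    \<Longrightarrow> right_give a r \<in> mor C \<and> src C (right_give a r) = N \<and> tgt C (right_give a r) = a \<odot> N'"
  by (induction r arbitrary: N) (auto simp: mor_simps composite_right_mor split: row.splits)

lemma right_take_mor:
  "right_path r [(a, Circ)] N N'
    \<Longrightarrow> a \<in> obs \<and> right_take a r \<in> mor C \<and> src C (right_take a r) = a \<odot> N \<and> tgt C (right_take a r) =
      N'"
  by (induction r arbitrary: N) (auto simp: mor_simps composite_right_mor split: row.splits)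

lemma run_Nil:
  "\<lbrakk>left_path l [] M M'; right_path r [] N N'\<rbrakk> \<Longrightarrow> run M N l r = composite M l \<oslash> composite N r"
proof (induction M N l r rule: run.induct)
  case (2 M N f l r)
  then show ?case
    using composite_left_mor[of l "tgt C f" M'] composite_right_mor[of r N N']  right_path_obs[of r]
    by (auto simp: mor_interchange mor_simps)
next
  case (3 M N g r)
  then show ?case
    using composite_right_mor[of r "tgt C g" N']
    by (auto simp: mor_interchange mor_simps)
qed (auto simp: tens_ident)

text \<open>A \<open>Circ\<close> letter is passed from left to right, so the left context can run
  to its end before the right one starts, with \<open>a\<close> waiting between the two. This is the
  form in which the vertical yanking equation is later recognised.\<close>

lemma run_Circ:
  "\<lbrakk>left_path l [(a, Circ)] M M'; right_path r [(a, Circ)] N N'\<rbrakk>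
    \<Longrightarrow> run M N l r = (left_give a l \<oslash> ident C N) \<triangleright> (ident C M' \<oslash> right_take a r)"
proof (induction M N l r rule: run.induct)
  case (2 M N f l r)
  then have f: "f \<in> mor C" "src C f = M" and l: "left_path l [(a, Circ)] (tgt C f) M'"
    by auto
  have *: "(f \<triangleright> left_give a l) \<oslash> ident C N = (f \<oslash> ident C N) \<triangleright> (left_give a l \<oslash> ident C N)"
    using f left_give_mor[OF l] right_path_obs[OF 2(3)] by (simp add: mor_interchange mor_simps)
  have "run M N (Arr f # l) r
      = (f \<oslash> ident C N) \<triangleright> (left_give a l \<oslash> ident C N) \<triangleright> (ident C M' \<oslash> right_take a r)"
    using 2 l by simp
  also have "\<dots> = ((f \<triangleright> left_give a l) \<oslash> ident C N) \<triangleright> (ident C M' \<oslash> right_take a r)"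
    unfolding * using f left_give_mor[OF l] right_take_mor[OF 2(3)] right_path_obs[OF 2(3)]
      left_path_obs[OF l]
    by (simp add: mor_simps)
  finally show ?case by simp
next
  case (4 M N b K l g r)
  then have g: "g \<in> mor C" "src C g = N" and r: "right_path r [(a, Circ)] (tgt C g) N'"
    by auto
  note l = left_give_mor[OF 4(2)] right_path_obs[OF 4(3)]
  have *: "ident C M' \<oslash> ((ident C a \<oslash> g) \<triangleright> right_take a r)
      = (ident C M' \<oslash> ident C a \<oslash> g) \<triangleright> (ident C M' \<oslash> right_take a r)"
    using g right_take_mor[OF r] left_path_obs[OF 4(2)] by (simp add: mor_interchange mor_simps)
  \<comment> \<open>Here \<open>g\<close> and \<open>left_give\<close> act on different tensor
    factors. After the exchange \<open>a\<close> stands between them, whence the factor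
    \<open>ident C a\<close> next to \<open>g\<close>.\<close>
  have **: "(ident C M \<oslash> g) \<triangleright> (left_give a (Give b K # l) \<oslash> ident C (tgt C g))
      = (left_give a (Give b K # l) \<oslash> ident C N) \<triangleright> (ident C M' \<oslash> ident C a \<oslash> g)"
    using g l right_take_mor[OF r] left_path_obs[OF 4(2)]
    by (simp add: mor_interchange mor_simps tens_ident flip: tens_assoc del: left_give.simps)
  have "run M N (Give b K # l) (Arr g # r)
      = (ident C M \<oslash> g) \<triangleright> (left_give a (Give b K # l) \<oslash> ident C (tgt C g)) \<triangleright>
        (ident C M' \<oslash> right_take a r)"
    using 4 r by simp
  also have
    "\<dots> = ((ident C M \<oslash> g) \<triangleright> (left_give a (Give b K # l) \<oslash> ident C (tgt C g))) \<triangleright> (ident C M' \<oslash> right_take a r)"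
    using g l right_take_mor[OF r] left_path_obs[OF 4(2)] by
      (simp add: mor_simps del: left_give.simps)
  also have "\<dots> = (left_give a (Give b K # l) \<oslash> ident C N) \<triangleright> (ident C M' \<oslash> right_take a (Arr g # r))"
    using g l right_take_mor[OF r] left_path_obs[OF 4(2)]
    by (simp add: mor_simps * ** del: left_give.simps)
  finally show ?case .
next
  case (6 M N b K l c J r)
  then have l: "left_path l [] K M'" and r: "right_path r [] (a \<odot> J) N'"
    and [simp]: "b = a" "c = a" "N = J" "a \<in> obs" "J \<in> obs" by auto
  show ?case
    using composite_left_mor[OF l] composite_right_mor[OF r] left_path_obs[OF l]
    by (simp add: run_Nil[OF l r] mor_simps mor_interchange tens_ident flip: tens_assoc)
      (simp add: mor_simps mor_interchange tens_ident)
qed auto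

text \<open>A \<open>Bull\<close> letter is passed from right to left, so it is now the right
  context that runs first and leaves \<open>a\<close> between the two.\<close>

lemma run_Bull:
  "\<lbrakk>left_path l [(a, Bull)] M M'; right_path r [(a, Bull)] N N'\<rbrakk>
    \<Longrightarrow> run M N l r = (ident C M \<oslash> right_give a r) \<triangleright> (left_take a l \<oslash> ident C N')"
proof (induction M N l r rule: run.induct)
  case (2 M N f l r)
  then have f: "f \<in> mor C" "src C f = M" and l: "left_path l [(a, Bull)] (tgt C f) M'"
    by auto
  note mor = f left_take_mor[OF l] right_give_mor[OF 2(3)] right_path_obs[OF 2(3)]
    left_path_obs[OF 2(2)] left_path_obs[OF l]
  have *: "((f \<oslash> ident C a) \<triangleright> left_take a l) \<oslash> ident C N'
      = (f \<oslash> ident C a \<oslash> ident C N') \<triangleright> (left_take a l \<oslash> ident C N')"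
    using mor by (simp add: mor_interchange mor_simps flip: tens_assoc)
  have **: "(f \<oslash> ident C N) \<triangleright> (ident C (tgt C f) \<oslash> right_give a r)
      = (ident C M \<oslash> right_give a r) \<triangleright> (f \<oslash> ident C a \<oslash> ident C N')"
    using mor by (simp add: mor_interchange mor_simps tens_ident)
  have "run M N (Arr f # l) r
      = (f \<oslash> ident C N) \<triangleright> (ident C (tgt C f) \<oslash> right_give a r) \<triangleright> (left_take a l \<oslash> ident C N')"
    using 2 l by simp
  also have
    "\<dots> = ((f \<oslash> ident C N) \<triangleright> (ident C (tgt C f) \<oslash> right_give a r)) \<triangleright> (left_take a l \<oslash> ident C N')"
    using mor by (simp add: mor_simps)
  also have "\<dots> = (ident C M \<oslash> right_give a r) \<triangleright> (left_take a (Arr f # l) \<oslash> ident C N')"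
    using mor by (simp add: mor_simps * **)
  finally show ?case .
next
  case (5 M N b K l g r)
  then have g: "g \<in> mor C" "src C g = N" and r: "right_path r [(a, Bull)] (tgt C g) N'"
    by auto
  note mor = g right_give_mor[OF r] left_take_mor[OF 5(2)] right_path_obs[OF 5(3)]
    left_path_obs[OF 5(2)]
  have *: "ident C M \<oslash> (g \<triangleright> right_give a r) = (ident C M \<oslash> g) \<triangleright> (ident C M \<oslash> right_give a r)"
    using mor by (simp add: mor_interchange mor_simps)
  have "run M N (Take b K # l) (Arr g # r)
      = (ident C M \<oslash> g) \<triangleright> (ident C M \<oslash> right_give a r) \<triangleright> (left_take a (Take b K # l) \<oslash> ident C N')"
    using 5 r by simp
  also have "\<dots> = (ident C M \<oslash> right_give a (Arr g # r)) \<triangleright> (left_take a (Take b K # l) \<oslash> ident C N')"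
    using mor by (simp add: mor_simps * del: left_take.simps)
  finally show ?case .
next
  case (7 M N b K l c J r)
  then have l: "left_path l [] (K \<odot> a) M'" and r: "right_path r [] J N'"
    and [simp]: "b = a" "c = a" "M = K" "a \<in> obs" "J \<in> obs" "K \<in> obs" by auto
  show ?case
    using composite_left_mor[OF l] composite_right_mor[OF r] left_path_obs[OF l]
      right_path_obs[OF r]
    by (simp add: run_Nil[OF l r] mor_simps mor_interchange tens_ident flip: tens_assoc)
qed auto

text \<open>\<open>before n l\<close> ends with the \<open>n\<close>-th corner of \<open>l\<close>; the morphisms between it and the next corner
  are left to \<open>after n l\<close>. This choice of the cut does not matter by lemma \<open>run_push_VComp\<close>.\<close>

fun before :: "nat \<Rightarrow> ('o, 'm) row list \<Rightarrow> ('o, 'm) row list" where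
  "before 0 l = []"
| "before n [] = []"
| "before (Suc n) (Arr f # l) = Arr f # before (Suc n) l"
| "before (Suc n) (x # l) = x # before n l"

definition after :: "nat \<Rightarrow> ('o, 'm) row list \<Rightarrow> ('o, 'm) row list" where
  "after n l = drop (length (before n l)) l"

text \<open>Paths are predicates while \<open>push\<close> is a function on all row lists; the
  bottom object of the part cut off therefore has to be computed.\<close>

primrec left_end :: "'o \<Rightarrow> ('o, 'm) row list \<Rightarrow> 'o" where
  "left_end M [] = M"
| "left_end M (x # l) = left_end (case x of Arr f \<Rightarrow> tgt C f | Give a K \<Rightarrow> K | Take a K \<Rightarrow> K \<odot> a) l"

primrec right_end :: "'o \<Rightarrow> ('o, 'm) row list \<Rightarrow> 'o" where
  "right_end N [] = N"
| "right_end N (x # r) = right_end (case x of Arr f \<Rightarrow> tgt C f | Give a K \<Rightarrow> K | Take a K \<Rightarrow> a \<odot> K) r"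

lemma left_end: "left_path l X M M' \<Longrightarrow> left_end M l = M'"
  by (induction l arbitrary: X M) (auto split: row.splits)

lemma right_end: "right_path r X N N' \<Longrightarrow> right_end N r = N'"
  by (induction r arbitrary: X N) (auto split: row.splits)

lemma before_append_after: "before n l @ after n l = l"
proof -
  have "\<exists>k. before n l = take k l"
  proof (induction n l rule: before.induct)
    case (1 l)
    have "before 0 l = take 0 l" by simp
    then show ?case by blast
  next
    case (3 n f l)
    then obtain k where "before (Suc n) l = take k l" by blast
    then have "before (Suc n) (Arr f # l) = take (Suc k) (Arr f # l)" by simp
    then show ?case by blast
  next
    case ("4_1" n v va l)
    then obtain k where "before n l = take k l" by blast
    then have "before (Suc n) (Give v va # l) = take (Suc k) (Give v va # l)" by simp
    then show ?case by blast
  next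
    case ("4_2" n v va l)
    then obtain k where "before n l = take k l" by blast
    then have "before (Suc n) (Take v va # l) = take (Suc k) (Take v va # l)" by simp
    then show ?case by blast
  qed simp
  then show ?thesis
    by (metis after_def append_eq_conv_conj append_take_drop_id)
qed

lemma after_simps [simp]:
  "after 0 l = l" "after (Suc n) (Arr f # l) = after (Suc n) l"
  "after (Suc n) (Give a K # l) = after n l" "after (Suc n) (Take a K # l) = after n l"
  by (simp_all add: after_def)

lemma left_path_split:
  "\<lbrakk>left_path l (X @ Y) M M'; length X = n\<rbrakk> \<Longrightarrow> \<exists>M1. left_path (before n l) X M M1
    \<and> left_path (after n l) Y M1 M'"
proof (induction n l arbitrary: X M rule: before.induct)
  case (1 l)
  then show ?case using left_path_obs[of l Y M M'] by simp
next
  case (3 n f l)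
  then show ?case by auto
next
  case ("4_1" n a K l)
  then obtain Z where "X = (a, Circ) # Z" "length Z = n" "left_path l (Z @ Y) K M'"
    by (cases X) auto
  with "4_1"(1)[of Z K] "4_1"(2) show ?case by auto
next
  case ("4_2" n a K l)
  then obtain Z where "X = (a, Bull) # Z" "length Z = n" "left_path l (Z @ Y) (K \<odot> a) M'"
    by (cases X) auto
  with "4_2"(1)[of Z "K \<odot> a"] "4_2"(2) show ?case by auto
qed auto

lemma right_path_split:
  "\<lbrakk>right_path l (X @ Y) M M'; length X = n\<rbrakk> \<Longrightarrow> \<exists>M1. right_path (before n l) X M M1
    \<and> right_path (after n l) Y M1 M'"
proof (induction n l arbitrary: X M rule: before.induct)
  case (1 l)
  then show ?case using right_path_obs[of l Y M M'] by simp
next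
  case (3 n f l)
  then show ?case by auto
next
  case ("4_1" n a K l)
  then obtain Z where "X = (a, Bull) # Z" "length Z = n" "right_path l (Z @ Y) K M'"
    by (cases X) auto
  with "4_1"(1)[of Z K] "4_1"(2) show ?case by auto
next
  case ("4_2" n a K l)
  then obtain Z where "X = (a, Circ) # Z" "length Z = n" "right_path l (Z @ Y) (a \<odot> K) M'"
    by (cases X) auto
  with "4_2"(1)[of Z "a \<odot> K"] "4_2"(2) show ?case by auto
qed auto

text \<open>The list is chosen to represent the context \<open>l\<close> with \<open>t\<close>
  attached on its right, as \<open>row_cells_push\<close> confirms. For a generator all of
  \<open>l\<close> is performed before any new corner appears. This is one of several lists for the
  same cell, hence the lack of literal invariance. Dually, \<open>pull t N r\<close> represents
  \<open>t\<close> followed by \<open>r\<close>.\<close>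

primrec push :: "('o, 'm) cell_term \<Rightarrow> 'o \<Rightarrow> ('o, 'm) row list \<Rightarrow> ('o, 'm) row list" where
  "push (SCorner p a) M l = (case p of
      Circ \<Rightarrow> [Arr (composite M l \<oslash> ident C a), Give a (left_end M l)]
    | Bull \<Rightarrow> [Arr (left_take a l)])"
| "push (RCorner p a) M l = (case p of
      Circ \<Rightarrow> [Arr (left_give a l)]
    | Bull \<Rightarrow> [Arr (composite M l), Take a (left_end M l)])"
| "push (Box f) M l = [Arr (composite M l \<oslash> f)]"
| "push (HId a) M l = [Arr (composite M l \<oslash> ident C a)]"
| "push (VId X) M l = l"
| "push (HComp s t) M l = push t (M \<odot> tm_top C s) (push s M l)"
| "push (VComp s t) M l = (let n = length (tm_left s); k = before n l in
      push s M k @ push t (left_end M k) (after n l))"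

primrec pull :: "('o, 'm) cell_term \<Rightarrow> 'o \<Rightarrow> ('o, 'm) row list \<Rightarrow> ('o, 'm) row list" where
  "pull (SCorner p a) N r = (case p of
      Circ \<Rightarrow> [Arr (right_take a r)]
    | Bull \<Rightarrow> [Arr (ident C a \<oslash> composite N r), Give a (right_end N r)])"
| "pull (RCorner p a) N r = (case p of
      Circ \<Rightarrow> [Arr (composite N r), Take a (right_end N r)]
    | Bull \<Rightarrow> [Arr (right_give a r)])"
| "pull (Box f) N r = [Arr (f \<oslash> composite N r)]"
| "pull (HId a) N r = [Arr (ident C a \<oslash> composite N r)]"
| "pull (VId X) N r = r"
| "pull (HComp s t) N r = pull s (tm_top C t \<odot> N) (pull t N r)"
| "pull (VComp s t) N r = (let n = length (tm_right s); k = before n r in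
      pull s N k @ pull t (right_end N k) (after n r))"

section \<open>Typing and adjointness of the two actions\<close>

lemma push_path:
  "\<lbrakk>wf_term C t; left_path l (tm_left t) M M'\<rbrakk>
    \<Longrightarrow> left_path (push t M l) (tm_right t) (M \<odot> tm_top C t) (M' \<odot> tm_bot C t)"
proof (induction t arbitrary: l M M')
  case (SCorner p a)
  then show ?case
    using composite_left_mor[of l M M'] left_take_mor[of l a M M'] left_path_obs[of l _ M M']
    by (cases p) (auto simp: mor_simps left_end)
next
  case (RCorner p a)
  then show ?case
    using composite_left_mor[of l M M'] left_give_mor[of l a M M'] left_path_obs[of l _ M M']
    by (cases p) (auto simp: mor_simps left_end)
next
  case (Box f)
  then show ?case using composite_left_mor[of l M M'] by (auto simp: mor_simps)
next
  case (HId f)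
  then show ?case using composite_left_mor[of l M M'] left_path_obs[of l _ M M'] by
    (auto simp: mor_simps)
next
  case (VId X)
  then show ?case using left_path_obs[of l X M M'] by (auto simp: mor_simps)
next
  case (HComp s t)
  have "left_path (push t (M \<odot> tm_top C s) (push s M l)) (tm_right t)
      ((M \<odot> tm_top C s) \<odot> tm_top C t) ((M' \<odot> tm_bot C s) \<odot> tm_bot C t)"
    using HComp by auto
  then show ?case
    using HComp.prems left_path_obs[OF HComp.prems(2)] by
      (simp add: mor_simps tm_top_obj tm_bot_obj)
next
  case (VComp s t)
  from left_path_split[of l "tm_left s" "tm_left t" M M'] VComp.prems
  obtain M1 where M1: "left_path (before (length (tm_left s)) l) (tm_left s) M M1"
    "left_path (after (length (tm_left s)) l) (tm_left t) M1 M'" by auto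
  show ?case
    using VComp.IH(1)[OF _ M1(1)] VComp.IH(2)[OF _ M1(2)] VComp.prems
    by (auto simp: Let_def left_end[OF M1(1)] intro: left_path_append)
qed

lemma pull_path:
  "\<lbrakk>wf_term C t; right_path r (tm_right t) N N'\<rbrakk>
    \<Longrightarrow> right_path (pull t N r) (tm_left t) (tm_top C t \<odot> N) (tm_bot C t \<odot> N')"
proof (induction t arbitrary: r N N')
  case (SCorner p a)
  then show ?case
    using composite_right_mor[of r N N'] right_take_mor[of r a N N'] right_path_obs[of r _ N N']
    by (cases p) (auto simp: mor_simps right_end)
next
  case (RCorner p a)
  then show ?case
    using composite_right_mor[of r N N'] right_give_mor[of r a N N'] right_path_obs[of r _ N N']
    by (cases p) (auto simp: mor_simps right_end)
next
  case (Box f)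
  then show ?case using composite_right_mor[of r N N'] by (auto simp: mor_simps)
next
  case (HId f)
  then show ?case using composite_right_mor[of r N N'] right_path_obs[of r _ N N'] by
    (auto simp: mor_simps)
next
  case (VId X)
  then show ?case using right_path_obs[of r X N N'] by (auto simp: mor_simps)
next
  case (HComp s t)
  have "right_path (pull s (tm_top C t \<odot> N) (pull t N r)) (tm_left s)
      (tm_top C s \<odot> tm_top C t \<odot> N) (tm_bot C s \<odot> tm_bot C t \<odot> N')"
    using HComp by auto
  then show ?case
    using HComp.prems right_path_obs[OF HComp.prems(2)] by
      (simp add: mor_simps tm_top_obj tm_bot_obj)
next
  case (VComp s t)
  from right_path_split[of r "tm_right s" "tm_right t" N N'] VComp.prems
  obtain N1 where N1: "right_path (before (length (tm_right s)) r) (tm_right s) N N1"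
    "right_path (after (length (tm_right s)) r) (tm_right t) N1 N'" by auto
  show ?case
    using VComp.IH(1)[OF _ N1(1)] VComp.IH(2)[OF _ N1(2)] VComp.prems
    by (auto simp: Let_def right_end[OF N1(1)] intro: right_path_append)
qed

text \<open>Both sides evaluate the row consisting of \<open>l\<close>, \<open>t\<close> and
  \<open>r\<close>. For a corner one side has no letter left and is computed by
  \<open>run_Nil\<close>, the other has exactly one and is computed by \<open>run_Circ\<close> or
  \<open>run_Bull\<close>. Composites follow by moving the factors across one at a time.\<close>

lemma run_push_pull:
  "\<lbrakk>wf_term C t; left_path l (tm_left t) M M'; right_path r (tm_right t) N N'\<rbrakk>
    \<Longrightarrow> run (M \<odot> tm_top C t) N (push t M l) r = run M (tm_top C t \<odot> N) l (pull t N r)"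
proof (induction t arbitrary: l r M M' N N')
  case (SCorner p a)
  note P = push_path[OF SCorner(1,2)] pull_path[OF SCorner(1,3)]
  note obs = left_path_obs[OF SCorner(2)] right_path_obs[OF SCorner(3)]
  show ?case
  proof (cases p)
    case Circ
    then show ?thesis
      using SCorner P obs composite_left_mor[of l M M'] right_take_mor[of r a N N']
      by (simp add: run_Nil run_Circ[of _ a _ M' _ _ N'] left_end[of l "[]" M M'] tens_ident mor_interchange mor_simps)
  next
    case Bull
    then show ?thesis
      using SCorner P obs composite_right_mor[of r N N'] left_take_mor[of l a M M']
      by (simp add: run_Nil run_Bull[of _ a _ M' _ _ N'] right_end[of r "[]" N N'] mor_simps)
        (simp add: tens_ident mor_interchange mor_simps flip: tens_assoc)
  qed
next
  case (RCorner p a)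
  note P = push_path[OF RCorner(1,2)] pull_path[OF RCorner(1,3)]
  note obs = left_path_obs[OF RCorner(2)] right_path_obs[OF RCorner(3)]
  show ?case
  proof (cases p)
    case Circ
    then show ?thesis
      using RCorner P obs composite_right_mor[of r N N'] left_give_mor[of l a M M']
      by (simp add: run_Nil run_Circ[of _ a _ M' _ _ "a \<odot> N'"] right_end[of r "[]" N N'] mor_simps)
        (simp add: tens_ident mor_interchange mor_simps flip: tens_assoc)
  next
    case Bull
    then show ?thesis
      using RCorner P obs composite_left_mor[of l M M'] right_give_mor[of r a N N']
      by (simp add: run_Nil run_Bull[of _ a _ "M' \<odot> a" _ _ N'] left_end[of l "[]" M M'] tens_ident mor_interchange mor_simps)
  qed
next
  case (Box f)
  have "left_path l [] M M'" "right_path r [] N N'" using Box by auto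
  with push_path[OF Box(1,2)] pull_path[OF Box(1,3)] show ?case
    using Box composite_right_mor[of r N N'] composite_left_mor[of l M M']
    by (simp add: run_Nil[where M' = "M' \<odot> tgt C f" and N' = N'] run_Nil[where M' = M' and N' = "tgt C f \<odot> N'"]
        mor_simps del: run.simps)
next
  case (HId a)
  have "left_path l [] M M'" "right_path r [] N N'" using HId by auto
  with push_path[OF HId(1,2)] pull_path[OF HId(1,3)] show ?case
    using HId composite_right_mor[of r N N'] composite_left_mor[of l M M']
    by (simp add: run_Nil[where M' = "M' \<odot> a" and N' = N'] run_Nil[where M' = M' and N' = "a \<odot> N'"]
        mor_simps del: run.simps)
next
  case (VId X)
  then show ?case using left_path_obs[of l X M M'] right_path_obs[of r X N N'] by
    (simp add: mor_simps)
next
  case (HComp s t)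
  then have st: "wf_term C s" "wf_term C t" "tm_right s = tm_left t"
    and l: "left_path l (tm_left s) M M'" and r: "right_path r (tm_right t) N N'"
    by auto
  have "run (M \<odot> tm_top C (HComp s t)) N (push (HComp s t) M l) r
      = run ((M \<odot> tm_top C s) \<odot> tm_top C t) N (push t (M \<odot> tm_top C s) (push s M l)) r"
    using left_path_obs[OF l] st by (simp add: mor_simps tm_top_obj)
  also have "\<dots> = run (M \<odot> tm_top C s) (tm_top C t \<odot> N) (push s M l) (pull t N r)"
    using HComp.IH(2)[OF st(2) push_path[OF st(1) l, unfolded st(3)] r] .
  also have "\<dots> = run M (tm_top C s \<odot> tm_top C t \<odot> N) l (pull s (tm_top C t \<odot> N) (pull t N r))"
    using HComp.IH(1)[OF st(1) l pull_path[OF st(2) r, folded st(3)]] .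
  finally show ?case
    using right_path_obs[OF r] st by (simp add: mor_simps tm_top_obj)
next
  case (VComp s t)
  let ?l1 = "before (length (tm_left s)) l" and ?l2 = "after (length (tm_left s)) l"
  let ?r1 = "before (length (tm_right s)) r" and ?r2 = "after (length (tm_right s)) r"
  from VComp.prems have st: "wf_term C s" "wf_term C t" "tm_bot C s = tm_top C t"
    by auto
  from VComp.prems left_path_split[of l "tm_left s" "tm_left t" M M']
  obtain M1 where l1: "left_path ?l1 (tm_left s) M M1" and l2: "left_path ?l2 (tm_left t) M1 M'"
    by auto
  from VComp.prems right_path_split[of r "tm_right s" "tm_right t" N N']
  obtain N1 where r1: "right_path ?r1 (tm_right s) N N1" and r2: "right_path ?r2 (tm_right t) N1 N'"
    by auto
  note push = push_path[OF st(1) l1] push_path[OF st(2) l2, folded st(3)]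
  note pull = pull_path[OF st(1) r1] pull_path[OF st(2) r2, folded st(3)]
  have "run (M \<odot> tm_top C (VComp s t)) N (push (VComp s t) M l) r
      = run (M \<odot> tm_top C s) N (push s M ?l1 @ push t M1 ?l2) (?r1 @ ?r2)"
    by (simp add: Let_def left_end[OF l1] before_append_after)
  \<comment> \<open>The left context is cut along the left side of \<open>s\<close>, the right one
    along its right side; \<open>run_append\<close> factors both runs through these cuts.\<close>
  also have "\<dots> = run M (tm_top C s \<odot> N) (?l1 @ ?l2) (pull s N ?r1 @ pull t N1 ?r2)"
    using run_append[OF push(1) r1 push(2) r2] run_append[OF l1 pull(1) l2 pull(2)]
      VComp.IH(1)[OF st(1) l1 r1] VComp.IH(2)[OF st(2) l2 r2, folded st(3)]
    by simp
  finally show ?case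
    by (simp add: Let_def right_end[OF r1] before_append_after)
qed

text \<open>\<open>push\<close> may cut \<open>l @ l'\<close> at another place than the given one.
  Once \<open>s\<close> and \<open>t\<close> have been pulled across, both cuts belong to runs of
  one and the same left context, and \<open>run_append\<close> can split that run at either
  place.\<close>

lemma run_push_VComp:
  assumes "wf_term C (VComp s t)"
    and l: "left_path l (tm_left s) M M1" "left_path l' (tm_left t) M1 M'"
    and r: "right_path r (tm_right s) N N1" "right_path r' (tm_right t) N1 N'"
  shows "run (M \<odot> tm_top C s) N (push (VComp s t) M (l @ l')) (r @ r')
    = run (M \<odot> tm_top C s) N (push s M l) r \<triangleright> run (M1 \<odot> tm_top C t) N1 (push t M1 l') r'"
proof -
  have st: "wf_term C s" "wf_term C t" "tm_bot C s = tm_top C t"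
    using assms(1) by auto
  have ll: "left_path (l @ l') (tm_left s @ tm_left t) M M'"
    and rr: "right_path (r @ r') (tm_right s @ tm_right t) N N'"
    using l r by (auto intro: left_path_append right_path_append)
  from left_path_split[OF ll] obtain M2 where
    k: "left_path (before (length (tm_left s)) (l @ l')) (tm_left s) M M2"
      "left_path (after (length (tm_left s)) (l @ l')) (tm_left t) M2 M'" by auto
  let ?k = "before (length (tm_left s)) (l @ l')" and ?k' = "after (length (tm_left s)) (l @ l')"
  note pull = pull_path[OF st(1) r(1)] pull_path[OF st(2) r(2), folded st(3)]
  have "run (M \<odot> tm_top C s) N (push (VComp s t) M (l @ l')) (r @ r')
      = run (M \<odot> tm_top C s) N (push s M ?k @ push t M2 ?k') (r @ r')"
    by (simp add: Let_def left_end[OF k(1)])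
  also have "\<dots> = run M (tm_top C s \<odot> N) (?k @ ?k') (pull s N r @ pull t N1 r')"
    using run_append[OF push_path[OF st(1) k(1)] r(1) push_path[OF st(2) k(2), folded st(3)] r(2)]
      run_append[OF k(1) pull(1) k(2) pull(2)]
      run_push_pull[OF st(1) k(1) r(1)] run_push_pull[OF st(2) k(2) r(2), folded st(3)]
    by simp
  \<comment> \<open>The two pieces are glued together and split again at the given place.\<close>
  also have "\<dots> = run M (tm_top C s \<odot> N) l (pull s N r)
      \<triangleright> run M1 (tm_top C t \<odot> N1) l' (pull t N1 r')"
    unfolding before_append_after using run_append[OF l(1) pull(1) l(2) pull(2)] st(3) by simp
  finally show ?thesis
    using run_push_pull[OF st(1) l(1) r(1)] run_push_pull[OF st(2) l(2) r(2)] by simp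
qed


section \<open>Invariance of the action\<close>

lemma run_push_Nil:
  assumes "wf_term C t" "tm_left t = []" "tm_right t = []"
    and l: "left_path l [] M M'" and r: "right_path r [] N N'"
  shows "run (M \<odot> tm_top C t) N (push t M l) r = composite (M \<odot> tm_top C t) (push t M l) \<oslash> composite N r"
  using run_Nil[of "push t M l" _ _ r N N'] push_path[OF assms(1), of l M M'] assms by simp

text \<open>Induction on the generation of \<open>cell_eq\<close>. Quantifying over all contexts on
  both sides is essential, because the cases for composites change them.\<close>

lemma run_push_cong:
  "\<lbrakk>cell_eq C s t; left_path l (tm_left s) M M'; right_path r (tm_right s) N N'\<rbrakk>
    \<Longrightarrow> run (M \<odot> tm_top C s) N (push s M l) r = run (M \<odot> tm_top C t) N (push t M l) r"
proof (induction arbitrary: l r M M' N N' rule: cell_eq.induct)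
  case (refl t)
  show ?case ..
next
  case (sym s t)
  then show ?case using cell_eq_boundary[OF sym(1)] by metis
next
  case (trans s t u)
  then show ?case using cell_eq_boundary[OF trans(1)] by metis
next
  case (HComp_cong s s' t t')
  note bs = cell_eq_boundary[OF HComp_cong(1)] and bt = cell_eq_boundary[OF HComp_cong(2)]
  have l: "left_path l (tm_left s) M M'" and r: "right_path r (tm_right t) N N'" using HComp_cong
    by auto
  have st: "wf_term C s" "wf_term C s'" "wf_term C t" "wf_term C t'" using bs bt by auto
  note ls = push_path[OF st(1) l, unfolded HComp_cong(3)]
    and rt = pull_path[OF st(3) r, folded HComp_cong(3)]
  have ls': "left_path (push s' M l) (tm_left t) (M \<odot> tm_top C s) (M' \<odot> tm_bot C s)"
    using push_path[OF st(2)] bs l HComp_cong(3) by metis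
  \<comment> \<open>While \<open>s\<close> is replaced, \<open>t\<close> is held in the right
    context. It is then moved back, and its own induction hypothesis applies to the changed left
    context.\<close>
  have "run ((M \<odot> tm_top C s) \<odot> tm_top C t) N (push t (M \<odot> tm_top C s) (push s M l)) r
      = run (M \<odot> tm_top C s) (tm_top C t \<odot> N) (push s M l) (pull t N r)"
    by (rule run_push_pull[OF st(3) ls r])
  also have "\<dots> = run (M \<odot> tm_top C s) (tm_top C t \<odot> N) (push s' M l) (pull t N r)"
    using HComp_cong(4)[OF l rt] bs by simp
  also have "\<dots> = run ((M \<odot> tm_top C s) \<odot> tm_top C t) N (push t (M \<odot> tm_top C s) (push s' M l)) r"
    by (rule run_push_pull[OF st(3) ls' r, symmetric])
  also have "\<dots> = run ((M \<odot> tm_top C s) \<odot> tm_top C t) N (push t' (M \<odot> tm_top C s) (push s' M l)) r"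
    using HComp_cong(5)[OF ls' r] bt by simp
  finally show ?case
    using bs bt left_path_obs[OF l] by (simp add: ob.m_assoc tm_top_obj)
next
  case (VComp_cong s s' t t')
  note bs = cell_eq_boundary[OF VComp_cong(1)] and bt = cell_eq_boundary[OF VComp_cong(2)]
  from left_path_split[of l "tm_left s" "tm_left t" M M'] VComp_cong(6) obtain l1 l2 M1 where
    l: "left_path l1 (tm_left s) M M1" "left_path l2 (tm_left t) M1 M'" "l = l1 @ l2"
    using before_append_after by (metis tm_left.simps(7))
  from right_path_split[of r "tm_right s" "tm_right t" N N'] VComp_cong(7) obtain r1 r2 N1 where
    r: "right_path r1 (tm_right s) N N1" "right_path r2 (tm_right t) N1 N'" "r = r1 @ r2"
    using before_append_after by (metis tm_right.simps(7))
  have "wf_term C (VComp s t)" "wf_term C (VComp s' t')" using bs bt VComp_cong(3) by auto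
  then show ?case
    using run_push_VComp[of s t l1 M M1 l2 M' r1 N N1 r2 N']
      run_push_VComp[of s' t' l1 M M1 l2 M' r1 N N1 r2 N']
     VComp_cong(4)[OF l(1) r(1)] VComp_cong(5)[OF l(2) r(2)] bs bt l r by simp
next
  case (HComp_assoc s t u)
  then show ?case using left_path_obs[of l _ M M'] by (simp add: mor_simps tm_top_obj)
next
  case (VComp_assoc s t u)
  from left_path_split[of l "tm_left s @ tm_left t" "tm_left u" M M'] VComp_assoc obtain l12 l3 M2
    where
    l': "left_path l12 (tm_left s @ tm_left t) M M2" "left_path l3 (tm_left u) M2 M'" "l = l12 @ l3"
    using before_append_after by (metis tm_left.simps(7))
  from left_path_split[OF l'(1)] obtain l1 l2 M1 where
    l: "left_path l1 (tm_left s) M M1" "left_path l2 (tm_left t) M1 M2" "l12 = l1 @ l2"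
    using before_append_after by metis
  from right_path_split[of r "tm_right s @ tm_right t" "tm_right u" N N'] VComp_assoc obtain r12
    r3 N2 where
    r': "right_path r12 (tm_right s @ tm_right t) N N2" "right_path r3 (tm_right u) N2 N'"
      "r = r12 @ r3"
    using before_append_after by (metis tm_right.simps(7))
  from right_path_split[OF r'(1)] obtain r1 r2 N1 where
    r: "right_path r1 (tm_right s) N N1" "right_path r2 (tm_right t) N1 N2" "r12 = r1 @ r2"
    using before_append_after by metis
  have l23: "left_path (l2 @ l3) (tm_left (VComp t u)) M1 M'" using l l' by
    (auto intro: left_path_append)
  have r23: "right_path (r2 @ r3) (tm_right (VComp t u)) N1 N'" using r r' by
    (auto intro: right_path_append)
  note wf = VComp_assoc(1-5)
  have "run (M \<odot> tm_top C s) N (push (VComp (VComp s t) u) M ((l1 @ l2) @ l3)) ((r1 @ r2) @ r3)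
    = (run (M \<odot> tm_top C s) N (push s M l1) r1 \<triangleright> run (M1 \<odot> tm_top C t) N1 (push t M1 l2) r2)
      \<triangleright> run (M2 \<odot> tm_top C u) N2 (push u M2 l3) r3"
    using run_push_VComp[of "VComp s t" u "l1 @ l2" M M2 l3 M' "r1 @ r2" N N2 r3 N']
      run_push_VComp[of s t l1 M M1 l2 M2 r1 N N1 r2 N2] wf l l' r r' by simp
  moreover have "run (M \<odot> tm_top C s) N (push (VComp s (VComp t u)) M (l1 @ l2 @ l3)) (r1 @ r2 @ r3)
    = run (M \<odot> tm_top C s) N (push s M l1) r1 \<triangleright> run (M1 \<odot> tm_top C t) N1 (push t M1 l2) r2
      \<triangleright> run (M2 \<odot> tm_top C u) N2 (push u M2 l3) r3"
    using run_push_VComp[of t u l2 M1 M2 l3 M' r2 N1 N2 r3 N']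
      run_push_VComp[OF _ l(1) l23 r(1) r23] wf l(2) l'(2) r(2) r'(2) by simp
  ultimately show ?case
    using run_mor[OF push_path[OF wf(1) l(1)] r(1)] run_mor[OF push_path[OF wf(2) l(2)] r(2)]
      run_mor[OF push_path[OF wf(3) l'(2)] r'(2)] l(3) l'(3) r(3) r'(3) wf(4,5)
    by (simp add: mor_assoc)
next
  case (HComp_unit_left t)
  then show ?case using left_path_obs[of l _ M M'] by (simp add: mor_simps tm_top_obj)
next
  case (HComp_unit_right t)
  then show ?case using left_path_obs[of l _ M M'] by (simp add: mor_simps tm_top_obj)
next
  case (VComp_unit_top t)
  then have l: "left_path l (tm_left t) M M'" and r: "right_path r (tm_right t) N N'" by auto
  note o = left_path_obs[OF l] right_path_obs[OF r] tm_top_obj[OF VComp_unit_top(1)]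
  let ?T = "tm_top C t"
  \<comment> \<open>The contexts are cut as \<open>[] @ l\<close> and \<open>[] @ r\<close>, so the
    identity row meets only empty contexts.\<close>
  have 1: "run (M \<odot> ?T) N (push (HId ?T) M []) [] = ident C (M \<odot> ?T \<odot> N)"
    using o by (simp add: mor_simps tens_ident)
  show ?case
    using run_push_VComp[of "HId ?T" t "[]" M M l M' "[]" N N r N', unfolded tm_top.simps 1] o
      VComp_unit_top(1) l r
      run_mor[OF push_path[OF VComp_unit_top(1) l] r] by (simp add: mor_simps)
next
  case (VComp_unit_bot t)
  then have l: "left_path l (tm_left t) M M'" and r: "right_path r (tm_right t) N N'" by auto
  note o = left_path_obs[OF l] right_path_obs[OF r] tm_bot_obj[OF VComp_unit_bot(1)]
  let ?T = "tm_bot C t"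
  have 1: "run (M' \<odot> ?T) N' (push (HId ?T) M' []) [] = ident C (M' \<odot> ?T \<odot> N')"
    using o by (simp add: mor_simps tens_ident)
  show ?case
    using run_push_VComp[of t "HId ?T" l M M' "[]" M' r N N' "[]" N', unfolded tm_top.simps 1] o
      VComp_unit_bot(1) l r
      run_mor[OF push_path[OF VComp_unit_bot(1) l] r] by (simp add: mor_simps)
next
  case (HComp_HId a b)
  then have l: "left_path l [] M M'" and r: "right_path r [] N N'" by auto
  show ?case
    using HComp_HId(1,2) left_path_obs[OF l] right_path_obs[OF r] composite_left_mor[OF l]
    by (simp add: mor_simps mor_interchange flip: tens_ident)
next
  case (VComp_VId X Y)
  then have "left_path l (X @ Y) M M'" "right_path r (X @ Y) N N'" by auto
  from left_path_split[OF this(1)] right_path_split[OF this(2)]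
  obtain l1 l2 M1 r1 r2 N1 where l: "left_path l1 X M M1" "left_path l2 Y M1 M'" "l = l1 @ l2"
    and r: "right_path r1 X N N1" "right_path r2 Y N1 N'" "r = r1 @ r2"
    by (metis before_append_after)
  then show ?case
    using run_push_VComp[of "VId X" "VId Y" l1 M M1 l2 M' r1 N N1 r2 N'] VComp_VId(1,2)
      left_path_obs[OF l(1)] run_append[OF l(1) r(1) l(2) r(2)] by simp
next
  case HId_unit
  then show ?case
    using composite_left_mor[of l M M'] left_path_obs[of l _ M M'] composite_right_mor[of r N N']
    by (simp add: mor_simps run_Nil[where M' = M' and N' = N'] del: run.simps)
next
  case (interchange s t u w)
  then have lr: "left_path l (tm_left s @ tm_left t) M M'"
    "right_path r (tm_right u @ tm_right w) N N'" by auto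
  define l1 l2 r1 r2 where l12: "l1 = before (length (tm_left s)) l"
    "l2 = after (length (tm_left s)) l"
    and r12: "r1 = before (length (tm_right u)) r" "r2 = after (length (tm_right u)) r"
  have l_eq: "l = l1 @ l2" and r_eq: "r = r1 @ r2"
    unfolding l12 r12 by (simp_all add: before_append_after)
  from left_path_split[OF lr(1) HOL.refl] obtain M1 where
    l: "left_path l1 (tm_left s) M M1" "left_path l2 (tm_left t) M1 M'"
    unfolding l12 by auto
  from right_path_split[OF lr(2) HOL.refl] obtain N1 where
    r: "right_path r1 (tm_right u) N N1" "right_path r2 (tm_right w) N1 N'"
    unfolding r12 by auto
  note wf = interchange(1-8)
  have p: "push (VComp s t) M l = push s M l1 @ push t M1 l2"
    using left_end[OF l(1)] unfolding l12 by (simp add: Let_def)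
  note l1 = push_path[OF wf(1) l(1)] and l2 = push_path[OF wf(2) l(2)]
  \<comment> \<open>Pushing \<open>s\<close> over \<open>t\<close> leaves a list in two parts.
    \<open>VComp u w\<close> need not cut it at that seam, but \<open>run_push_VComp\<close> allows
    the seam as the cut.\<close>
  have "run ((M \<odot> tm_top C s) \<odot> tm_top C u) N (push (VComp u w) (M \<odot> tm_top C s) (push s M l1 @ push t M1 l2)) (r1 @ r2)
      = run ((M \<odot> tm_top C s) \<odot> tm_top C u) N (push u (M \<odot> tm_top C s) (push s M l1)) r1
        \<triangleright> run ((M1 \<odot> tm_top C t) \<odot> tm_top C w) N1 (push w (M1 \<odot> tm_top C t) (push t M1 l2)) r2"
    using run_push_VComp[of u w "push s M l1" "M \<odot> tm_top C s" "M1 \<odot> tm_bot C s" "push t M1 l2" _ r1 N N1 r2 N'] l1 l2 wf r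
    by auto
  also have
    "\<dots> = run (M \<odot> tm_top C (HComp s u)) N (push (VComp (HComp s u) (HComp t w)) M (l1 @ l2)) (r1 @ r2)"
    using run_push_VComp[of "HComp s u" "HComp t w" l1 M M1 l2 M' r1 N N1 r2 N'] l wf r
      left_path_obs[OF l(1)]
    by (simp add: ob.m_assoc tm_top_obj)
  finally show ?case
    using p l_eq r_eq wf left_path_obs[OF l(1)] by
      (simp add: ob.m_assoc tm_top_obj del: push.simps(7))
next
  case (yank_Circ_h a)
  then show ?case
    using left_path_obs[of l _ M M'] right_path_obs[of r _ N N'] composite_left_mor[of l M M']
    by (simp add: mor_simps left_end[where M' = M'] tens_ident)
next
  case (yank_Bull_h a)
  then show ?case
    using left_path_obs[of l _ M M'] right_path_obs[of r _ N N'] composite_left_mor[of l M M']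
    by (simp add: mor_simps left_end[where M' = M'] tens_ident)
next
  case (yank_Circ_v a)
  then have a: "a \<in> obs" and l: "left_path l [(a, Circ)] M M'" and r:
    "right_path r [(a, Circ)] N N'"
    by auto
  note mor = left_give_mor[OF l] right_take_mor[OF r] left_path_obs[OF l] right_path_obs[OF r]
  \<comment> \<open>The contexts are cut as \<open>l @ []\<close> and \<open>[] @ r\<close>: the
    r-corner sees all of \<open>l\<close>, the s-corner all of \<open>r\<close>. The two factors are
    those of \<open>run_Circ\<close>.\<close>
  have 1: "run M N (push (RCorner Circ a) M l) [] = left_give a l \<oslash> ident C N"
    using a mor by (simp add: mor_simps tens_ident)
  have "run (M' \<odot> tm_top C (SCorner Circ a)) N (push (SCorner Circ a) M' []) r
      = run M' (tm_top C (SCorner Circ a) \<odot> N) [] (pull (SCorner Circ a) N r)"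
    using a l r mor by (intro run_push_pull) auto
  also have "\<dots> = ident C M' \<oslash> right_take a r"
    using a mor by (simp add: mor_simps tens_ident)
  finally have 2: "run (M' \<odot> a) N (push (SCorner Circ a) M' []) r = ident C M' \<oslash> right_take a r"
    by simp
  have "run M N (push (VComp (RCorner Circ a) (SCorner Circ a)) M l) r
      = run M N (push (RCorner Circ a) M l) [] \<triangleright> run (M' \<odot> a) N (push (SCorner Circ a) M' []) r"
    using run_push_VComp[of "RCorner Circ a" "SCorner Circ a" l M M' "[]" M' "[]" N N r N'] a l r
      mor
    by (simp add: mor_simps del: push.simps)
  then show ?case
    using mor unfolding 1 2 by (simp add: run_Circ[OF l r] del: push.simps(7))
next
  case (yank_Bull_v a)
  then have a: "a \<in> obs" and l: "left_path l [(a, Bull)] M M'" and r: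
    "right_path r [(a, Bull)] N N'"
    by auto
  note mor = left_take_mor[OF l] right_give_mor[OF r] left_path_obs[OF l] right_path_obs[OF r]
  \<comment> \<open>The opposite cut, \<open>[] @ l\<close> and \<open>r @ []\<close>: for
    \<open>Bull\<close> the upper corner has to see the right context, in accordance with
    \<open>run_Bull\<close>.\<close>
  have "run (M \<odot> tm_top C (RCorner Bull a)) N (push (RCorner Bull a) M []) r
      = run M (tm_top C (RCorner Bull a) \<odot> N) [] (pull (RCorner Bull a) N r)"
    using a l r mor by (intro run_push_pull) auto
  also have "\<dots> = ident C M \<oslash> right_give a r"
    using a mor by (simp add: mor_simps tens_ident)
  finally have 1: "run M N (push (RCorner Bull a) M []) r = ident C M \<oslash> right_give a r"
    using mor by simp
  have 2: "run (M \<odot> a) N' (push (SCorner Bull a) M l) [] = left_take a l \<oslash> ident C N'"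
    using a mor by (simp add: mor_simps tens_ident)
  have "run M N (push (VComp (RCorner Bull a) (SCorner Bull a)) M l) r
      = run M N (push (RCorner Bull a) M []) r \<triangleright> run (M \<odot> a) N' (push (SCorner Bull a) M l) []"
    using run_push_VComp[of "RCorner Bull a" "SCorner Bull a" "[]" M M l M' r N N' "[]" N'] a l r
      mor
    by (simp add: mor_simps del: push.simps)
  then show ?case
    using mor unfolding 1 2 by (simp add: run_Bull[OF l r] del: push.simps(7))
next
  case (Box_seq f g)
  then have l: "left_path l [] M M'" and r: "right_path r [] N N'" by auto
  note mor = composite_left_mor[OF l] composite_right_mor[OF r] left_path_obs[OF l]
    right_path_obs[OF r]
  \<comment> \<open>The cut \<open>l @ []\<close>, \<open>r @ []\<close> lets \<open>Box f\<close>
    see both contexts and leaves empty ones for \<open>Box g\<close>.\<close>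
  show ?case
    using run_push_VComp[of "Box f" "Box g" l M M' "[]" M' r N N' "[]" N'] Box_seq(1-3) l r mor
      run_push_Nil[of "Box f" l M M' r N N'] run_push_Nil[of "Box g" "[]" M' M' "[]" N' N']
      run_push_Nil[of "Box (seq C f g)" l M M' r N N']
    by (simp add: mor_simps mor_interchange del: push.simps(7) run.simps)
next
  case (Box_ident a)
  then show ?case by simp
next
  case (Box_tens f g)
  then show ?case
    using left_path_obs[of l _ M M'] right_path_obs[of r _ N N'] composite_left_mor[of l M M']
    by (simp add: mor_simps)
qed


section \<open>Cells with trivial sides\<close>

interpretation F: single_object_double_category "free_cornering C"
  by (rule free_cornering_double_category)

abbreviation fc_hcomp (infixr "\<bar>\<bar>" 60) where
  "\<alpha> \<bar>\<bar> \<beta> \<equiv> hcomp (free_cornering C) \<alpha> \<beta>"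
abbreviation fc_vcomp (infixr "\<parallel>" 60) where
  "\<alpha> \<parallel> \<beta> \<equiv> vcomp (free_cornering C) \<alpha> \<beta>"

section \<open>Generators of the free cornering as cells\<close>

lemma cell_of_boundary:
  "wf_term C t \<Longrightarrow> cell_of C t \<in> cells (free_cornering C)
    \<and> ctop (free_cornering C) (cell_of C t) = tm_top C t \<and> cbot (free_cornering C) (cell_of C t) =
      tm_bot C t
    \<and> cleft (free_cornering C) (cell_of C t) = tm_left t \<and> cright (free_cornering C) (cell_of C t)
      = tm_right t"
  by (auto simp: cells_free_cornering free_cornering_boundary)

lemma generator_cells:
  "f \<in> mor C \<Longrightarrow> box C f \<in> cells_at (free_cornering C) (src C f) (tgt C f) [] []"
  "a \<in> obs \<Longrightarrow> scorner C Circ a \<in> cells_at (free_cornering C) a \<one>\<^bsub>obj C\<^esub> [] [(a, Circ)]"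
  "a \<in> obs \<Longrightarrow> rcorner C Circ a \<in> cells_at (free_cornering C) \<one>\<^bsub>obj C\<^esub> a [(a, Circ)] []"
  "a \<in> obs \<Longrightarrow> scorner C Bull a \<in> cells_at (free_cornering C) a \<one>\<^bsub>obj C\<^esub> [(a, Bull)] []"
  "a \<in> obs \<Longrightarrow> rcorner C Bull a \<in> cells_at (free_cornering C) \<one>\<^bsub>obj C\<^esub> a [] [(a, Bull)]"
  by (auto simp: cells_at_def box_def scorner_def rcorner_def cell_of_boundary)

lemma generator_eqs:
  "a \<in> obs \<Longrightarrow> scorner C Circ a \<bar>\<bar> rcorner C Circ a = hid (free_cornering C) a"
  "a \<in> obs \<Longrightarrow> rcorner C Circ a \<parallel> scorner C Circ a = vid (free_cornering C) [(a, Circ)]"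
  "a \<in> obs \<Longrightarrow> rcorner C Bull a \<bar>\<bar> scorner C Bull a = hid (free_cornering C) a"
  "a \<in> obs \<Longrightarrow> rcorner C Bull a \<parallel> scorner C Bull a = vid (free_cornering C) [(a, Bull)]"
  "\<lbrakk>f \<in> mor C; g \<in> mor C; tgt C f = src C g\<rbrakk> \<Longrightarrow> box C f \<parallel> box C g = box C (f \<triangleright> g)"
  "\<lbrakk>f \<in> mor C; g \<in> mor C\<rbrakk> \<Longrightarrow> box C f \<bar>\<bar> box C g = box C (f \<oslash> g)"
  "a \<in> obs \<Longrightarrow> hid (free_cornering C) a = box C (ident C a)"
  by (auto simp: box_def scorner_def rcorner_def free_cornering_simps
      intro!: cell_of_eqI intro: cell_eq.intros(16-) cell_eq.Box_ident[THEN cell_eq.sym])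

section \<open>Left contexts realised as cells\<close>

primrec row_cells :: "'o \<Rightarrow> ('o, 'm) row list \<Rightarrow> ('o, 'm) cell_term set" where
  "row_cells M [] = hid (free_cornering C) M"
| "row_cells M (x # l) = (case x of
      Arr f \<Rightarrow> box C f \<parallel> row_cells (tgt C f) l
    | Give a K \<Rightarrow> (hid (free_cornering C) K \<bar>\<bar> scorner C Circ a) \<parallel> row_cells K l
    | Take a K \<Rightarrow> (hid (free_cornering C) K \<bar>\<bar> rcorner C Bull a) \<parallel> row_cells (K \<odot> a) l)"

lemmas fc_simps =
  F.cell_simps[unfolded hedges_free_cornering vedges_free_cornering signed_words_simps]
  generator_cells[unfolded F.cells_at_iff]

lemma row_cells_cell:
  "left_path l X M M' \<Longrightarrow> row_cells M l \<in> cells_at (free_cornering C) M M' [] X"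
  by (induction l arbitrary: X M)
    (auto simp: F.cells_at_iff fc_simps src_obj tgt_obj split: row.splits)

lemma row_cells_append:
  "\<lbrakk>left_path l X M M'; left_path l' Y M' M''\<rbrakk>
    \<Longrightarrow> row_cells M (l @ l') = row_cells M l \<parallel> row_cells M' l'"
proof (induction l arbitrary: X M)
  case Nil
  then show ?case using row_cells_cell[of l' Y M' M''] by (simp add: F.cells_at_iff fc_simps)
next
  case (Cons x l)
  note l' = row_cells_cell[OF Cons(3), unfolded F.cells_at_iff]
  show ?case
  proof (cases x)
    case (Arr f)
    with Cons.prems have l: "left_path l X (tgt C f) M'" and "f \<in> mor C" by auto
    with Arr l' Cons.IH[OF l Cons(3)] row_cells_cell[OF l, unfolded F.cells_at_iff] show ?thesis
      by (simp add: fc_simps)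
  next
    case (Give a K)
    with Cons.prems obtain Z where l: "left_path l Z K M'" and "a \<in> obs" "K \<in> obs" by auto
    with Give l' Cons.IH[OF l Cons(3)] row_cells_cell[OF l, unfolded F.cells_at_iff] show ?thesis
      by (simp add: fc_simps)
  next
    case (Take a K)
    with Cons.prems obtain Z where l: "left_path l Z (K \<odot> a) M'" and "a \<in> obs" "K \<in> obs" by auto
    with Take l' Cons.IH[OF l Cons(3)] row_cells_cell[OF l, unfolded F.cells_at_iff] show ?thesis
      by (simp add: fc_simps)
  qed
qed

lemma row_cells_Nil: "left_path l [] M M' \<Longrightarrow> row_cells M l = box C (composite M l)"
  by (induction l arbitrary: M)
    (auto simp: generator_eqs composite_left_mor split: row.splits)

text \<open>The r-corner slides down past the morphisms until it meets the s-corner of the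
  \<open>Give\<close> row and yanks; this is what \<open>left_give\<close> records.\<close>

lemma row_cells_RCirc:
  "left_path l [(a, Circ)] M M' \<Longrightarrow> row_cells M l \<bar>\<bar> rcorner C Circ a = box C (left_give a l)"
proof (induction l arbitrary: M)
  case (Cons x l)
  show ?case
  proof (cases x)
    case (Arr f)
    with Cons.prems have f: "f \<in> mor C" "src C f = M" and l:
      "left_path l [(a, Circ)] (tgt C f) M'" by auto
    have a: "a \<in> obs" using l by (induction l arbitrary: f) (auto split: row.splits)
    note [simp] = row_cells_cell[OF l, unfolded F.cells_at_iff]
    \<comment> \<open>The corner has trivial top, so only the identity on the unit is inserted next
      to \<open>f\<close>.\<close>
    have "(box C f \<parallel> row_cells (tgt C f) l) \<bar>\<bar> (hid (free_cornering C) \<one>\<^bsub>obj C\<^esub> \<parallel> rcorner C Circ a)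
      = (box C f \<bar>\<bar> hid (free_cornering C) \<one>\<^bsub>obj C\<^esub>) \<parallel> (row_cells (tgt C f) l \<bar>\<bar> rcorner C Circ a)"
      using f a by (intro F.interchange) (simp_all add: fc_simps)
    also have "row_cells (tgt C f) l \<bar>\<bar> rcorner C Circ a = box C (left_give a l)"
      by (rule Cons.IH[OF l])
    finally show ?thesis
      using f a Arr left_give_mor[OF l] by (simp add: fc_simps src_obj generator_eqs(5))
  next
    case (Give b K)
    with Cons.prems have [simp]: "b = a" and a: "a \<in> obs" "K \<in> obs" and l: "left_path l [] K M'"
      by auto
    note [simp] = row_cells_cell[OF l, unfolded F.cells_at_iff]
    \<comment> \<open>At the matching row the two corners cancel, and \<open>a\<close> continues
      beside the remaining rows.\<close>
    have "((hid (free_cornering C) K \<bar>\<bar> scorner C Circ a) \<parallel> row_cells K l) \<bar>\<bar> (rcorner C Circ a \<parallel> hid (free_cornering C) a)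
      = ((hid (free_cornering C) K \<bar>\<bar> scorner C Circ a) \<bar>\<bar> rcorner C Circ a) \<parallel>
        (row_cells K l \<bar>\<bar> hid (free_cornering C) a)"
      using a by (intro F.interchange) (simp_all add: fc_simps)
    then have "row_cells M (x # l) \<bar>\<bar> rcorner C Circ a = row_cells K l \<bar>\<bar> hid (free_cornering C) a"
      using a Give by (simp add: fc_simps generator_eqs(1-4))
    then show ?thesis
      using a Give composite_left_mor[OF l] by
        (simp add: row_cells_Nil[OF l] generator_eqs ident_mor)
  qed (use Cons in auto)
qed auto

text \<open>The s-corner has top \<open>a\<close>, so sliding it down puts the identity on
  \<open>a\<close> beside each morphism passed; hence the factor \<open>ident C a\<close> in
  \<open>left_take\<close>.\<close>

lemma row_cells_SBull:
  "left_path l [(a, Bull)] M M' \<Longrightarrow> row_cells M l \<bar>\<bar> scorner C Bull a = box C (left_take a l)"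
proof (induction l arbitrary: M)
  case (Cons x l)
  show ?case
  proof (cases x)
    case (Arr f)
    with Cons.prems have f: "f \<in> mor C" "src C f = M" and l:
      "left_path l [(a, Bull)] (tgt C f) M'" by auto
    have a: "a \<in> obs" using left_take_mor[OF l] by simp
    note [simp] = row_cells_cell[OF l, unfolded F.cells_at_iff]
    have "(box C f \<parallel> row_cells (tgt C f) l) \<bar>\<bar> (hid (free_cornering C) a \<parallel> scorner C Bull a)
      = (box C f \<bar>\<bar> hid (free_cornering C) a) \<parallel> (row_cells (tgt C f) l \<bar>\<bar> scorner C Bull a)"
      using f a by (intro F.interchange) (simp_all add: fc_simps)
    also have "row_cells (tgt C f) l \<bar>\<bar> scorner C Bull a = box C (left_take a l)"
      by (rule Cons.IH[OF l])
    also have "(hid (free_cornering C) a \<parallel> scorner C Bull a) = scorner C Bull a"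
      using a by (simp add: fc_simps)
    finally show ?thesis
      using f a Arr left_take_mor[OF l] by (simp add: generator_eqs tens_mor ident_mor)
  next
    case (Take b K)
    with Cons.prems have [simp]: "b = a" and a: "a \<in> obs" "K \<in> obs" "M = K" and l:
      "left_path l [] (K \<odot> a) M'" by auto
    note [simp] = row_cells_cell[OF l, unfolded F.cells_at_iff]
    have "((hid (free_cornering C) K \<bar>\<bar> rcorner C Bull a) \<parallel> row_cells (K \<odot> a) l)
        \<bar>\<bar> (scorner C Bull a \<parallel> hid (free_cornering C) \<one>\<^bsub>obj C\<^esub>)
      = ((hid (free_cornering C) K \<bar>\<bar> rcorner C Bull a) \<bar>\<bar> scorner C Bull a)
        \<parallel> (row_cells (K \<odot> a) l \<bar>\<bar> hid (free_cornering C) \<one>\<^bsub>obj C\<^esub>)"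
      using a by (intro F.interchange) (simp_all add: fc_simps)
    then have "row_cells M (x # l) \<bar>\<bar> scorner C Bull a = row_cells (K \<odot> a) l"
      using a Take by (simp add: fc_simps generator_eqs(1-4))
    then show ?thesis
      using Take by (simp add: row_cells_Nil[OF l])
  qed (use Cons in auto)
qed auto

text \<open>This ties the combinatorial action to the double category: each clause of
  \<open>push\<close> becomes an equation of cells, obtained from interchange and, where a letter is
  consumed, from horizontal yanking.\<close>

lemma row_cells_push:
  "\<lbrakk>wf_term C t; left_path l (tm_left t) M M'\<rbrakk>
    \<Longrightarrow> row_cells M l \<bar>\<bar> cell_of C t = row_cells (M \<odot> tm_top C t) (push t M l)"
proof (induction t arbitrary: l M M')
  case (SCorner p a)
  show ?case
  proof (cases p)
    case Circ
    with SCorner have a: "a \<in> obs" and l: "left_path l [] M M'" by auto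
    note obs = left_path_obs[OF l] and m = composite_left_mor[OF l]
    \<comment> \<open>The new corner is slid below everything in \<open>l\<close>, as the clause of
      \<open>push\<close> prescribes.\<close>
    have "(box C (composite M l) \<parallel> hid (free_cornering C) M') \<bar>\<bar> (hid (free_cornering C) a \<parallel> scorner C Circ a)
      = (box C (composite M l) \<bar>\<bar> hid (free_cornering C) a) \<parallel>
        (hid (free_cornering C) M' \<bar>\<bar> scorner C Circ a)"
      using a obs m by (intro F.interchange) (simp_all add: fc_simps)
    also have
      "box C (composite M l) \<bar>\<bar> hid (free_cornering C) a = box C (composite M l \<oslash> ident C a)"
      using a m by (simp add: generator_eqs ident_mor)
    finally show ?thesis
      using Circ a obs m by
        (simp add: row_cells_Nil[OF l] left_end[OF l] fc_simps tens_mor ident_mor flip: scorner_def)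
  next
    case Bull
    with SCorner have a: "a \<in> obs" and l: "left_path l [(a, Bull)] M M'" by auto
    show ?thesis
      using Bull row_cells_SBull[OF l] left_take_mor[OF l] by (simp add: fc_simps flip: scorner_def)
  qed
next
  case (RCorner p a)
  show ?case
  proof (cases p)
    case Bull
    with RCorner have a: "a \<in> obs" and l: "left_path l [] M M'" by auto
    note obs = left_path_obs[OF l] and m = composite_left_mor[OF l]
    have "(box C (composite M l) \<parallel> hid (free_cornering C) M') \<bar>\<bar> (hid (free_cornering C) \<one>\<^bsub>obj C\<^esub> \<parallel> rcorner C Bull a)
      = (box C (composite M l) \<bar>\<bar> hid (free_cornering C) \<one>\<^bsub>obj C\<^esub>) \<parallel>
        (hid (free_cornering C) M' \<bar>\<bar> rcorner C Bull a)"
      using a obs m by (intro F.interchange) (simp_all add: fc_simps)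
    then show ?thesis
      using Bull a obs m by
        (simp add: row_cells_Nil[OF l] left_end[OF l] fc_simps flip: rcorner_def)
  next
    case Circ
    with RCorner have a: "a \<in> obs" and l: "left_path l [(a, Circ)] M M'" by auto
    show ?thesis
      using Circ row_cells_RCirc[OF l] left_give_mor[OF l] left_path_obs[OF l] a by
        (simp add: fc_simps flip: rcorner_def)
  qed
next
  case (Box f)
  then have l: "left_path l [] M M'" by simp
  show ?case
    using Box composite_left_mor[OF l] by
      (simp add: row_cells_Nil[OF l] generator_eqs fc_simps tens_mor flip: box_def)
next
  case (HId a)
  then have l: "left_path l [] M M'" by simp
  show ?case
    using HId composite_left_mor[OF l]
    by (simp add: row_cells_Nil[OF l] fc_simps tens_mor ident_mor flip: hid_free_cornering)
      (simp add: generator_eqs fc_simps ident_mor)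
next
  case (VId X)
  then show ?case
    using row_cells_cell[of l X M M'] left_path_obs[of l X M M']
    by (simp add: F.cells_at_iff fc_simps flip: vid_free_cornering)
next
  case (HComp s t)
  then have st: "wf_term C s" "wf_term C t" "tm_right s = tm_left t" and l:
    "left_path l (tm_left s) M M'" by auto
  have "row_cells M l \<bar>\<bar> cell_of C (HComp s t) = (row_cells M l \<bar>\<bar> cell_of C s) \<bar>\<bar> cell_of C t"
    using st row_cells_cell[OF l]
    by (simp add: F.cells_at_iff fc_simps cell_of_boundary flip: hcomp_cell_of)
  then show ?case
    using HComp.IH(1)[OF st(1) l] HComp.IH(2)[OF st(2) push_path[OF st(1) l, unfolded st(3)]]
      left_path_obs[OF l] st
    by (simp add: ob.m_assoc tm_top_obj)
next
  case (VComp s t)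
  let ?l1 = "before (length (tm_left s)) l" and ?l2 = "after (length (tm_left s)) l"
  from VComp.prems have st: "wf_term C s" "wf_term C t" "tm_bot C s = tm_top C t"
    by auto
  from VComp.prems left_path_split[of l "tm_left s" "tm_left t" M M']
  obtain M1 where l: "left_path ?l1 (tm_left s) M M1" "left_path ?l2 (tm_left t) M1 M'"
    by auto
  have "row_cells M l \<bar>\<bar> cell_of C (VComp s t)
      = (row_cells M ?l1 \<parallel> row_cells M1 ?l2) \<bar>\<bar> (cell_of C s \<parallel> cell_of C t)"
    using st row_cells_append[OF l] by (simp add: before_append_after vcomp_cell_of)
  also have "\<dots> = (row_cells M ?l1 \<bar>\<bar> cell_of C s) \<parallel> (row_cells M1 ?l2 \<bar>\<bar> cell_of C t)"
    using st row_cells_cell[OF l(1)] row_cells_cell[OF l(2)]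
    by (intro F.interchange) (simp_all add: F.cells_at_iff cell_of_boundary)
  also have "\<dots> = row_cells (M \<odot> tm_top C s) (push s M ?l1 @ push t M1 ?l2)"
    using row_cells_append[OF push_path[OF st(1) l(1)] push_path[OF st(2) l(2), folded st(3)]]
      VComp.IH(1)[OF st(1) l(1)] VComp.IH(2)[OF st(2) l(2), folded st(3)] st(3) by simp
  finally show ?case
    using left_end[OF l(1)] by (simp add: Let_def)
qed

text \<open>The empty context on the unit is realised by the unit for composition with a cell of
  trivial left side. Pushing \<open>t\<close> through it yields a list with empty word, that is, a
  list of morphisms only.\<close>

lemma box_surj:
  assumes "\<alpha> \<in> cells_at (free_cornering C) a b [] []"
  obtains f where "f \<in> homs C a b" "\<alpha> = box C f"
proof -
  obtain t where t: "wf_term C t" "tm_top C t = a" "tm_bot C t = b" "tm_left t = []"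
    "tm_right t = []" "\<alpha> = cell_of C t"
    using assms by (auto simp: cells_at_def cells_free_cornering free_cornering_boundary)
  note l = push_path[OF t(1), of "[]" "\<one>\<^bsub>obj C\<^esub>" "\<one>\<^bsub>obj C\<^esub>"]
  have "\<alpha> = row_cells \<one>\<^bsub>obj C\<^esub> [] \<bar>\<bar> cell_of C t"
    using t by (simp add: fc_simps cell_of_boundary)
  also have "\<dots> = box C (composite a (push t \<one>\<^bsub>obj C\<^esub> []))"
    using row_cells_push[OF t(1), of "[]" "\<one>\<^bsub>obj C\<^esub>" "\<one>\<^bsub>obj C\<^esub>"] row_cells_Nil l t(2-5)
      tm_top_obj[OF t(1)] by simp
  finally show thesis
    using that[of "composite a (push t \<one>\<^bsub>obj C\<^esub> [])"] l t tm_top_obj[OF t(1)] tm_bot_obj[OF t(1)]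
      composite_left_mor[of "push t \<one>\<^bsub>obj C\<^esub> []" a b] by (simp add: homs_def)
qed

text \<open>Between empty contexts on the unit object, the morphism observed for
  \<open>Box f\<close> is \<open>f\<close> itself.\<close>

lemma box_inj:
  assumes "f \<in> mor C" "g \<in> mor C" "box C f = box C g"
  shows "f = g"
proof -
  have "cell_eq C (Box f) (Box g)"
    using assms cell_of_eq_iff[of "Box f" "Box g"] by (simp add: box_def)
  from run_push_cong[OF this, of "[]" "\<one>\<^bsub>obj C\<^esub>" "\<one>\<^bsub>obj C\<^esub>" "[]" "\<one>\<^bsub>obj C\<^esub>" "\<one>\<^bsub>obj C\<^esub>"]
  show ?thesis
    using assms(1,2) by (simp add: mor_simps)
qed


section \<open>The two functors\<close>

interpretation M: single_object_double_category "hmirror (free_cornering C)"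
  by (rule F.hmirror_double_category)

section \<open>Mates of boxes in the free cornering and in its mirror image\<close>

lemmas edge_simps = hedges_free_cornering vedges_free_cornering signed_words_simps

lemma corner_pair_Circ:
  "a \<in> obs \<Longrightarrow> F.corner_pair a [(a, Circ)] (rcorner C Circ a) (scorner C Circ a)"
  unfolding F.corner_pair_def using generator_cells generator_eqs
  by (simp add: edge_simps)

lemma corner_pair_Bull:
  "a \<in> obs \<Longrightarrow> M.corner_pair a [(a, Bull)] (rcorner C Bull a) (scorner C Bull a)"
  unfolding M.corner_pair_def hmirror_simps using generator_cells generator_eqs
  by (simp add: hmirror_simps edge_simps)

lemma box_vcells:
  "f \<in> homs C a b \<Longrightarrow> box C f \<in> cells_at (free_cornering C) a b [] []"
  using generator_cells(1) by (auto simp: homs_def)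

lemma homs_obs: "f \<in> homs C a b \<Longrightarrow> a \<in> obs \<and> b \<in> obs"
  by (auto simp: homs_def src_obj tgt_obj)

lemma mate_box_hcomp:
  assumes "F.corner_pair a X p q" "F.corner_pair b Y p' q'" "F.corner_pair c Z p'' q''"
    "f \<in> homs C a b" "g \<in> homs C b c"
  shows "F.mate p (box C f) q' \<bar>\<bar> F.mate p' (box C g) q'' = F.mate p (box C (f \<triangleright> g)) q''"
  using F.mate_hcomp[OF assms(1-3), of "box C f" "box C g"] box_vcells[OF assms(4)]
    box_vcells[OF assms(5)] assms(4,5) generator_eqs(5)[of f g]
  by (simp add: edge_simps homs_def)

lemma mate_box_vcomp:
  assumes "F.corner_pair a X p q" "F.corner_pair b Y p' q'" "F.corner_pair c Z p2 q2"
    "F.corner_pair d W p2' q2'"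
    "f \<in> homs C a b" "g \<in> homs C c d"
  shows "F.mate p (box C f) q' \<parallel> F.mate p2 (box C g) q2'
    = F.mate (F.join_in a p p2) (box C (g \<oslash> f)) (F.join_out d q' q2')"
  using F.mate_vcomp[OF assms(1-4), of "box C f" "box C g"] box_vcells[OF assms(5)]
    box_vcells[OF assms(6)] assms(5,6) generator_eqs(6)[of g f]
  by (simp add: edge_simps homs_def)

lemma mate_box_cells:
  assumes "F.corner_pair a X p q" "F.corner_pair b Y p' q'" "f \<in> homs C a b"
  shows "F.mate p (box C f) q' \<in> homs (horizontal_cells (free_cornering C)) X Y"
  using F.mate_cells[OF assms(1,2), of "box C f"] box_vcells[OF assms(3)]
  by (simp add: homs_horizontal_cells hmirror_simps edge_simps)

lemma mate_box_ident:
  assumes "F.corner_pair a X p q" "a \<in> obs"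
  shows "F.mate p (box C (ident C a)) q = vid (free_cornering C) X"
  using F.mate_hid[OF assms(1)] assms(2) by (simp add: generator_eqs)

lemma mate_box_iso:
  assumes p: "F.corner_pair a X p q" "F.corner_pair b Y p' q'"
    and f: "f \<in> homs C a b" "g \<in> homs C b a" "f \<triangleright> g = ident C a" "g \<triangleright> f = ident C b"
  shows "is_iso (horizontal_cells (free_cornering C)) (F.mate p (box C f) q')"
proof -
  let ?H = "horizontal_cells (free_cornering C)"
  have "F.mate p (box C f) q' \<in> homs ?H X Y" "F.mate p' (box C g) q \<in> homs ?H Y X"
    by (rule mate_box_cells[OF p f(1)] mate_box_cells[OF p(2,1) f(2)])+
  then show ?thesis
    unfolding is_iso_def using mate_box_hcomp[OF p p(1) f(1,2)] mate_box_hcomp[OF p(2,1,2) f(2,1)]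
      f(3,4)
      mate_box_ident[OF p(1)] mate_box_ident[OF p(2)] homs_obs[OF f(1)]
    by (auto simp: homs_def horizontal_cells_def intro!: bexI[of _ "F.mate p' (box C g) q"])
qed

text \<open>The mirror reverses horizontal composition; this is the source of the contravariance of
  the \<open>Bull\<close> functor.\<close>

lemma hmirror_mate_box_hcomp:
  assumes "M.corner_pair a X p q" "M.corner_pair b Y p' q'" "M.corner_pair c Z p'' q''"
    "f \<in> homs C a b" "g \<in> homs C b c"
  shows "M.mate p' (box C g) q'' \<bar>\<bar> M.mate p (box C f) q' = M.mate p (box C (f \<triangleright> g)) q''"
  using M.mate_hcomp[OF assms(1-3), of "box C f" "box C g"] box_vcells[OF assms(4)]
    box_vcells[OF assms(5)] assms(4,5) generator_eqs(5)[of f g]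
  by (simp add: hmirror_simps edge_simps homs_def)

text \<open>The mirror also reverses the product of horizontal edges, which undoes the reversal
  caused by joining: \<open>f\<close> and \<open>g\<close> keep their order.\<close>

lemma hmirror_mate_box_vcomp:
  assumes "M.corner_pair a X p q" "M.corner_pair b Y p' q'" "M.corner_pair c Z p2 q2"
    "M.corner_pair d W p2' q2'"
    "f \<in> homs C a b" "g \<in> homs C c d"
  shows "M.mate p (box C f) q' \<parallel> M.mate p2 (box C g) q2'
    = M.mate (M.join_in a p p2) (box C (f \<oslash> g)) (M.join_out d q' q2')"
  using M.mate_vcomp[OF assms(1-4), of "box C f" "box C g"] box_vcells[OF assms(5)]
    box_vcells[OF assms(6)] assms(5,6) generator_eqs(6)[of f g]
  by (simp add: hmirror_simps edge_simps homs_def)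

lemma hmirror_mate_box_cells:
  assumes "M.corner_pair a X p q" "M.corner_pair b Y p' q'" "f \<in> homs C a b"
  shows "M.mate p (box C f) q' \<in> homs (horizontal_cells (free_cornering C)) Y X"
  using M.mate_cells[OF assms(1,2), of "box C f"] box_vcells[OF assms(3)]
  by (simp add: homs_horizontal_cells hmirror_simps edge_simps)

lemma hmirror_mate_box_ident:
  assumes "M.corner_pair a X p q" "a \<in> obs"
  shows "M.mate p (box C (ident C a)) q = vid (free_cornering C) X"
  using M.mate_hid[OF assms(1)] assms(2) by
    (simp add: generator_eqs(7)[symmetric] hmirror_simps edge_simps)

lemma hmirror_mate_box_iso:
  assumes p: "M.corner_pair a X p q" "M.corner_pair a Y p' q'" and a: "a \<in> obs"
  shows "is_iso (horizontal_cells (free_cornering C)) (M.mate p (box C (ident C a)) q')"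
proof -
  let ?H = "horizontal_cells (free_cornering C)"
  note i = ident_homs[OF a]
  have "M.mate p (box C (ident C a)) q' \<in> homs ?H Y X"
    "M.mate p' (box C (ident C a)) q \<in> homs ?H X Y"
    by (rule hmirror_mate_box_cells[OF p i] hmirror_mate_box_cells[OF p(2,1) i])+
  then show ?thesis
    unfolding is_iso_def using hmirror_mate_box_hcomp[OF p p(1) i i]
      hmirror_mate_box_hcomp[OF p(2,1,2) i i]
      hmirror_mate_box_ident[OF p(1)] hmirror_mate_box_ident[OF p(2)] a seq_ident_left[OF i]
    by (auto simp: homs_def horizontal_cells_def intro!: bexI[of _ "M.mate p' (box C (ident C a)) q"])
qed

lemma polar_mor_Circ:
  "f \<in> homs C a b \<Longrightarrow> polar_mor C Circ f = F.mate (rcorner C Circ a) (box C f) (scorner C Circ b)"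
  by (auto simp: polar_mor_def F.mate_def homs_def)

lemma polar_mor_Bull:
  "f \<in> homs C a b \<Longrightarrow> polar_mor C Bull f = M.mate (rcorner C Bull a) (box C f) (scorner C Bull b)"
  by (auto simp: polar_mor_def M.mate_def homs_def hmirror_simps)

lemma homs_opposite: "homs (opposite C) X Y = homs C Y X"
  by (auto simp: homs_def opposite_def)

lemma opposite_strict_monoidal: "strict_monoidal_category (opposite C)"
  apply (rule strict_monoidal_category.intro)
  unfolding homs_opposite
  using obj_monoid src_obj tgt_obj ident_homs tens_homs tens_ident tens_assoc tens_unit_left
    tens_unit_right
  by (auto simp: opposite_def seq_homs seq_assoc seq_ident_left seq_ident_right tens_seq)

section \<open>Fullness and faithfulness\<close>

lemma full_Circ: "full C (horizontal_cells (free_cornering C)) (polar_obj Circ) (polar_mor C Circ)"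
  unfolding full_def
proof (intro ballI)
  fix a b g
  assume a: "a \<in> obs" "b \<in> obs" and g:
    "g \<in> homs (horizontal_cells (free_cornering C)) (polar_obj Circ a) (polar_obj Circ b)"
  have "g \<in> cells_at (free_cornering C) \<one>\<^bsub>hedges (free_cornering C)\<^esub> \<one>\<^bsub>hedges (free_cornering C)\<^esub> [(a, Circ)] [(b, Circ)]"
    using g by (simp add: homs_horizontal_cells polar_obj_def)
  note u = F.mate_unmate[OF corner_pair_Circ corner_pair_Circ this, OF a]
  obtain f where "f \<in> homs C a b" "(scorner C Circ a \<bar>\<bar> g) \<bar>\<bar> rcorner C Circ b = box C f"
    by (rule box_surj[OF u(1)[unfolded edge_simps]])
  then show "\<exists>f \<in> homs C a b. polar_mor C Circ f = g"
    using u(2) polar_mor_Circ by metis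
qed

lemma faithful_Circ: "faithful C (polar_mor C Circ)"
  unfolding faithful_def
proof (intro ballI inj_onI)
  fix a b f g
  assume a: "a \<in> obs" "b \<in> obs" and f: "f \<in> homs C a b" "g \<in> homs C a b" and eq:
    "polar_mor C Circ f = polar_mor C Circ g"
  have "box C f = box C g"
    using F.unmate_mate[OF corner_pair_Circ[OF a(1)] corner_pair_Circ[OF a(2)]] box_vcells f eq
      polar_mor_Circ[OF f(1)] polar_mor_Circ[OF f(2)]
    by (metis signed_words_simps(3) vedges_free_cornering)
  then show "f = g"
    using box_inj f by (auto simp: homs_def)
qed

lemma full_Bull:
  "full (opposite C) (horizontal_cells (free_cornering C)) (polar_obj Bull) (polar_mor C Bull)"
  unfolding full_def homs_opposite
proof (intro ballI)
  fix b a g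
  assume "b \<in> carrier (obj (opposite C))" "a \<in> carrier (obj (opposite C))"
    and g: "g \<in> homs (horizontal_cells (free_cornering C)) (polar_obj Bull b) (polar_obj Bull a)"
  then have a: "a \<in> obs" "b \<in> obs" by (simp_all add: opposite_def)
  have "g \<in> cells_at (hmirror (free_cornering C)) \<one>\<^bsub>hedges (hmirror (free_cornering C))\<^esub>
      \<one>\<^bsub>hedges (hmirror (free_cornering C))\<^esub> [(a, Bull)] [(b, Bull)]"
    using g by (simp add: homs_horizontal_cells polar_obj_def hmirror_simps edge_simps)
  note u = M.mate_unmate[OF corner_pair_Bull corner_pair_Bull this, OF a]
  obtain f where "f \<in> homs C a b" "rcorner C Bull b \<bar>\<bar> g \<bar>\<bar> scorner C Bull a = box C f"
    by (rule box_surj[OF u(1)[unfolded hmirror_simps edge_simps]])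
  then show "\<exists>f \<in> homs C a b. polar_mor C Bull f = g"
    using u(2)[unfolded hmirror_simps] polar_mor_Bull by metis
qed

lemma faithful_Bull: "faithful (opposite C) (polar_mor C Bull)"
  unfolding faithful_def homs_opposite
proof (intro ballI inj_onI)
  fix b a f g
  assume f: "f \<in> homs C a b" "g \<in> homs C a b" and eq: "polar_mor C Bull f = polar_mor C Bull g"
  note a = homs_obs[OF f(1)]
  have *: "box C h \<in> M.vcells a b" if "h \<in> homs C a b" for h
    using box_vcells[OF that] by (simp add: hmirror_simps edge_simps)
  have "box C f = box C g"
    using M.unmate_mate[OF corner_pair_Bull corner_pair_Bull] * f eq polar_mor_Bull[OF f(1)]
      polar_mor_Bull[OF f(2)] a
    by metis
  then show "f = g"
    using box_inj f by (auto simp: homs_def)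
qed

text \<open>The word with letters \<open>a\<close>, \<open>b\<close> differs from the single letter
  \<open>a \<odot> b\<close>, so comparison cells are required. In the mirror the joined corners lie
  over \<open>a \<odot> b\<close>, and the mate of the identity on it compares them with the corners
  of the product.\<close>

lemma strong_monoidal_functor_Bull:
  "strong_monoidal_functor (opposite C) (horizontal_cells (free_cornering C)) (polar_obj Bull) (polar_mor C Bull)
    (\<lambda>a b. M.mate (rcorner C Bull (a \<odot> b)) (box C (ident C (a \<odot> b))) (M.join_out b (scorner C Bull a) (scorner C Bull b)))
    (M.mate (rcorner C Bull \<one>\<^bsub>obj C\<^esub>) (box C (ident C \<one>\<^bsub>obj C\<^esub>)) (hid (free_cornering C) \<one>\<^bsub>obj C\<^esub>))"
  (is "strong_monoidal_functor _ ?H _ _ ?\<mu> ?\<epsilon>")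
proof -
  note P = corner_pair_Bull
  let ?r = "rcorner C Bull" and ?s = "scorner C Bull"
  have PP: "M.corner_pair (a \<odot> b) [(a, Bull), (b, Bull)] (M.join_in a (?r a) (?r b)) (M.join_out b (?s a) (?s b))"
    if "a \<in> obs" "b \<in> obs" for a b
    using M.corner_pair_join[OF P P, OF that] by (simp add: hmirror_simps edge_simps)
  have P1: "M.corner_pair \<one>\<^bsub>obj C\<^esub> [] (hid (free_cornering C) \<one>\<^bsub>obj C\<^esub>) (hid (free_cornering C) \<one>\<^bsub>obj C\<^esub>)"
    using M.corner_pair_unit by (simp add: hmirror_simps edge_simps)
  have H: "obj ?H = signed_words C" "seq ?H = hcomp (free_cornering C)"
    "tens ?H = vcomp (free_cornering C)"
      "ident ?H = vid (free_cornering C)"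
    and O: "obj (opposite C) = obj C" "seq (opposite C) f g = seq C g f"
      "tens (opposite C) = tens C"
      "ident (opposite C) = ident C" for f g
    by (simp_all add: horizontal_cells_def opposite_def edge_simps)
  note i = ident_homs
  show ?thesis
  proof (intro strong_monoidal_functor.intro strong_monoidal_functor_axioms.intro, unfold H O homs_opposite polar_obj_def signed_words_simps)
    show "strict_monoidal_category (opposite C)"
      by (rule opposite_strict_monoidal)
    show "strict_monoidal_category ?H"
      by (rule F.horizontal_cells_strict_monoidal)
  next
    fix a b f assume "f \<in> homs C b a"
    then show "polar_mor C Bull f \<in> homs ?H [(a, Bull)] [(b, Bull)]"
      using hmirror_mate_box_cells[OF P P] homs_obs polar_mor_Bull by metis
  next
    fix a assume a: "a \<in> obs"
    then show "fst ` set [(a, Bull)] \<subseteq> obs" by simp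
    show "polar_mor C Bull (ident C a) = vid (free_cornering C) [(a, Bull)]"
      using hmirror_mate_box_ident[OF P] polar_mor_Bull[OF i] a by simp
  next
    fix x y z f g assume f: "f \<in> homs C y x" and g: "g \<in> homs C z y"
    show "polar_mor C Bull (g \<triangleright> f) = polar_mor C Bull f \<bar>\<bar> polar_mor C Bull g"
      using hmirror_mate_box_hcomp[OF P P P g f] polar_mor_Bull[OF f] polar_mor_Bull[OF g]
        polar_mor_Bull[OF seq_homs[OF g f]] homs_obs f g by simp
  next
    fix a b assume ab: "a \<in> obs" "b \<in> obs"
    then show "?\<mu> a b \<in> homs ?H ([(a, Bull)] @ [(b, Bull)]) [(a \<odot> b, Bull)]"
      using hmirror_mate_box_cells[OF P PP i] by simp
    show "is_iso ?H (?\<mu> a b)"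
      using hmirror_mate_box_iso[OF P PP] ab by simp
  next
    fix f a b g a' b' assume f: "f \<in> homs C b a" and g: "g \<in> homs C b' a'"
    note o = homs_obs[OF f] homs_obs[OF g] and fg = tens_homs[OF f g]
    have t: "polar_mor C Bull f \<parallel> polar_mor C Bull g
        = M.mate (M.join_in b (?r b) (?r b')) (box C (f \<oslash> g)) (M.join_out a' (?s a) (?s a'))"
      using hmirror_mate_box_vcomp[OF P P P P f g] polar_mor_Bull[OF f] polar_mor_Bull[OF g] o by
        simp
    show "(polar_mor C Bull f \<parallel> polar_mor C Bull g) \<bar>\<bar> ?\<mu> b b' = ?\<mu> a a' \<bar>\<bar> polar_mor C Bull (f \<oslash> g)"
      unfolding t using hmirror_mate_box_hcomp[OF P PP PP i fg]
        hmirror_mate_box_hcomp[OF P P PP fg i]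
        polar_mor_Bull[OF fg] o seq_ident_left[OF fg] seq_ident_right[OF fg] by simp
  next
    fix x y z assume o: "x \<in> obs" "y \<in> obs" "z \<in> obs"
    have v: "vid (free_cornering C) [(a, Bull)] = M.mate (?r a) (box C (ident C a)) (?s a)" if
      "a \<in> obs" for a
      using hmirror_mate_box_ident[OF P] that by simp
    \<comment> \<open>Both sides of the associativity law become mates of the identity on
      \<open>x \<odot> y \<odot> z\<close>; \<open>eq\<close> shows that they end in the same
      threefold join.\<close>
    have A: "?\<mu> x y \<parallel> vid (free_cornering C) [(z, Bull)] = M.mate (M.join_in (x \<odot> y) (?r (x \<odot> y)) (?r z))
        (box C (ident C (x \<odot> y \<odot> z))) (M.join_out z (M.join_out y (?s x) (?s y)) (?s z))"
      using hmirror_mate_box_vcomp[OF P PP P P i i] o by (simp add: v tens_ident ob.m_assoc)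
    have B: "vid (free_cornering C) [(x, Bull)] \<parallel> ?\<mu> y z = M.mate (M.join_in x (?r x) (?r (y \<odot> z)))
        (box C (ident C (x \<odot> y \<odot> z))) (M.join_out (y \<odot> z) (?s x) (M.join_out z (?s y) (?s z)))"
      using hmirror_mate_box_vcomp[OF P P P PP i i] o by (simp add: v tens_ident ob.m_assoc)
    have eq: "M.join_out z (M.join_out y (?s x) (?s y)) (?s z) = M.join_out (y \<odot> z) (?s x) (M.join_out z (?s y) (?s z))"
      using M.join_out_assoc[OF P P P, of x y z] o by (simp add: hmirror_simps edge_simps)
    have PX: "M.corner_pair (x \<odot> y \<odot> z) [(x, Bull), (y, Bull), (z, Bull)]
        (M.join_in (x \<odot> y) (M.join_in x (?r x) (?r y)) (?r z))
          (M.join_out (y \<odot> z) (?s x) (M.join_out z (?s y) (?s z)))"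
      using M.corner_pair_join[OF PP P, of x y z] o by
        (simp add: hmirror_simps edge_simps eq ob.m_assoc)
    have PXY: "M.corner_pair (x \<odot> y \<odot> z) [(x \<odot> y, Bull), (z, Bull)]
        (M.join_in (x \<odot> y) (?r (x \<odot> y)) (?r z)) (M.join_out z (?s (x \<odot> y)) (?s z))"
      using PP[of "x \<odot> y" z] o by (simp add: ob.m_assoc)
    show "(?\<mu> x y \<parallel> vid (free_cornering C) [(z, Bull)]) \<bar>\<bar> ?\<mu> (x \<odot> y) z
        = (vid (free_cornering C) [(x, Bull)] \<parallel> ?\<mu> y z) \<bar>\<bar> ?\<mu> x (y \<odot> z)"
      unfolding A B eq
      using hmirror_mate_box_hcomp[OF P PXY PX i i]
        hmirror_mate_box_hcomp[OF P PP PX i i] o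
      by (simp add: ob.m_assoc)
  next
    show "?\<epsilon> \<in> homs ?H [] [(\<one>\<^bsub>obj C\<^esub>, Bull)]"
      using hmirror_mate_box_cells[OF P P1 i] by simp
    show "is_iso ?H ?\<epsilon>"
      using hmirror_mate_box_iso[OF P P1] by simp
  next
    fix a assume a: "a \<in> obs"
    have v: "vid (free_cornering C) [(a, Bull)] = M.mate (?r a) (box C (ident C a)) (?s a)"
      using hmirror_mate_box_ident[OF P] a by simp
    note u = M.join_unit[OF P[OF a], unfolded hmirror_simps edge_simps]
    have 1: "?\<epsilon> \<parallel> vid (free_cornering C) [(a, Bull)]
        = M.mate (M.join_in \<one>\<^bsub>obj C\<^esub> (?r \<one>\<^bsub>obj C\<^esub>) (?r a)) (box C (ident C a)) (?s a)"
      using hmirror_mate_box_vcomp[OF P P1 P P i i] a by (simp add: v u tens_ident)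
    show "(?\<epsilon> \<parallel> vid (free_cornering C) [(a, Bull)]) \<bar>\<bar> ?\<mu> \<one>\<^bsub>obj C\<^esub> a = vid (free_cornering C) [(a, Bull)]"
      unfolding 1 using hmirror_mate_box_hcomp[OF P PP P i i, of "\<one>\<^bsub>obj C\<^esub>" a] a
        seq_ident_left[OF i]
      by (simp add: v)
    have 2: "vid (free_cornering C) [(a, Bull)] \<parallel> ?\<epsilon>
        = M.mate (M.join_in a (?r a) (?r \<one>\<^bsub>obj C\<^esub>)) (box C (ident C a)) (?s a)"
      using hmirror_mate_box_vcomp[OF P P P P1 i i] a by (simp add: v u tens_ident)
    show "(vid (free_cornering C) [(a, Bull)] \<parallel> ?\<epsilon>) \<bar>\<bar> ?\<mu> a \<one>\<^bsub>obj C\<^esub> = vid (free_cornering C) [(a, Bull)]"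
      unfolding 2 using hmirror_mate_box_hcomp[OF P PP P i i, of a "\<one>\<^bsub>obj C\<^esub>"] a
        seq_ident_left[OF i]
      by (simp add: v)
  qed
qed

end

section \<open>Coherence of the braiding and the functor for \<open>Circ\<close>\<close>

context symmetric_strict_monoidal_category
begin

interpretation ob: monoid "obj C"
  by (rule obj_monoid)

text \<open>The hexagon at two units makes the braiding with the unit idempotent, and an invertible
  idempotent is an identity.\<close>

lemma braid_unit:
  assumes "a \<in> obs"
  shows "\<sigma> \<one>\<^bsub>obj C\<^esub> a = ident C a" "\<sigma> a \<one>\<^bsub>obj C\<^esub> = ident C a"
proof -
  have b: "\<sigma> \<one>\<^bsub>obj C\<^esub> a \<in> homs C a a" "\<sigma> a \<one>\<^bsub>obj C\<^esub> \<in> homs C a a"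
    using braid_homs[of "\<one>\<^bsub>obj C\<^esub>" a] braid_homs[of a "\<one>\<^bsub>obj C\<^esub>"] assms by auto
  have 1: "\<sigma> \<one>\<^bsub>obj C\<^esub> a = \<sigma> \<one>\<^bsub>obj C\<^esub> a \<triangleright> \<sigma> \<one>\<^bsub>obj C\<^esub> a"
    using braid_hexagon[of "\<one>\<^bsub>obj C\<^esub>" "\<one>\<^bsub>obj C\<^esub>" a] assms b by
      (simp add: tens_unit_left tens_unit_right homs_def)
  have inv: "\<sigma> \<one>\<^bsub>obj C\<^esub> a \<triangleright> \<sigma> a \<one>\<^bsub>obj C\<^esub> = ident C a"
    using braid_symmetric[of "\<one>\<^bsub>obj C\<^esub>" a] assms by simp
  have "ident C a = (\<sigma> \<one>\<^bsub>obj C\<^esub> a \<triangleright> \<sigma> \<one>\<^bsub>obj C\<^esub> a) \<triangleright> \<sigma> a \<one>\<^bsub>obj C\<^esub>"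
    using inv 1 by simp
  also have "\<dots> = \<sigma> \<one>\<^bsub>obj C\<^esub> a"
    using seq_assoc[OF b(1) b(1) b(2)] inv seq_ident_right[OF b(1)] by simp
  finally show "\<sigma> \<one>\<^bsub>obj C\<^esub> a = ident C a" ..
  then show "\<sigma> a \<one>\<^bsub>obj C\<^esub> = ident C a"
    using inv seq_ident_left[OF b(2)] by simp
qed

text \<open>By symmetry, inverting the factors of the given hexagon yields an inverse of the same
  braiding \<open>?g\<close>; inverses are unique.\<close>

lemma braid_hexagon_right:
  assumes "x \<in> obs" "y \<in> obs" "z \<in> obs"
  shows "\<sigma> z (y \<odot> x) = (\<sigma> z y \<oslash> ident C x) \<triangleright> (ident C y \<oslash> \<sigma> z x)"
proof -
  let ?f = "(\<sigma> z y \<oslash> ident C x) \<triangleright> (ident C y \<oslash> \<sigma> z x)" and ?g = "\<sigma> (y \<odot> x) z"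
  have b: "\<sigma> a b \<in> mor C" "src C (\<sigma> a b) = a \<odot> b" "tgt C (\<sigma> a b) = b \<odot> a" if "a \<in> obs" "b \<in> obs"
    for a b
    using braid_homs[OF that] by (auto simp: homs_def)
  have g: "?g = (ident C y \<oslash> \<sigma> x z) \<triangleright> (\<sigma> y z \<oslash> ident C x)"
    using braid_hexagon[of y x z] assms by simp
  have "?f \<triangleright> ?g = (\<sigma> z y \<oslash> ident C x) \<triangleright> ((ident C y \<oslash> \<sigma> z x) \<triangleright> (ident C y \<oslash> \<sigma> x z)) \<triangleright> (\<sigma> y z \<oslash> ident C x)"
    unfolding g using assms by (simp add: mor_simps b)
  also have "(ident C y \<oslash> \<sigma> z x) \<triangleright> (ident C y \<oslash> \<sigma> x z) = ident C (y \<odot> z \<odot> x)"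
    using assms by (simp add: mor_interchange mor_simps b braid_symmetric tens_ident)
  also have "(\<sigma> z y \<oslash> ident C x) \<triangleright> ident C (y \<odot> z \<odot> x) \<triangleright> (\<sigma> y z \<oslash> ident C x) = ident C (z \<odot> y \<odot> x)"
    using assms by (simp add: mor_interchange mor_simps b braid_symmetric tens_ident)
  finally have fg: "?f \<triangleright> ?g = ident C (z \<odot> y \<odot> x)" .
  have "?f = ?f \<triangleright> ?g \<triangleright> \<sigma> z (y \<odot> x)"
    using assms by (simp add: mor_simps b braid_symmetric)
  also have "\<dots> = (?f \<triangleright> ?g) \<triangleright> \<sigma> z (y \<odot> x)"
    using assms by (simp add: mor_simps b)
  finally show ?thesis
    unfolding fg using assms by (simp add: mor_simps b)
qed

text \<open>What associativity of the \<open>Circ\<close> comparison cells amounts to. After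
  naturality, the two hexagons expand both sides into the same three braidings, which reverse the
  order of \<open>z\<close>, \<open>y\<close>, \<open>x\<close>.\<close>

lemma braid_assoc:
  assumes "x \<in> obs" "y \<in> obs" "z \<in> obs"
  shows "(ident C z \<oslash> \<sigma> y x) \<triangleright> \<sigma> z (x \<odot> y) = (\<sigma> z y \<oslash> ident C x) \<triangleright> \<sigma> (y \<odot> z) x"
proof -
  have b: "\<sigma> a b \<in> mor C" "src C (\<sigma> a b) = a \<odot> b" "tgt C (\<sigma> a b) = b \<odot> a" if "a \<in> obs" "b \<in> obs"
    for a b
    using braid_homs[OF that] by (auto simp: homs_def)
  have "(ident C z \<oslash> \<sigma> y x) \<triangleright> \<sigma> z (x \<odot> y) = \<sigma> z (y \<odot> x) \<triangleright> (\<sigma> y x \<oslash> ident C z)"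
    using assms by (intro braid_natural ident_homs braid_homs)
  then show ?thesis
    using assms by (simp add: braid_hexagon_right[of x y z] braid_hexagon[of y z x] mor_simps b)
qed

interpretation F: single_object_double_category "free_cornering C"
  by (rule free_cornering_double_category)

text \<open>The joined corners of \<open>a\<close> and \<open>b\<close> lie over
  \<open>b \<odot> a\<close>, so the comparison with the corners of \<open>a \<odot> b\<close> is
  the mate of \<open>\<sigma> b a\<close>. Each law for it reduces to a law of the braiding.\<close>

lemma strong_monoidal_functor_Circ:
  "strong_monoidal_functor C (horizontal_cells (free_cornering C)) (polar_obj Circ) (polar_mor C Circ)
    (\<lambda>a b. F.mate (F.join_in a (rcorner C Circ a) (rcorner C Circ b)) (box C (\<sigma> b a)) (scorner C Circ (a \<odot> b)))
    (F.mate (hid (free_cornering C) \<one>\<^bsub>obj C\<^esub>) (box C (ident C \<one>\<^bsub>obj C\<^esub>)) (scorner C Circ \<one>\<^bsub>obj C\<^esub>))"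
  (is "strong_monoidal_functor _ ?H _ _ ?\<mu> ?\<epsilon>")
proof -
  note P = corner_pair_Circ
  let ?r = "rcorner C Circ" and ?s = "scorner C Circ"
  have PP: "F.corner_pair (b \<odot> a) [(a, Circ), (b, Circ)] (F.join_in a (?r a) (?r b)) (F.join_out b (?s a) (?s b))"
    if "a \<in> obs" "b \<in> obs" for a b
    using F.corner_pair_join[OF P P, OF that] by (simp add: edge_simps)
  have P1: "F.corner_pair \<one>\<^bsub>obj C\<^esub> [] (hid (free_cornering C) \<one>\<^bsub>obj C\<^esub>) (hid (free_cornering C) \<one>\<^bsub>obj C\<^esub>)"
    using F.corner_pair_unit by (simp add: edge_simps)
  have H: "obj ?H = signed_words C" "seq ?H = hcomp (free_cornering C)"
    "tens ?H = vcomp (free_cornering C)"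
      "ident ?H = vid (free_cornering C)"
    by (simp_all add: horizontal_cells_def edge_simps)
  note i = ident_homs and b = braid_homs
  show ?thesis
  proof (intro strong_monoidal_functor.intro strong_monoidal_functor_axioms.intro, unfold H polar_obj_def signed_words_simps)
    show "strict_monoidal_category C" ..
    show "strict_monoidal_category ?H"
      by (rule F.horizontal_cells_strict_monoidal)
  next
    fix a b f assume "f \<in> homs C a b"
    then show "polar_mor C Circ f \<in> homs ?H [(a, Circ)] [(b, Circ)]"
      using mate_box_cells[OF P P] homs_obs polar_mor_Circ by metis
  next
    fix a assume a: "a \<in> obs"
    then show "fst ` set [(a, Circ)] \<subseteq> obs" by simp
    show "polar_mor C Circ (ident C a) = vid (free_cornering C) [(a, Circ)]"
      using mate_box_ident[OF P] polar_mor_Circ[OF i] a by simp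
  next
    fix x y z f g assume f: "f \<in> homs C x y" and g: "g \<in> homs C y z"
    show "polar_mor C Circ (f \<triangleright> g) = polar_mor C Circ f \<bar>\<bar> polar_mor C Circ g"
      using mate_box_hcomp[OF P P P f g] polar_mor_Circ[OF f] polar_mor_Circ[OF g]
        polar_mor_Circ[OF seq_homs[OF f g]] homs_obs f g by simp
  next
    fix a c assume ab: "a \<in> obs" "c \<in> obs"
    then show "?\<mu> a c \<in> homs ?H ([(a, Circ)] @ [(c, Circ)]) [(a \<odot> c, Circ)]"
      using mate_box_cells[OF PP P b] by simp
    show "is_iso ?H (?\<mu> a c)"
      using mate_box_iso[OF PP P b b] braid_symmetric ab by simp
  next
    fix f a c g a' c' assume f: "f \<in> homs C a c" and g: "g \<in> homs C a' c'"
    note o = homs_obs[OF f] homs_obs[OF g] and fg = tens_homs[OF f g] and gf = tens_homs[OF g f]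
    have t: "polar_mor C Circ f \<parallel> polar_mor C Circ g
        = F.mate (F.join_in a (?r a) (?r a')) (box C (g \<oslash> f)) (F.join_out c' (?s c) (?s c'))"
      using mate_box_vcomp[OF P P P P f g] polar_mor_Circ[OF f] polar_mor_Circ[OF g] o by simp
    show "(polar_mor C Circ f \<parallel> polar_mor C Circ g) \<bar>\<bar> ?\<mu> c c' = ?\<mu> a a' \<bar>\<bar> polar_mor C Circ (f \<oslash> g)"
      unfolding t using mate_box_hcomp[OF PP PP P gf b] mate_box_hcomp[OF PP P P b fg]
        polar_mor_Circ[OF fg] o braid_natural[OF g f] by simp
  next
    fix x y z assume o: "x \<in> obs" "y \<in> obs" "z \<in> obs"
    have v: "vid (free_cornering C) [(a, Circ)] = F.mate (?r a) (box C (ident C a)) (?s a)" if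
      "a \<in> obs" for a
      using mate_box_ident[OF P] that by simp
    have A: "?\<mu> x y \<parallel> vid (free_cornering C) [(z, Circ)] = F.mate (F.join_in (y \<odot> x) (F.join_in x (?r x) (?r y)) (?r z))
        (box C (ident C z \<oslash> \<sigma> y x)) (F.join_out z (?s (x \<odot> y)) (?s z))"
      using mate_box_vcomp[OF PP P P P b i, of x y z] o by (simp add: v)
    have B: "vid (free_cornering C) [(x, Circ)] \<parallel> ?\<mu> y z = F.mate (F.join_in x (?r x) (F.join_in y (?r y) (?r z)))
        (box C (\<sigma> z y \<oslash> ident C x)) (F.join_out (y \<odot> z) (?s x) (?s (y \<odot> z)))"
      using mate_box_vcomp[OF P P PP P i b, of x y z] o by (simp add: v)
    have eq: "F.join_in x (?r x) (F.join_in y (?r y) (?r z)) = F.join_in (y \<odot> x) (F.join_in x (?r x) (?r y)) (?r z)"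
      using F.join_in_assoc[OF P P P, of x y z] o by (simp add: edge_simps)
    have PX: "F.corner_pair (z \<odot> y \<odot> x) [(x, Circ), (y, Circ), (z, Circ)]
        (F.join_in (y \<odot> x) (F.join_in x (?r x) (?r y)) (?r z))
          (F.join_out z (F.join_out y (?s x) (?s y)) (?s z))"
      using F.corner_pair_join[OF PP P, of x y z] o by (simp add: edge_simps)
    have hA: "ident C z \<oslash> \<sigma> y x \<in> homs C (z \<odot> y \<odot> x) (z \<odot> x \<odot> y)"
      and hB: "\<sigma> z y \<oslash> ident C x \<in> homs C (z \<odot> y \<odot> x) ((y \<odot> z) \<odot> x)"
      using tens_homs[OF i b, of z y x] tens_homs[OF b i, of z y x] o by (simp_all add: ob.m_assoc)
    show "(?\<mu> x y \<parallel> vid (free_cornering C) [(z, Circ)]) \<bar>\<bar> ?\<mu> (x \<odot> y) z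
        = (vid (free_cornering C) [(x, Circ)] \<parallel> ?\<mu> y z) \<bar>\<bar> ?\<mu> x (y \<odot> z)"
      unfolding A B eq
      using mate_box_hcomp[OF PX PP P hA b] mate_box_hcomp[OF PX PP P hB b] o braid_assoc[OF o]
      by (simp add: ob.m_assoc)
  next
    show "?\<epsilon> \<in> homs ?H [] [(\<one>\<^bsub>obj C\<^esub>, Circ)]"
      using mate_box_cells[OF P1 P i] by simp
    show "is_iso ?H ?\<epsilon>"
      using mate_box_iso[OF P1 P i i] seq_ident_left[OF i] by simp
  next
    fix a assume a: "a \<in> obs"
    have v: "vid (free_cornering C) [(a, Circ)] = F.mate (?r a) (box C (ident C a)) (?s a)"
      using mate_box_ident[OF P] a by simp
    note u = F.join_unit[OF P[OF a], unfolded edge_simps]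
    \<comment> \<open>The letter of the unit object is not the empty word: the incoming join
      collapses because the pair of the empty word is an identity, while the outgoing one keeps the
      s-corner of the unit object.\<close>
    have 1: "?\<epsilon> \<parallel> vid (free_cornering C) [(a, Circ)]
        = F.mate (?r a) (box C (ident C a)) (F.join_out a (?s \<one>\<^bsub>obj C\<^esub>) (?s a))"
      using mate_box_vcomp[OF P1 P P P i i] a by (simp add: v u tens_ident)
    show "(?\<epsilon> \<parallel> vid (free_cornering C) [(a, Circ)]) \<bar>\<bar> ?\<mu> \<one>\<^bsub>obj C\<^esub> a = vid (free_cornering C) [(a, Circ)]"
      unfolding 1 using mate_box_hcomp[OF P PP P i i, of a "\<one>\<^bsub>obj C\<^esub>"] a seq_ident_left[OF i]
      by (simp add: v braid_unit)
    have 2: "vid (free_cornering C) [(a, Circ)] \<parallel> ?\<epsilon>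
        = F.mate (?r a) (box C (ident C a)) (F.join_out \<one>\<^bsub>obj C\<^esub> (?s a) (?s \<one>\<^bsub>obj C\<^esub>))"
      using mate_box_vcomp[OF P P P1 P i i] a by (simp add: v u tens_ident)
    show "(vid (free_cornering C) [(a, Circ)] \<parallel> ?\<epsilon>) \<bar>\<bar> ?\<mu> a \<one>\<^bsub>obj C\<^esub> = vid (free_cornering C) [(a, Circ)]"
      unfolding 2 using mate_box_hcomp[OF P PP P i i, of "\<one>\<^bsub>obj C\<^esub>" a] a seq_ident_left[OF i]
      by (simp add: v braid_unit)
  qed
qed

end

theorem lemma6p5:
  fixes A :: "('o, 'm) moncat" and \<sigma> :: "'o \<Rightarrow> 'o \<Rightarrow> 'm"
  assumes "symmetric_strict_monoidal_category A \<sigma>"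
  shows "(\<exists>\<mu> \<epsilon>. strong_monoidal_functor A (horizontal_cells (free_cornering A))
            (polar_obj Circ) (polar_mor A Circ) \<mu> \<epsilon>)
    \<and> (\<exists>\<mu> \<epsilon>. strong_monoidal_functor (opposite A) (horizontal_cells (free_cornering A))
            (polar_obj Bull) (polar_mor A Bull) \<mu> \<epsilon>)
    \<and> full A (horizontal_cells (free_cornering A)) (polar_obj Circ) (polar_mor A Circ)
    \<and> faithful A (polar_mor A Circ)
    \<and> full (opposite A) (horizontal_cells (free_cornering A)) (polar_obj Bull) (polar_mor A Bull)
    \<and> faithful (opposite A) (polar_mor A Bull)"
proof -
  interpret symmetric_strict_monoidal_category A \<sigma> by (rule assms)
  show ?thesis
    using strong_monoidal_functor_Circ strong_monoidal_functor_Bull full_Circ faithful_Circ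
      full_Bull faithful_Bull by blast
qed

end
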